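(* Let $n$ nodes be equally split into $k$ classes of size $\frac nk$ each, let $p,q\in(0,1)$ with $p+q\le1$, let $M\ge2$ be an integer that may vary with $n$, and let $\alpha_{m,n}\in(0,1]$, $m=2,\dots,M$, be sparsity factors. Consider the random hypergraph in which, for each $m=2,\dots,M$, each set of $m$ nodes is an edge, independently, with probability $\alpha_{m,n}(p+q)$ if all $m$ nodes belong to the same class, and with probability $\alpha_{m,n}q$ otherwise. The partitions in this model are identifiable (i.e. $\delta>0$, with $\delta$ as defined in the context) for all $p>0$. In addition, let $(\theta_m)_{m=2}^\infty$ be a non-negative sequence independent of $n$, and assume that for any $n\in\mathbb N$ and $m=2,\dots,M$, the sparsity factor is $$\alpha_{m,n}=\frac{\theta_m n^a(\ln n)^b}{\binom nm}$$ for some $a\ge1$ and $b\ge2$ (so that $\alpha_{m,n}=0$ is allowed here when $\theta_m=0$). There exists an absolute constant $C$ such that, if $$\sum_{m=r}^M m\theta_m\le C\left(\frac{n^{a-1}(\ln n)^{b-2}}{k^{2r-1}}\right)$$ for $r=\min\{m:\theta_m>0\}$, then $\mathsf{Err}(\psi,\psi')=o(n)$ with probability $1-o(1)$, where $\psi'$ is the labelling returned by the spectral hypergraph partitioning algorithm described in the context.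
   Context: Let $\mathcal V=\{1,\dots,n\}$ and let $\psi:\mathcal V\to\{1,\dots,k\}$ be the true class labelling, with $\psi_i=\psi(i)$; $k$ may vary with $n$, and asymptotic notation refers to $n\to\infty$. Let $\xi_1,\xi_2,\dots$ enumerate the subsets of $\mathcal V$ of size between $2$ and $M$, let $h_j\in\{0,1\}$ indicate that $\xi_j$ is an edge, and let $a_{\xi_j}\in\{0,1\}^n$ be the indicator vector of $\xi_j$. **Laplacians.** $D$ is diagonal with $D_{ii}=\sum_j h_j(a_{\xi_j})_i$, $A=\sum_j\frac{h_j}{|\xi_j|}a_{\xi_j}a_{\xi_j}^T$, $L=I-D^{-1/2}AD^{-1/2}$. Let $\mathcal D=\mathsf E[D]$, $\mathcal A=\mathsf E[A]$. **The quantity $\delta$.** $G\in\mathbb R^{k\times k}$ is the symmetric matrix with $G_{\psi_i\psi_j}=\mathcal A_{ij}$ for $i\ne j$ (this depends only on $\psi_i,\psi_j$), $J$ is the diagonal $n\times n$ matrix with $J_{ii}=G_{\psi_i\psi_i}-\mathcal A_{ii}$, and, with $n_{\psi_i}$ the size of the class of node $i$ and $\lambda_{\min}(G)$ the smallest eigenvalue of $G$, $$\delta=\Big(\lambda_{\min}(G)\min_{1\le i\le n}\frac{n_{\psi_i}}{\mathcal D_{ii}}\Big)-\max_{1\le i,j\le n}\Big|\frac{J_{ii}}{\mathcal D_{ii}}-\frac{J_{jj}}{\mathcal D_{jj}}\Big|.$$ **Algorithm.** Let $X\in\mathbb R^{n\times k}$ have as columns orthonormal eigenvectors of $L$ for its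 $k$ smallest eigenvalues; let $\overline X$ be $X$ with rows normalized to unit Euclidean norm; run approximate $k$-means on the rows of $\overline X$, obtaining $S^*\in\mathcal M_{n\times k}(k)$, where $\mathcal M_{n\times k}(t)$ is the set of real $n\times k$ matrices with at most $t$ distinct rows (the rows of $S^*$ are the centers of the clusters). The labels $\psi'$ are the resulting clusters. The $k$-means method is that of Ostrovsky et al. (J. ACM 2012), which has the following guarantee: with $\eta_t(\overline X)=\min_{S\in\mathcal M_{n\times k}(t)}\|\overline X-S\|_F$, if $\eta_k(\overline X)\le\epsilon\,\eta_{k-1}(\overline X)$ for small enough $\epsilon$, then with probability $1-O(\sqrt\epsilon)$, $\|\overline X-S^*\|_F\le\gamma\,\eta_k(\overline X)$ with $\gamma=\sqrt{\frac{1-\epsilon^2}{1-37\epsilon^2}}$. **Error.** $\mathsf{Err}(\psi,\psi')=\min_\sigma\sum_{i=1}^n\mathbf 1\{\psi_i\ne\sigma(\psi'_i)\}$, the minimum over permutations $\sigma$ of the labels. *)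

theory Defs
  imports "HOL-Probability.Probability" "Jordan_Normal_Form.Char_Poly"
begin

text \<open>
  Nodes are \<open>0, \<dots>, n - 1\<close> and class labels are \<open>0, \<dots>, k - 1\<close>, to agree with the matrix indexing.
  A hypergraph is its edge indicator \<open>h :: nat set \<Rightarrow> bool\<close>, of which only the values on
  \<open>potential_edges n M\<close> matter.
\<close>

definition potential_edges :: "nat \<Rightarrow> nat \<Rightarrow> nat set set" where
  "potential_edges n M = {\<xi>. \<xi> \<subseteq> {..<n} \<and> 2 \<le> card \<xi> \<and> card \<xi> \<le> M}"

definition balanced_classes :: "nat \<Rightarrow> nat \<Rightarrow> (nat \<Rightarrow> nat) \<Rightarrow> bool" where
  "balanced_classes n k \<psi> \<longleftrightarrow> 0 < k \<and> k dvd n \<and> (\<forall>i<n. \<psi> i < k) \<and>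
     (\<forall>c<k. card {i. i < n \<and> \<psi> i = c} = n div k)"

definition planted_hypergraph ::
  "nat \<Rightarrow> nat \<Rightarrow> (nat \<Rightarrow> nat) \<Rightarrow> real \<Rightarrow> real \<Rightarrow> (nat \<Rightarrow> real) \<Rightarrow> (nat set \<Rightarrow> bool) pmf" where
  "planted_hypergraph n M \<psi> p q \<alpha> =
     Pi_pmf (potential_edges n M) False
       (\<lambda>\<xi>. bernoulli_pmf
          (if \<forall>i\<in>\<xi>. \<forall>j\<in>\<xi>. \<psi> i = \<psi> j then \<alpha> (card \<xi>) * (p + q) else \<alpha> (card \<xi>) * q))"

definition degree_mat :: "nat \<Rightarrow> nat \<Rightarrow> (nat set \<Rightarrow> bool) \<Rightarrow> real mat" where
  "degree_mat n M h = mat n n (\<lambda>(i, j).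
     if i = j then \<Sum>\<xi>\<in>potential_edges n M. of_bool (h \<xi>) * of_bool (i \<in> \<xi>) else 0)"

definition adjacency_mat :: "nat \<Rightarrow> nat \<Rightarrow> (nat set \<Rightarrow> bool) \<Rightarrow> real mat" where
  "adjacency_mat n M h = mat n n (\<lambda>(i, j).
     \<Sum>\<xi>\<in>potential_edges n M.
       of_bool (h \<xi>) / real (card \<xi>) * (of_bool (i \<in> \<xi>) * of_bool (j \<in> \<xi>)))"

text \<open>For an isolated node the corresponding entry of \<open>D\<^sup>-\<^sup>1\<^sup>/\<^sup>2\<close> is \<open>0\<close>, because \<open>1 / 0 = 0\<close>.\<close>

definition laplacian :: "nat \<Rightarrow> nat \<Rightarrow> (nat set \<Rightarrow> bool) \<Rightarrow> real mat" where
  "laplacian n M h =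
     (let R = mat n n (\<lambda>(i, j). if i = j then 1 / sqrt (degree_mat n M h $$ (i, i)) else 0)
      in 1\<^sub>m n - R * adjacency_mat n M h * R)"

definition expected_mat ::
  "nat \<Rightarrow> (nat set \<Rightarrow> bool) pmf \<Rightarrow> ((nat set \<Rightarrow> bool) \<Rightarrow> real mat) \<Rightarrow> real mat" where
  "expected_mat n H B = mat n n (\<lambda>(i, j). measure_pmf.expectation H (\<lambda>h. B h $$ (i, j)))"

text \<open>
  \<open>class_mat n k \<psi> \<A>\<close> is the matrix \<open>G\<close> with \<open>G(\<psi> i, \<psi> j) = \<A>(i, j)\<close> for \<open>i \<noteq> j\<close>. A diagonal entry
  is determined only if the class has at least two nodes; otherwise \<open>THE\<close> is unspecified.
\<close>

definition class_mat :: "nat \<Rightarrow> nat \<Rightarrow> (nat \<Rightarrow> nat) \<Rightarrow> real mat \<Rightarrow> real mat" where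
  "class_mat n k \<psi> \<A> = mat k k (\<lambda>(c, d).
     THE x. \<exists>i<n. \<exists>j<n. i \<noteq> j \<and> \<psi> i = c \<and> \<psi> j = d \<and> x = \<A> $$ (i, j))"

definition delta :: "nat \<Rightarrow> nat \<Rightarrow> (nat \<Rightarrow> nat) \<Rightarrow> real mat \<Rightarrow> real mat \<Rightarrow> real" where
  "delta n k \<psi> \<D> \<A> =
     (let G = class_mat n k \<psi> \<A>;
          J = (\<lambda>i. G $$ (\<psi> i, \<psi> i) - \<A> $$ (i, i))
      in Min {x. eigenvalue G x} *
           Min ((\<lambda>i. real (card {j. j < n \<and> \<psi> j = \<psi> i}) / \<D> $$ (i, i)) ` {..<n})
         - Max ((\<lambda>(i, j). \<bar>J i / \<D> $$ (i, i) - J j / \<D> $$ (j, j)\<bar>) ` ({..<n} \<times> {..<n})))"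

definition planted_delta ::
  "nat \<Rightarrow> nat \<Rightarrow> nat \<Rightarrow> (nat \<Rightarrow> nat) \<Rightarrow> real \<Rightarrow> real \<Rightarrow> (nat \<Rightarrow> real) \<Rightarrow> real" where
  "planted_delta n k M \<psi> p q \<alpha> =
     (let H = planted_hypergraph n M \<psi> p q \<alpha>
      in delta n k \<psi> (expected_mat n H (degree_mat n M)) (expected_mat n H (adjacency_mat n M)))"

text \<open>
  The list \<open>es\<close> consists of all eigenvalues of \<open>L\<close> with multiplicity, arranged so that its first
  \<open>k\<close> entries are \<open>k\<close> smallest ones. Neither the order of the columns of \<open>X\<close> nor the choice of the
  eigenvectors is prescribed.
\<close>

definition smallest_eigenvectors :: "nat \<Rightarrow> nat \<Rightarrow> real mat \<Rightarrow> real mat \<Rightarrow> bool" where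
  "smallest_eigenvectors n k L X \<longleftrightarrow>
     X \<in> carrier_mat n k \<and> transpose_mat X * X = 1\<^sub>m k \<and>
     (\<exists>es. length es = n \<and> char_poly L = (\<Prod>e\<leftarrow>es. [:- e, 1:]) \<and>
        (\<forall>i<k. \<forall>j\<in>{k..<n}. es ! i \<le> es ! j) \<and>
        (\<forall>j<k. eigenvector L (col X j) (es ! j)))"

text \<open>A zero row is left unchanged, because \<open>x / 0 = 0\<close>.\<close>

definition normalize_rows :: "real mat \<Rightarrow> real mat" where
  "normalize_rows X = mat (dim_row X) (dim_col X)
     (\<lambda>(i, j). X $$ (i, j) / sqrt (\<Sum>l<dim_col X. (X $$ (i, l))\<^sup>2))"

definition frobenius_norm :: "real mat \<Rightarrow> real" where
  "frobenius_norm X = sqrt (\<Sum>i<dim_row X. \<Sum>j<dim_col X. (X $$ (i, j))\<^sup>2)"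

definition few_rows_mats :: "nat \<Rightarrow> nat \<Rightarrow> nat \<Rightarrow> real mat set" where
  "few_rows_mats n k t = {S \<in> carrier_mat n k. card (set (rows S)) \<le> t}"

definition kmeans_eta :: "nat \<Rightarrow> real mat \<Rightarrow> real" where
  "kmeans_eta t X =
     (INF S\<in>few_rows_mats (dim_row X) (dim_col X) t. frobenius_norm (X - S))"

text \<open>
  A randomized \<open>k\<close>-means method maps an \<open>n \<times> k\<close> data matrix to the distribution of its output
  matrix \<open>S\<^sup>*\<close>. The case \<open>k = 1\<close> is excluded from the approximation guarantee, since there is no
  matrix with \<open>n > 0\<close> rows of which at most \<open>0\<close> are distinct.
\<close>

definition kmeans_with_guarantee :: "(real mat \<Rightarrow> real mat pmf) \<Rightarrow> bool" where
  "kmeans_with_guarantee km \<longleftrightarrow>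
     (\<forall>n. \<forall>k\<ge>1. \<forall>X\<in>carrier_mat n k. set_pmf (km X) \<subseteq> few_rows_mats n k k) \<and>
     (\<exists>\<epsilon>\<^sub>0>0. \<exists>K>0. \<forall>\<epsilon>. 0 < \<epsilon> \<and> \<epsilon> \<le> \<epsilon>\<^sub>0 \<longrightarrow>
        (\<forall>n. \<forall>k\<ge>2. \<forall>X\<in>carrier_mat n k. kmeans_eta k X \<le> \<epsilon> * kmeans_eta (k - 1) X \<longrightarrow>
           measure_pmf.prob (km X)
             {S. frobenius_norm (X - S) \<le> sqrt ((1 - \<epsilon>\<^sup>2) / (1 - 37 * \<epsilon>\<^sup>2)) * kmeans_eta k X}
           \<ge> 1 - K * sqrt \<epsilon>))"

text \<open>The numbering of the clusters is arbitrary.\<close>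

definition cluster_labels :: "real mat \<Rightarrow> nat \<Rightarrow> nat" where
  "cluster_labels S = (SOME l. (\<forall>i<dim_row S. l i < dim_col S) \<and>
     (\<forall>i<dim_row S. \<forall>j<dim_row S. l i = l j \<longleftrightarrow> row S i = row S j))"

definition spectral_labels :: "(real mat \<Rightarrow> real mat pmf) \<Rightarrow> real mat \<Rightarrow> (nat \<Rightarrow> nat) pmf" where
  "spectral_labels km X = map_pmf cluster_labels (km (normalize_rows X))"

definition Err :: "nat \<Rightarrow> nat \<Rightarrow> (nat \<Rightarrow> nat) \<Rightarrow> (nat \<Rightarrow> nat) \<Rightarrow> nat" where
  "Err n k \<psi> \<psi>' = Min ((\<lambda>\<sigma>. card {i. i < n \<and> \<psi> i \<noteq> \<sigma> (\<psi>' i)}) ` {\<sigma>. \<sigma> permutes {..<k}})"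

end

theory Submission
  imports
    Defs
    "Jordan_Normal_Form.Spectral_Radius"
    "HOL-Combinatorics.Permutations"
    "HOL-Real_Asymp.Real_Asymp"
begin

text \<open>
  Every edge contributes a rank-one projection to \<open>A\<close>, so resampling one edge changes
  \<open>Z = A - E[A]\<close> by a rank-one matrix. Telescoping the difference of the odd powers gives
  \<open>E tr Z\<^sup>2\<^sup>m\<^sup>+\<^sup>2 \<le> (P\<^sup>2 + 4 P d) E tr Z\<^sup>2\<^sup>m\<close> for \<open>m < P\<close>, where \<open>d\<close> is the expected degree, and
  \<open>P \<approx> ln n\<close> yields \<open>\<parallel>Z\<parallel> = O(sqrt (d ln n))\<close> with high probability. By the Davis-Kahan argument the
  eigenvectors of \<open>L\<close> are then close to the span of the class indicators, so the normalized rows are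
  close on average to \<open>k\<close> well separated centers, and the guarantee of the \<open>k\<close>-means method bounds
  the number of misclassified nodes. The sparsity hypothesis makes the relative error
  \<open>k (d ln n) / (class size \<cdot> gap)\<^sup>2\<close> of order \<open>1 / ln n\<close>, whatever the constant \<open>C\<close>; here \<open>C = 1\<close>.
\<close>

section \<open>Spectral decomposition of real symmetric matrices\<close>

text \<open>The moment recursion reduces a matrix concentration bound to scalar algebra. After
  telescoping, an odd power leaves products of two quadratic forms of even total degree, and these
  can be compared with even powers although the two matrices do not commute. The exponent 2r-1 in
  the hypothesis is 1 + 2(r-1): one factor k counts the eigenvectors whose errors are summed, and
  the squared gap loses k^(2(r-1)), since only about a k^(1-r) fraction of the r-sets through a node
  stays inside its class. Of the two spare factors ln n the noise consumes one; the other drives the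
  relative error \<kappa> to zero. The parameter \<epsilon> of the k-means guarantee must then vary
  with n, like sqrt \<kappa>, because the failure probability of that method is of order sqrt
  \<epsilon>. The estimate of the gap needs classes that are large compared with r. For large n this
  follows from \<alpha> <= 1 together with the sparsity hypothesis, by comparing powers of n and
  k.\<close>

lemma real_symmetric_eigenvalue:
  fixes W :: "real mat"
  assumes W: "W \<in> carrier_mat n n" and sym: "transpose_mat W = W" and n: "0 < n"
  obtains v e where "eigenvector W v e"
proof -
  let ?C = "map_mat complex_of_real W"
  have C: "?C \<in> carrier_mat n n" using W by simp
  obtain z where "z \<in> spectrum ?C" using spectrum_non_empty[OF C n] by blast
  then obtain w where w: "w \<in> carrier_vec n" "w \<noteq> 0\<^sub>v n" and ev: "?C *\<^sub>v w = z \<cdot>\<^sub>v w"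
    using C unfolding spectrum_def eigenvalue_def eigenvector_def by auto
  let ?x = "map_vec Re w" and ?y = "map_vec Im w"
  have x: "?x \<in> carrier_vec n" and y: "?y \<in> carrier_vec n" using w by auto
  have comp: "(\<Sum>j<n. complex_of_real (W $$ (i,j)) * w $ j) = z * w $ i" if i: "i < n" for i
  proof -
    have "(?C *\<^sub>v w) $ i = (z \<cdot>\<^sub>v w) $ i" by (simp only: ev)
    then show ?thesis using i W w(1)
      by (simp add: scalar_prod_def atLeast0LessThan)
  qed
  have ex: "(\<Sum>j<n. W $$ (i,j) * Re (w $ j)) = Re z * Re (w $ i) - Im z * Im (w $ i)"
    and ey: "(\<Sum>j<n. W $$ (i,j) * Im (w $ j)) = Re z * Im (w $ i) + Im z * Re (w $ i)" if "i < n" for i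
    using arg_cong[OF comp[OF that], of Re] arg_cong[OF comp[OF that], of Im] by (simp_all add: Re_sum Im_sum)
  have symW: "W $$ (i,j) = W $$ (j,i)" if "i < n" "j < n" for i j
    using arg_cong[OF sym, of "\<lambda>A. A $$ (i,j)"] that W by simp
  \<comment> \<open>The real-part equation is paired with Im w; by symmetry of W this equals the
    imaginary-part equation paired with Re w. The terms with Re z cancel and leave Im z times
    |w|^2.\<close>
  have "(\<Sum>i<n. Im (w $ i) * (Re z * Re (w $ i) - Im z * Im (w $ i)))
      = (\<Sum>i<n. Im (w $ i) * (\<Sum>j<n. W $$ (i,j) * Re (w $ j)))"
    using ex by simp
  also have "\<dots> = (\<Sum>i<n. \<Sum>j<n. W $$ (i,j) * Re (w $ j) * Im (w $ i))"
    by (simp add: sum_distrib_left mult_ac)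
  also have "\<dots> = (\<Sum>j<n. \<Sum>i<n. W $$ (i,j) * Re (w $ j) * Im (w $ i))"
    by (rule sum.swap)
  also have "\<dots> = (\<Sum>j<n. Re (w $ j) * (\<Sum>i<n. W $$ (j,i) * Im (w $ i)))"
    using symW by (auto simp add: sum_distrib_left mult_ac intro!: sum.cong)
  also have "\<dots> = (\<Sum>j<n. Re (w $ j) * (Re z * Im (w $ j) + Im z * Re (w $ j)))"
    using ey by simp
  finally have "Im z * (\<Sum>i<n. (Re (w $ i))\<^sup>2 + (Im (w $ i))\<^sup>2) = 0"
    by (simp add: algebra_simps sum.distrib sum_subtractf sum_distrib_left power2_eq_square)
  moreover have "(\<Sum>i<n. (Re (w $ i))\<^sup>2 + (Im (w $ i))\<^sup>2) \<noteq> 0"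
  proof
    assume "(\<Sum>i<n. (Re (w $ i))\<^sup>2 + (Im (w $ i))\<^sup>2) = 0"
    then have "\<forall>i<n. (Re (w $ i))\<^sup>2 + (Im (w $ i))\<^sup>2 = 0"
      by (subst (asm) sum_nonneg_eq_0_iff) auto
    then have "\<forall>i<n. w $ i = 0" by (auto simp: complex_eq_iff sum_power2_eq_zero_iff)
    with w show False by auto
  qed
  ultimately have im: "Im z = 0" by simp
  have Wx: "W *\<^sub>v ?x = Re z \<cdot>\<^sub>v ?x"
    by (rule eq_vecI) (use W w ex im in \<open>auto simp: scalar_prod_def atLeast0LessThan\<close>)
  have Wy: "W *\<^sub>v ?y = Re z \<cdot>\<^sub>v ?y"
    by (rule eq_vecI) (use W w ey im in \<open>auto simp: scalar_prod_def atLeast0LessThan\<close>)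
  have "?x \<noteq> 0\<^sub>v n \<or> ?y \<noteq> 0\<^sub>v n"
  proof (rule ccontr)
    assume "\<not> ?thesis"
    then have a: "?x = 0\<^sub>v n" "?y = 0\<^sub>v n" by auto
    have "w $ i = 0" if "i < n" for i
      using arg_cong[OF a(1), of "\<lambda>v. v $ i"] arg_cong[OF a(2), of "\<lambda>v. v $ i"] that w
      by (auto simp: complex_eq_iff)
    with w show False by auto
  qed
  then show ?thesis
    using that[of ?x "Re z"] that[of ?y "Re z"] Wx Wy x y W unfolding eigenvector_def by auto
qed

text \<open>The Householder reflection in the hyperplane orthogonal to \<open>v - e\<^sub>0\<close>.\<close>

lemma orthogonal_first_column:
  fixes v :: "nat \<Rightarrow> real"
  assumes v: "(\<Sum>i<n. (v i)\<^sup>2) = 1"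
  obtains R :: "real mat" where "R \<in> carrier_mat n n" "transpose_mat R = R" "R * R = 1\<^sub>m n"
    "\<And>i. i < n \<Longrightarrow> R $$ (i, 0) = v i"
proof -
  have n: "0 < n" using v by (cases n) auto
  define w where "w = (\<lambda>i. v i - of_bool (i = 0))"
  define c where "c = (\<Sum>i<n. (w i)\<^sup>2)"
  \<comment> \<open>For v = e_0 both w and c vanish, and x / 0 = 0 makes R the identity, as
    desired.\<close>
  define R where "R = Matrix.mat n n (\<lambda>(i,j). of_bool (i = j) - 2 * w i * w j / c)"
  have c_eq: "c = 2 - 2 * v 0"
  proof -
    have "c = (\<Sum>i<n. (v i)\<^sup>2 + of_bool (i = 0) * (1 - 2 * v i))"
      unfolding c_def w_def by (rule sum.cong) (auto simp: power2_eq_square algebra_simps)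
    also have "\<dots> = 2 - 2 * v 0"
      using v n by (simp add: sum.distrib of_bool_def if_distrib[where f = "\<lambda>x. x * _"] sum.If_cases cong: if_cong)
    finally show ?thesis .
  qed
  have c0: "w i = 0" if "c = 0" "i < n" for i
    using that unfolding c_def by (subst (asm) sum_nonneg_eq_0_iff) auto
  have R: "R \<in> carrier_mat n n" by (simp add: R_def)
  have RR: "R * R = 1\<^sub>m n"
  proof (rule eq_matI)
    fix i j assume ij: "i < dim_row (1\<^sub>m n :: real mat)" "j < dim_col (1\<^sub>m n :: real mat)"
    then have ij: "i < n" "j < n" by auto
    have "(R * R) $$ (i,j) = (\<Sum>k<n. (of_bool (i = k) - 2 * w i * w k / c) * (of_bool (k = j) - 2 * w k * w j / c))"
      using ij by (simp add: R_def scalar_prod_def atLeast0LessThan)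
    also have "\<dots> = (\<Sum>k<n. (if k = i then of_bool (i = j) - 2 * w i * w j / c else 0)
        - (if k = j then 2 * w i * w j / c else 0) + 4 * w i * w j / c\<^sup>2 * (w k)\<^sup>2)"
      by (rule sum.cong) (auto simp: power2_eq_square divide_inverse algebra_simps)
    also have "\<dots> = of_bool (i = j) - 4 * w i * w j / c + 4 * w i * w j / c\<^sup>2 * c"
      using ij by (simp add: sum.distrib sum_subtractf c_def sum_distrib_left sum_divide_distrib)
    also have "\<dots> = of_bool (i = j)"
      using c0 ij by (cases "c = 0") (auto simp: power2_eq_square)
    finally show "(R * R) $$ (i,j) = 1\<^sub>m n $$ (i,j)" using ij by simp
  qed (auto simp: R_def)
  have first: "R $$ (i, 0) = v i" if "i < n" for i
  proof (cases "c = 0")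
    case True
    then show ?thesis using c0[OF True that] that n by (simp add: R_def w_def)
  next
    case False
    have "2 * w 0 / c = -1" using False c_eq by (simp add: w_def field_simps)
    then have "2 * w i * w 0 / c = - w i" by (metis (no_types, lifting) mult.commute mult.left_commute mult_minus1_right times_divide_eq_right)
    then show ?thesis using that n by (simp add: R_def w_def)
  qed
  have "transpose_mat R = R" by (rule eq_matI) (auto simp: R_def)
  with that R RR first show ?thesis by blast
qed

text \<open>Deflation: conjugation by a reflection that exchanges a unit eigenvector with the first
  basis vector clears the first row and column off the diagonal, and the induction hypothesis
  diagonalizes the remaining n x n block.\<close>

lemma real_symmetric_diagonalization:
  fixes W :: "real mat"
  assumes "W \<in> carrier_mat n n" and "transpose_mat W = W"
  shows "\<exists>U l. U \<in> carrier_mat n n \<and> transpose_mat U * U = 1\<^sub>m n \<and> W = U * mat_diag n l * transpose_mat U"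
  using assms
proof (induction n arbitrary: W)
  case 0
  then show ?case by (intro exI[of _ "1\<^sub>m 0"] exI[of _ "\<lambda>_. 0"]) auto
next
  case (Suc n)
  let ?N = "Suc n"
  note W = Suc.prems(1) and sym = Suc.prems(2)
  obtain v0 e where ev0: "eigenvector W v0 e" using real_symmetric_eigenvalue[OF W sym] by auto
  then have v0: "v0 \<in> carrier_vec ?N" "v0 \<noteq> 0\<^sub>v ?N" and Wv0: "W *\<^sub>v v0 = e \<cdot>\<^sub>v v0"
    using W unfolding eigenvector_def by auto
  define t where "t = (\<Sum>i<?N. (v0 $ i)\<^sup>2)"
  have t: "t > 0"
  proof -
    have "t \<noteq> 0"
    proof
      assume "t = 0"
      then have "\<forall>i<?N. v0 $ i = 0" unfolding t_def by (subst (asm) sum_nonneg_eq_0_iff) auto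
      with v0 show False by auto
    qed
    moreover have "t \<ge> 0" unfolding t_def by (rule sum_nonneg) simp
    ultimately show ?thesis by simp
  qed
  define v where "v = (\<lambda>i. v0 $ i / sqrt t)"
  have vnorm: "(\<Sum>i<?N. (v i)\<^sup>2) = 1"
  proof -
    have "(\<Sum>i<?N. (v i)\<^sup>2) = (\<Sum>i<?N. (v0 $ i)\<^sup>2) / t"
      unfolding v_def using t by (simp add: power_divide sum_divide_distrib del: sum.lessThan_Suc)
    then show ?thesis using t by (simp add: t_def[symmetric] del: sum.lessThan_Suc)
  qed
  have Wv: "(\<Sum>j<?N. W $$ (i,j) * v j) = e * v i" if i: "i < ?N" for i
  proof -
    have "(W *\<^sub>v v0) $ i = (e \<cdot>\<^sub>v v0) $ i" by (simp only: Wv0)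
    then have "(\<Sum>j<?N. W $$ (i,j) * v0 $ j) = e * v0 $ i" using i W v0
      by (simp add: scalar_prod_def atLeast0LessThan del: sum.lessThan_Suc)
    then have "(\<Sum>j<?N. W $$ (i,j) * v0 $ j) / sqrt t = e * v i" by (simp add: v_def del: sum.lessThan_Suc)
    then show ?thesis by (simp add: v_def sum_divide_distrib del: sum.lessThan_Suc)
  qed
  obtain R where R: "R \<in> carrier_mat ?N ?N" "transpose_mat R = R" "R * R = 1\<^sub>m ?N"
    and R0: "\<And>i. i < ?N \<Longrightarrow> R $$ (i, 0) = v i"
    using orthogonal_first_column[OF vnorm] by metis
  define W' where "W' = R * (W * R)"
  have W': "W' \<in> carrier_mat ?N ?N" using R W by (simp add: W'_def)
  have symW': "transpose_mat W' = W'"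
  proof -
    have "transpose_mat W' = transpose_mat (W * R) * transpose_mat R"
      unfolding W'_def using transpose_mult[OF R(1), of "W * R" ?N] W R by simp
    also have "\<dots> = (transpose_mat R * transpose_mat W) * transpose_mat R"
      using transpose_mult[OF W R(1)] by simp
    also have "\<dots> = W'" using R W sym by (simp add: W'_def assoc_mult_mat[of _ ?N ?N _ ?N _ ?N])
    finally show ?thesis .
  qed
  have WR0: "(W * R) $$ (i, 0) = e * R $$ (i, 0)" if "i < ?N" for i
    using that W R(1) R0 Wv by (simp add: scalar_prod_def atLeast0LessThan del: sum.lessThan_Suc)
  have col0: "W' $$ (i, 0) = e * of_bool (i = 0)" if i: "i < ?N" for i
  proof -
    have "W' $$ (i, 0) = (\<Sum>j<?N. R $$ (i,j) * (W * R) $$ (j, 0))"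
      using i W R(1) by (simp add: W'_def scalar_prod_def atLeast0LessThan del: sum.lessThan_Suc)
    also have "\<dots> = e * (\<Sum>j<?N. R $$ (i,j) * R $$ (j, 0))"
      using WR0 by (simp add: sum_distrib_left mult_ac del: sum.lessThan_Suc)
    also have "(\<Sum>j<?N. R $$ (i,j) * R $$ (j, 0)) = (R * R) $$ (i, 0)"
      using i R(1) by (simp add: scalar_prod_def atLeast0LessThan del: sum.lessThan_Suc)
    finally show ?thesis using i by (simp add: R(3))
  qed
  have row0: "W' $$ (0, i) = e * of_bool (i = 0)" if i: "i < ?N" for i
    using arg_cong[OF symW', of "\<lambda>A. A $$ (0,i)"] col0[OF i] i W' by simp
  define V where "V = Matrix.mat n n (\<lambda>(i,j). W' $$ (Suc i, Suc j))"
  have V: "V \<in> carrier_mat n n" by (simp add: V_def)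
  have "V $$ (i,j) = V $$ (j,i)" if "i < n" "j < n" for i j
    using arg_cong[OF symW', of "\<lambda>A. A $$ (Suc i,Suc j)"] that W' by (simp add: V_def)
  then have symV: "transpose_mat V = V" by (intro eq_matI) (auto simp: V_def)
  obtain U l where U: "U \<in> carrier_mat n n" "transpose_mat U * U = 1\<^sub>m n"
    and VU: "V = U * mat_diag n l * transpose_mat U"
    using Suc.IH[OF V symV] by blast
  define Q where "Q = four_block_mat (1\<^sub>m 1) (0\<^sub>m 1 n) (0\<^sub>m n 1) U"
  define l' where "l' = case_nat e l"
  have Q: "Q \<in> carrier_mat ?N ?N" unfolding Q_def using U four_block_carrier_mat[of "1\<^sub>m 1" 1 1 U n n] by simp
  have tQ: "transpose_mat Q = four_block_mat (1\<^sub>m 1) (0\<^sub>m 1 n) (0\<^sub>m n 1) (transpose_mat U)"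
    unfolding Q_def using U by (subst transpose_four_block_mat[of _ 1 1 _ n _ n]) auto
  have QQ: "transpose_mat Q * Q = 1\<^sub>m ?N"
    unfolding tQ unfolding Q_def using U
    by (subst mult_four_block_mat[of _ 1 1 _ n _ n _ _ 1 _ n]) (auto simp: one_mat_def[symmetric])
  have dia: "mat_diag ?N l' = four_block_mat (e \<cdot>\<^sub>m 1\<^sub>m 1) (0\<^sub>m 1 n) (0\<^sub>m n 1) (mat_diag n l)"
    by (rule eq_matI) (auto simp: mat_diag_def l'_def split: nat.split)
  have W'_eq: "W' = four_block_mat (e \<cdot>\<^sub>m 1\<^sub>m 1) (0\<^sub>m 1 n) (0\<^sub>m n 1) V"
  proof (rule eq_matI)
    fix i j assume "i < dim_row (four_block_mat (e \<cdot>\<^sub>m 1\<^sub>m 1) (0\<^sub>m 1 n) (0\<^sub>m n 1) V)"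
      "j < dim_col (four_block_mat (e \<cdot>\<^sub>m 1\<^sub>m 1) (0\<^sub>m 1 n) (0\<^sub>m n 1) V)"
    then have ij: "i < ?N" "j < ?N" using V by auto
    then show "W' $$ (i,j) = four_block_mat (e \<cdot>\<^sub>m 1\<^sub>m 1) (0\<^sub>m 1 n) (0\<^sub>m n 1) V $$ (i,j)"
      using V col0[of i] row0[of j] by (cases i; cases j) (auto simp: V_def)
  qed (use V W' in auto)
  have D: "mat_diag n l \<in> carrier_mat n n" and tU: "transpose_mat U \<in> carrier_mat n n" using U by auto
  have z: "0\<^sub>m (Suc 0) n * mat_diag n l = 0\<^sub>m (Suc 0) n" "0\<^sub>m (Suc 0) n * transpose_mat U = 0\<^sub>m (Suc 0) n"
    "U * mat_diag n l * 0\<^sub>m n (Suc 0) = 0\<^sub>m n (Suc 0)" "U * 0\<^sub>m n (Suc 0) = 0\<^sub>m n (Suc 0)"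
    using left_mult_zero_mat[OF D] left_mult_zero_mat[OF tU] right_mult_zero_mat[OF U(1)]
      right_mult_zero_mat[OF mult_carrier_mat[OF U(1) D]] by auto
  have "Q * mat_diag ?N l' = four_block_mat (e \<cdot>\<^sub>m 1\<^sub>m 1) (0\<^sub>m 1 n) (0\<^sub>m n 1) (U * mat_diag n l)"
    unfolding Q_def dia using U D z
    by (subst mult_four_block_mat[of _ 1 1 _ n _ n _ _ 1 _ n]) auto
  then have "Q * mat_diag ?N l' * transpose_mat Q = W'"
    unfolding tQ W'_eq VU using U D z
    by (simp, subst mult_four_block_mat[of _ 1 1 _ n _ n _ _ 1 _ n]) auto
  then have eq: "W' = Q * mat_diag ?N l' * transpose_mat Q" by simp
  have "W = R * W' * R"
  proof -
    have "R * W' * R = (R * R) * W * (R * R)"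
      unfolding W'_def using R(1) W by (simp add: assoc_mult_mat[of _ ?N ?N _ ?N _ ?N])
    then show ?thesis using R W by simp
  qed
  moreover have conj: "R * W' * R = (R * Q) * mat_diag ?N l' * (transpose_mat Q * R)"
  proof -
    have QD: "Q * mat_diag ?N l' \<in> carrier_mat ?N ?N" and tQ': "transpose_mat Q \<in> carrier_mat ?N ?N"
      using Q by auto
    have "R * W' * R = R * (Q * mat_diag ?N l') * transpose_mat Q * R"
      unfolding eq using assoc_mult_mat[OF R(1) QD tQ'] by simp
    also have "\<dots> = R * (Q * mat_diag ?N l') * (transpose_mat Q * R)"
      by (rule assoc_mult_mat[OF mult_carrier_mat[OF R(1) QD] tQ' R(1)])
    also have "R * (Q * mat_diag ?N l') = R * Q * mat_diag ?N l'"
      by (rule assoc_mult_mat[OF R(1) Q mat_diag_dim, symmetric])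
    finally show ?thesis .
  qed
  moreover have tRQ: "transpose_mat (R * Q) = transpose_mat Q * R"
    using transpose_mult[OF R(1) Q] R(2) by simp
  ultimately have "W = (R * Q) * mat_diag ?N l' * transpose_mat (R * Q)"
    using conj by simp
  moreover have "transpose_mat (R * Q) * (R * Q) = 1\<^sub>m ?N"
  proof -
    have "transpose_mat (R * Q) * (R * Q) = transpose_mat Q * ((R * R) * Q)"
      unfolding \<open>transpose_mat (R * Q) = transpose_mat Q * R\<close>
      using R(1) Q by (simp add: assoc_mult_mat[of _ ?N ?N _ ?N _ ?N])
    then show ?thesis using R(3) Q QQ by simp
  qed
  ultimately show ?case using R(1) Q by (intro exI[of _ "R * Q"] exI[of _ l']) auto
qed

section \<open>Vectors as functions on indices, inner products and eigenbases\<close>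

definition ip :: "nat \<Rightarrow> (nat \<Rightarrow> real) \<Rightarrow> (nat \<Rightarrow> real) \<Rightarrow> real" where
  "ip n x y = (\<Sum>i<n. x i * y i)"

definition mv :: "nat \<Rightarrow> (nat \<Rightarrow> nat \<Rightarrow> real) \<Rightarrow> (nat \<Rightarrow> real) \<Rightarrow> nat \<Rightarrow> real" where
  "mv n W x = (\<lambda>i. \<Sum>j<n. W i j * x j)"

definition symm :: "nat \<Rightarrow> (nat \<Rightarrow> nat \<Rightarrow> real) \<Rightarrow> bool" where
  "symm n W \<longleftrightarrow> (\<forall>i<n. \<forall>j<n. W i j = W j i)"

text \<open>The number \<open>u j i\<close> is the i-th coordinate of the j-th vector. Completeness
  is recorded beside orthonormality: the former yields Parseval's identity, the latter turns traces
  into sums over eigenvalues.\<close>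

definition eigenbasis :: "nat \<Rightarrow> (nat \<Rightarrow> nat \<Rightarrow> real) \<Rightarrow> (nat \<Rightarrow> nat \<Rightarrow> real) \<Rightarrow> (nat \<Rightarrow> real) \<Rightarrow> bool" where
  "eigenbasis n W u l \<longleftrightarrow>
     (\<forall>j<n. \<forall>i<n. mv n W (u j) i = l j * u j i) \<and>
     (\<forall>i<n. \<forall>k<n. (\<Sum>j<n. u j i * u j k) = of_bool (i = k)) \<and>
     (\<forall>j<n. \<forall>k<n. ip n (u j) (u k) = of_bool (j = k))"

text \<open>The characteristic polynomial is kept because \<open>smallest_eigenvectors\<close>
  speaks of its roots with multiplicity, which have to be matched with the
  \<open>l j\<close>.\<close>

lemma eigenbasis_exists:
  assumes sym: "symm n W"
  obtains u l where "eigenbasis n W u l"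
    "char_poly (Matrix.mat n n (\<lambda>(i,j). W i j)) = (\<Prod>j<n. [:- l j, 1:])"
proof -
  let ?W = "Matrix.mat n n (\<lambda>(i,j). W i j)"
  have W: "?W \<in> carrier_mat n n" by simp
  have "transpose_mat ?W = ?W" by (rule eq_matI) (use sym in \<open>auto simp: symm_def\<close>)
  then obtain U l where U: "U \<in> carrier_mat n n" "transpose_mat U * U = 1\<^sub>m n"
    and WU: "?W = U * mat_diag n l * transpose_mat U"
    using real_symmetric_diagonalization[OF W] by blast
  have tU: "transpose_mat U \<in> carrier_mat n n" using U by simp
  have UU: "U * transpose_mat U = 1\<^sub>m n" using mat_mult_left_right_inverse[OF tU U(1) U(2)] .
  define u where "u = (\<lambda>j i. U $$ (i,j))"
  have "?W * U = U * mat_diag n l * (transpose_mat U * U)"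
    unfolding WU by (rule assoc_mult_mat[of _ n n _ n _ n]) (use U(1) in auto)
  also have "\<dots> = U * mat_diag n l" using U right_mult_one_mat[of "U * mat_diag n l" n n] by simp
  finally have WUeq: "?W * U = U * mat_diag n l" .
  have "mv n W (u j) i = l j * u j i" if "j < n" "i < n" for i j
  proof -
    have "mv n W (u j) i = (?W * U) $$ (i,j)"
      using that U(1) by (simp add: mv_def u_def scalar_prod_def atLeast0LessThan)
    also have "\<dots> = l j * u j i"
      unfolding WUeq mat_diag_mult_right[OF U(1)] using that by (simp add: u_def)
    finally show ?thesis .
  qed
  moreover have "(\<Sum>j<n. u j i * u j k) = of_bool (i = k)" if "i < n" "k < n" for i k
    using arg_cong[OF UU, of "\<lambda>A. A $$ (i,k)"] that U(1)
    by (simp add: u_def scalar_prod_def atLeast0LessThan)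
  moreover have "ip n (u j) (u k) = of_bool (j = k)" if "j < n" "k < n" for j k
    using arg_cong[OF U(2), of "\<lambda>A. A $$ (j,k)"] that U(1)
    by (simp add: u_def ip_def scalar_prod_def atLeast0LessThan)
  ultimately have "eigenbasis n W u l" unfolding eigenbasis_def by blast
  moreover have "char_poly ?W = (\<Prod>j<n. [:- l j, 1:])"
  proof -
    have "similar_mat ?W (mat_diag n l)"
      unfolding similar_mat_def
      by (intro exI, rule similar_mat_witI[OF UU U(2) WU W mat_diag_dim U(1) tU])
    then have "char_poly ?W = char_poly (mat_diag n l)" by (rule char_poly_similar)
    also have "\<dots> = (\<Prod>a\<leftarrow>diag_mat (mat_diag n l). [:- a, 1:])"
      by (rule char_poly_upper_triangular[OF mat_diag_dim]) (auto simp: mat_diag_def upper_triangular_def)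
    also have "diag_mat (mat_diag n l) = map l [0..<n]"
      by (auto simp: diag_mat_def mat_diag_def)
    also have "(\<Prod>a\<leftarrow>map l [0..<n]. [:- a, 1:]) = (\<Prod>j<n. [:- l j, 1:])"
      by (simp add: prod.list_conv_set_nth atLeast0LessThan)
    finally show ?thesis .
  qed
  ultimately show ?thesis using that by blast
qed

lemma eigenbasis_ex:
  assumes "symm n W"
  shows "\<exists>u l. eigenbasis n W u l"
proof (rule eigenbasis_exists[OF assms])
  fix u l assume "eigenbasis n W u l"
  then show ?thesis by blast
qed

lemma ip_commute: "ip n x y = ip n y x"
  by (simp add: ip_def mult.commute)

lemma ip_self_nonneg: "0 \<le> ip n x x"
  by (auto simp: ip_def intro: sum_nonneg)

lemma ip_cong: "(\<And>i. i < n \<Longrightarrow> x i = x' i) \<Longrightarrow> (\<And>i. i < n \<Longrightarrow> y i = y' i) \<Longrightarrow> ip n x y = ip n x' y'"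
  by (auto simp: ip_def)

lemma ip_add_right: "ip n z (\<lambda>i. x i + y i) = ip n z x + ip n z y"
  by (simp add: ip_def sum.distrib algebra_simps)

lemma ip_diff_left: "ip n (\<lambda>i. x i - y i) z = ip n x z - ip n y z"
  by (simp add: ip_def sum_subtractf algebra_simps)

lemma ip_diff_right: "ip n z (\<lambda>i. x i - y i) = ip n z x - ip n z y"
  by (simp add: ip_def sum_subtractf algebra_simps)

lemma ip_scale_left: "ip n (\<lambda>i. c * x i) y = c * ip n x y"
  by (simp add: ip_def sum_distrib_left mult_ac)

lemma ip_scale_right: "ip n x (\<lambda>i. c * y i) = c * ip n x y"
  by (simp add: ip_def sum_distrib_left mult_ac)

lemma ip_sum_right: "ip n x (\<lambda>i. \<Sum>k\<in>A. f k i) = (\<Sum>k\<in>A. ip n x (f k))"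
  unfolding ip_def sum_distrib_left by (rule sum.swap)

lemma ip_sum_left: "ip n (\<lambda>i. \<Sum>k\<in>A. f k i) x = (\<Sum>k\<in>A. ip n (f k) x)"
  unfolding ip_def sum_distrib_right by (rule sum.swap)

lemma ip_Cauchy_Schwarz: "(ip n x y)\<^sup>2 \<le> ip n x x * ip n y y"
  unfolding ip_def using Cauchy_Schwarz_ineq_sum[of x y "{..<n}"] by (simp add: power2_eq_square)

lemma ip_Cauchy_Schwarz_abs: "\<bar>ip n x y\<bar> \<le> sqrt (ip n x x) * sqrt (ip n y y)"
  using real_sqrt_le_mono[OF ip_Cauchy_Schwarz[of n x y]] by (simp add: real_sqrt_mult)

lemma ip_mv: "ip n x (mv n W y) = (\<Sum>i<n. \<Sum>j<n. W i j * (x i * y j))"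
  by (simp add: ip_def mv_def sum_distrib_left mult_ac)

lemma ip_mv_sym:
  assumes "symm n W"
  shows "ip n (mv n W x) y = ip n x (mv n W y)"
proof -
  have "ip n (mv n W x) y = (\<Sum>i<n. \<Sum>j<n. W i j * (y i * x j))" by (subst ip_commute) (rule ip_mv)
  also have "\<dots> = (\<Sum>j<n. \<Sum>i<n. W i j * (y i * x j))" by (rule sum.swap)
  also have "\<dots> = ip n x (mv n W y)" unfolding ip_mv using assms by (auto simp: symm_def mult_ac intro!: sum.cong)
  finally show ?thesis .
qed

lemma ip_eigenbasis:
  assumes "eigenbasis n W u l"
  shows "ip n x y = (\<Sum>j<n. ip n x (u j) * ip n y (u j))"
proof -
  have "(\<Sum>j<n. ip n x (u j) * ip n y (u j)) = (\<Sum>j<n. \<Sum>i<n. \<Sum>k<n. x i * y k * (u j i * u j k))"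
    by (simp add: ip_def sum_product mult_ac)
  also have "\<dots> = (\<Sum>i<n. \<Sum>j<n. \<Sum>k<n. x i * y k * (u j i * u j k))" by (rule sum.swap)
  also have "\<dots> = (\<Sum>i<n. \<Sum>k<n. \<Sum>j<n. x i * y k * (u j i * u j k))"
    by (rule sum.cong[OF refl], rule sum.swap)
  also have "\<dots> = (\<Sum>i<n. \<Sum>k<n. if k = i then x i * y i else 0)"
  proof (intro sum.cong refl)
    fix i k assume "i \<in> {..<n}" "k \<in> {..<n}"
    then have "(\<Sum>j<n. u j i * u j k) = of_bool (i = k)" using assms unfolding eigenbasis_def by blast
    then show "(\<Sum>j<n. x i * y k * (u j i * u j k)) = (if k = i then x i * y i else 0)"
      by (simp add: sum_distrib_left[symmetric])
  qed
  also have "\<dots> = ip n x y"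
    by (simp add: ip_def)
  finally show ?thesis by simp
qed

lemma ip_power_eigenvector:
  assumes sym: "symm n W"
    and W: "eigenbasis n W u l" and j: "j < n"
  shows "ip n ((mv n W ^^ q) x) (u j) = l j ^ q * ip n x (u j)"
proof (induction q)
  case (Suc q)
  have "ip n ((mv n W ^^ Suc q) x) (u j) = ip n ((mv n W ^^ q) x) (mv n W (u j))"
    by (simp add: ip_mv_sym[OF sym])
  also have "\<dots> = ip n ((mv n W ^^ q) x) (\<lambda>i. l j * u j i)"
    using W j unfolding eigenbasis_def by (intro ip_cong) auto
  finally show ?case using Suc by (simp add: ip_scale_right)
qed simp

lemma ip_power_eigenbasis:
  assumes sym: "symm n W" and W: "eigenbasis n W u l"
  shows "ip n x ((mv n W ^^ q) x) = (\<Sum>j<n. l j ^ q * (ip n x (u j))\<^sup>2)"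
  by (subst ip_eigenbasis[OF W], intro sum.cong refl) (simp add: ip_power_eigenvector[OF sym W] power2_eq_square)

section \<open>Moments of random sums of rank-one matrices\<close>

definition trace_pow :: "nat \<Rightarrow> (nat \<Rightarrow> nat \<Rightarrow> real) \<Rightarrow> nat \<Rightarrow> real" where
  "trace_pow n W q = (\<Sum>a<n. ip n (\<lambda>i. of_bool (i = a)) ((mv n W ^^ q) (\<lambda>i. of_bool (i = a))))"

definition quad_pow :: "nat \<Rightarrow> (nat \<Rightarrow> nat \<Rightarrow> real) \<Rightarrow> nat \<Rightarrow> (nat \<Rightarrow> real) \<Rightarrow> real" where
  "quad_pow n W q v = ip n v ((mv n W ^^ q) v)"

text \<open>A bound on the operator norm, stated through the bilinear form: two different vectors
  are allowed, so products with diagonal matrices on either side can be estimated directly.\<close>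

definition op_bound :: "nat \<Rightarrow> (nat \<Rightarrow> nat \<Rightarrow> real) \<Rightarrow> real \<Rightarrow> bool" where
  "op_bound n W T \<longleftrightarrow> (\<forall>x y. \<bar>ip n x (mv n W y)\<bar> \<le> T * (sqrt (ip n x x) * sqrt (ip n y y)))"

lemma quad_pow_eigenbasis:
  assumes "symm n W" "eigenbasis n W u l"
  shows "quad_pow n W q v = (\<Sum>j<n. l j ^ q * (ip n v (u j))\<^sup>2)"
  unfolding quad_pow_def using ip_power_eigenbasis[OF assms] .

lemma trace_pow_eigenbasis:
  assumes sym: "symm n W" and W: "eigenbasis n W u l"
  shows "trace_pow n W q = (\<Sum>j<n. l j ^ q)"
proof -
  have e: "ip n (\<lambda>i. of_bool (i = a)) (u j) = u j a" if "a < n" for a j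
    using that by (simp add: ip_def)
  have "trace_pow n W q = (\<Sum>a<n. \<Sum>j<n. l j ^ q * (u j a)\<^sup>2)"
    unfolding trace_pow_def by (intro sum.cong refl, subst ip_power_eigenbasis[OF sym W]) (auto simp: e)
  also have "\<dots> = (\<Sum>j<n. \<Sum>a<n. l j ^ q * (u j a)\<^sup>2)" by (rule sum.swap)
  also have "\<dots> = (\<Sum>j<n. l j ^ q * ip n (u j) (u j))"
    by (simp add: ip_def sum_distrib_left power2_eq_square)
  also have "\<dots> = (\<Sum>j<n. l j ^ q)" using W unfolding eigenbasis_def by simp
  finally show ?thesis .
qed

lemma quad_pow_even_nonneg:
  assumes "symm n W"
  shows "0 \<le> quad_pow n W (2 * m) v"
proof -
  obtain u l where "eigenbasis n W u l" using eigenbasis_ex[OF assms] by blast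
  from quad_pow_eigenbasis[OF assms this] show ?thesis
    by (auto intro!: sum_nonneg simp: power_mult)
qed

lemma trace_pow_even_nonneg:
  assumes "symm n W"
  shows "0 \<le> trace_pow n W (2 * m)"
proof -
  obtain u l where "eigenbasis n W u l" using eigenbasis_ex[OF assms] by blast
  from trace_pow_eigenbasis[OF assms this] show ?thesis
    by (auto intro!: sum_nonneg simp: power_mult)
qed

text \<open>For each eigenvalue, x <= (x^2/c + c)/2 is multiplied by the nonnegative x^(2m). An odd
  trace has no definite sign, so it is controlled by its two even neighbours; the free weight c will
  be P.\<close>

lemma trace_pow_odd_le:
  assumes sym: "symm n W" and c: "c > 0"
  shows "trace_pow n W (2 * m + 1) \<le> (trace_pow n W (2 * m + 2) / c + c * trace_pow n W (2 * m)) / 2"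
proof -
  obtain u l where W: "eigenbasis n W u l" using eigenbasis_ex[OF sym] by blast
  have *: "x ^ (2 * m + 1) \<le> (x ^ (2 * m + 2) / c + c * x ^ (2 * m)) / 2" for x :: real
  proof -
    have "0 \<le> (x / c - 1)\<^sup>2 * c" using c by simp
    also have "\<dots> = x\<^sup>2 / c + c - 2 * x" using c by (simp add: power2_eq_square field_simps)
    finally have "x \<le> (x\<^sup>2 / c + c) / 2" by simp
    then have "x ^ (2 * m) * x \<le> x ^ (2 * m) * ((x\<^sup>2 / c + c) / 2)"
      by (rule mult_left_mono) (simp add: power_mult)
    then show ?thesis by (simp add: field_simps power_add power2_eq_square)
  qed
  have "(\<Sum>j<n. l j ^ (2 * m + 1)) \<le> (\<Sum>j<n. (l j ^ (2 * m + 2) / c + c * l j ^ (2 * m)) / 2)"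
    by (intro sum_mono *)
  also have "\<dots> = ((\<Sum>j<n. l j ^ (2 * m + 2)) / c + c * (\<Sum>j<n. l j ^ (2 * m))) / 2"
    unfolding sum_divide_distrib sum_distrib_left sum.distrib[symmetric] ..
  finally show ?thesis unfolding trace_pow_eigenbasis[OF sym W] .
qed

text \<open>Even powers of the eigenvalues are nonnegative, so each is at most their sum, the trace.
  Parseval turns the eigenvalue bound into a bound on |Wy|, and Cauchy-Schwarz into one on the
  bilinear form.\<close>

lemma op_bound_if_trace_pow_le:
  assumes sym: "symm n W"
    and tr: "trace_pow n W (2 * m) \<le> T ^ (2 * m)" and m: "m > 0" and T: "T \<ge> 0"
  shows "op_bound n W T"
  unfolding op_bound_def
proof (intro allI)
  fix x y
  obtain u l where W: "eigenbasis n W u l" using eigenbasis_ex[OF sym] by blast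
  have l: "(l j)\<^sup>2 \<le> T\<^sup>2" if j: "j < n" for j
  proof -
    have "\<bar>l j\<bar> ^ (2 * m) = l j ^ (2 * m)" by (simp add: power_even_abs)
    also have "\<dots> \<le> (\<Sum>j<n. l j ^ (2 * m))"
      by (rule member_le_sum) (use j in \<open>auto simp: power_mult\<close>)
    also have "\<dots> \<le> T ^ (2 * m)" using tr trace_pow_eigenbasis[OF sym W] by simp
    finally have "\<bar>l j\<bar> \<le> T" using power_mono_iff[of "\<bar>l j\<bar>" T "2 * m"] m T by simp
    then show ?thesis by (metis abs_ge_zero power2_abs power_mono)
  qed
  have "ip n (mv n W y) (mv n W y) = (\<Sum>j<n. (l j)\<^sup>2 * (ip n y (u j))\<^sup>2)"
    using ip_power_eigenvector[OF sym W, of _ 1 y]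
    by (subst ip_eigenbasis[OF W]) (auto intro!: sum.cong simp: power2_eq_square)
  also have "\<dots> \<le> (\<Sum>j<n. T\<^sup>2 * (ip n y (u j))\<^sup>2)"
    by (intro sum_mono mult_right_mono) (use l in auto)
  also have "\<dots> = T\<^sup>2 * ip n y y"
    by (subst ip_eigenbasis[OF W, of y]) (simp add: sum_distrib_left power2_eq_square)
  finally have "sqrt (ip n (mv n W y) (mv n W y)) \<le> T * sqrt (ip n y y)"
    using T real_sqrt_le_mono[of _ "T\<^sup>2 * ip n y y"] by (simp add: real_sqrt_mult)
  then have "sqrt (ip n x x) * sqrt (ip n (mv n W y) (mv n W y)) \<le> sqrt (ip n x x) * (T * sqrt (ip n y y))"
    by (rule mult_left_mono) (simp add: ip_self_nonneg)
  with ip_Cauchy_Schwarz_abs[of n x "mv n W y"]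
  show "\<bar>ip n x (mv n W y)\<bar> \<le> T * (sqrt (ip n x x) * sqrt (ip n y y))"
    by (simp add: mult_ac)
qed

text \<open>In absolute values the claim is (|x|^q - |y|^q)(|x|^s - |y|^s) >= 0, which holds because
  the factors do not have opposite signs. Absolute values are harmless on the right, where the
  exponent is even; q and s themselves may be odd.\<close>

lemma power_mixed_le:
  fixes x y :: real
  assumes "q + s = 2 * m"
  shows "x ^ q * y ^ s + x ^ s * y ^ q \<le> x ^ (2 * m) + y ^ (2 * m)"
proof -
  have "x ^ q * y ^ s + x ^ s * y ^ q \<le> \<bar>x\<bar> ^ q * \<bar>y\<bar> ^ s + \<bar>x\<bar> ^ s * \<bar>y\<bar> ^ q"
    using abs_ge_self[of "x ^ q * y ^ s"] abs_ge_self[of "x ^ s * y ^ q"]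
    by (simp add: abs_mult power_abs)
  also have "\<dots> \<le> \<bar>x\<bar> ^ (q + s) + \<bar>y\<bar> ^ (q + s)"
  proof -
    have "0 \<le> (\<bar>x\<bar> ^ q - \<bar>y\<bar> ^ q) * (\<bar>x\<bar> ^ s - \<bar>y\<bar> ^ s)"
    proof (cases "\<bar>x\<bar> \<le> \<bar>y\<bar>")
      case True
      then show ?thesis by (intro mult_nonpos_nonpos) (simp_all add: power_mono)
    next
      case False
      then show ?thesis by (intro mult_nonneg_nonneg) (simp_all add: power_mono)
    qed
    then show ?thesis by (simp add: power_add algebra_simps)
  qed
  also have "\<dots> = x ^ (2 * m) + y ^ (2 * m)" unfolding assms by (simp add: power_even_abs)
  finally show ?thesis .
qed

text \<open>In two unrelated eigenbases each quadratic form is a scalar sum with nonnegative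
  weights, so W and Y need not commute: the scalar inequality applies to every pair of eigenvalues.
  The weights in either basis add up to |v|^2 <= 1, which removes the extra factor.\<close>

lemma quad_pow_mixed_le:
  assumes symW: "symm n W"
    and symY: "symm n Y"
    and v: "ip n v v \<le> 1" and qs: "q + s = 2 * m"
  shows "quad_pow n W q v * quad_pow n Y s v + quad_pow n W s v * quad_pow n Y q v
      \<le> quad_pow n W (2 * m) v + quad_pow n Y (2 * m) v"
proof -
  obtain u l where W: "eigenbasis n W u l" using eigenbasis_ex[OF symW] by blast
  obtain u' l' where Y: "eigenbasis n Y u' l'" using eigenbasis_ex[OF symY] by blast
  let ?w = "\<lambda>i. (ip n v (u i))\<^sup>2" and ?w' = "\<lambda>j. (ip n v (u' j))\<^sup>2"
  have w: "(\<Sum>i<n. ?w i) = ip n v v" using ip_eigenbasis[OF W, of v v] by (simp add: power2_eq_square)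
  have w': "(\<Sum>i<n. ?w' i) = ip n v v" using ip_eigenbasis[OF Y, of v v] by (simp add: power2_eq_square)
  have "quad_pow n W q v * quad_pow n Y s v + quad_pow n W s v * quad_pow n Y q v
      = (\<Sum>i<n. \<Sum>j<n. ?w i * ?w' j * (l i ^ q * l' j ^ s + l i ^ s * l' j ^ q))"
    unfolding quad_pow_eigenbasis[OF symW W] quad_pow_eigenbasis[OF symY Y]
    unfolding sum_product sum.distrib[symmetric] by (intro sum.cong refl) (simp add: algebra_simps)
  also have "\<dots> \<le> (\<Sum>i<n. \<Sum>j<n. ?w i * ?w' j * (l i ^ (2 * m) + l' j ^ (2 * m)))"
    by (intro sum_mono mult_left_mono power_mixed_le qs) auto
  also have "\<dots> = (\<Sum>i<n. ?w i * l i ^ (2 * m)) * (\<Sum>j<n. ?w' j) + (\<Sum>i<n. ?w i) * (\<Sum>j<n. ?w' j * l' j ^ (2 * m))"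
    unfolding sum_product by (simp add: algebra_simps sum.distrib)
  also have "\<dots> = quad_pow n W (2 * m) v * ip n v v + ip n v v * quad_pow n Y (2 * m) v"
    unfolding quad_pow_eigenbasis[OF symW W] quad_pow_eigenbasis[OF symY Y] w w' by (simp add: mult_ac)
  also have "\<dots> \<le> quad_pow n W (2 * m) v + quad_pow n Y (2 * m) v"
    using v quad_pow_even_nonneg[OF symW] quad_pow_even_nonneg[OF symY]
    by (intro add_mono mult_left_le mult_left_le_one_le ip_self_nonneg)
  finally show ?thesis .
qed

lemma mv_power_linear:
  "(mv n W ^^ q) (\<lambda>i. x i + c * y i) = (\<lambda>i. (mv n W ^^ q) x i + c * (mv n W ^^ q) y i)"
  by (induction q) (auto simp: mv_def sum.distrib sum_distrib_left algebra_simps)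

text \<open>This is Y^N - W^N = sum of Y^q (Y - W) W^(N-1-q). Because Y - W = v v^T and a further v
  stands on the left, every term splits into a product of two numbers. The update is assumed at all
  indices so that the iterates are equal as functions, not merely below n.\<close>

lemma rank_one_update_telescope:
  assumes Y: "\<And>i j. Y i j = W i j + v i * v j"
  shows "ip n v ((mv n Y ^^ N) x) - ip n v ((mv n W ^^ N) x)
      = (\<Sum>q<N. ip n v ((mv n Y ^^ q) v) * ip n v ((mv n W ^^ (N - 1 - q)) x))"
proof (induction N arbitrary: x)
  case (Suc N)
  have Yx: "mv n Y x = (\<lambda>i. mv n W x i + ip n v x * v i)"
    by (auto simp: mv_def ip_def Y algebra_simps sum.distrib sum_distrib_left)
  have "ip n v ((mv n Y ^^ Suc N) x) = ip n v ((mv n Y ^^ N) (mv n W x)) + ip n v x * ip n v ((mv n Y ^^ N) v)"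
    by (simp add: funpow_Suc_right Yx mv_power_linear ip_add_right ip_scale_right del: funpow.simps)
  moreover have "ip n v ((mv n W ^^ Suc N) x) = ip n v ((mv n W ^^ N) (mv n W x))"
    by (simp add: funpow_Suc_right del: funpow.simps)
  ultimately have "ip n v ((mv n Y ^^ Suc N) x) - ip n v ((mv n W ^^ Suc N) x)
      = (\<Sum>q<N. ip n v ((mv n Y ^^ q) v) * ip n v ((mv n W ^^ (N - 1 - q)) (mv n W x)))
        + ip n v ((mv n Y ^^ N) v) * ip n v x"
    using Suc.IH[of "mv n W x"] by simp
  also have "(\<Sum>q<N. ip n v ((mv n Y ^^ q) v) * ip n v ((mv n W ^^ (N - 1 - q)) (mv n W x)))
      = (\<Sum>q<N. ip n v ((mv n Y ^^ q) v) * ip n v ((mv n W ^^ (Suc N - 1 - q)) x))"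
  proof (rule sum.cong[OF refl])
    fix q assume "q \<in> {..<N}"
    then have "Suc N - 1 - q = Suc (N - 1 - q)" by auto
    then show "ip n v ((mv n Y ^^ q) v) * ip n v ((mv n W ^^ (N - 1 - q)) (mv n W x))
       = ip n v ((mv n Y ^^ q) v) * ip n v ((mv n W ^^ (Suc N - 1 - q)) x)"
      by (simp add: funpow_Suc_right del: funpow.simps)
  qed
  finally show ?case by simp
qed simp

text \<open>The exponent is odd, so the telescoped terms have even total degree 2m. Each is averaged
  with its mirror image under q -> 2m - q, and the symmetrized pair is what
  \<open>quad_pow_mixed_le\<close> bounds. The 2m+1 terms and the averaging give the factor
  (2m+1)/2.\<close>

lemma quad_pow_rank_one_update_le:
  assumes symW: "\<And>i j. W i j = W j i" and Y: "\<And>i j. Y i j = W i j + v i * v j" and v: "ip n v v \<le> 1"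
  shows "quad_pow n Y (2 * m + 1) v - quad_pow n W (2 * m + 1) v
      \<le> real (2 * m + 1) / 2 * (quad_pow n Y (2 * m) v + quad_pow n W (2 * m) v)"
proof -
  let ?N = "2 * m + 1" and ?c = "quad_pow n Y (2 * m) v + quad_pow n W (2 * m) v"
  let ?f = "\<lambda>q. quad_pow n Y q v * quad_pow n W (2 * m - q) v"
  have symY: "Y i j = Y j i" for i j using symW[of i j] by (simp add: Y)
  have D: "quad_pow n Y ?N v - quad_pow n W ?N v = (\<Sum>q<?N. ?f q)"
    unfolding quad_pow_def by (subst rank_one_update_telescope[OF Y]) simp
  have rev: "(\<Sum>q<?N. ?f q) = (\<Sum>q<?N. ?f (?N - Suc q))"
    by (rule sum.nat_diff_reindex[symmetric])
  have "2 * (\<Sum>q<?N. ?f q) = (\<Sum>q<?N. ?f q + ?f (?N - Suc q))"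
    unfolding sum.distrib using rev by simp
  also have "\<dots> \<le> (\<Sum>q<?N. ?c)"
  proof (rule sum_mono)
    fix q assume "q \<in> {..<?N}"
    then have "q + (2 * m - q) = 2 * m" "2 * m - (2 * m - q) = q" by auto
    then show "?f q + ?f (?N - Suc q) \<le> ?c"
      using quad_pow_mixed_le[of n Y W v q "2 * m - q" m] symW symY v by (auto simp: symm_def)
  qed
  finally have "2 * (\<Sum>q<?N. ?f q) \<le> ?N * ?c" by simp
  then show ?thesis unfolding D by (simp add: field_simps)
qed

section \<open>Resampling one coordinate of a Bernoulli product measure\<close>

lemma finite_set_Pi_pmf_bool:
  assumes "finite I"
  shows "finite (set_pmf (Pi_pmf I False p :: ('a \<Rightarrow> bool) pmf))"
proof (rule finite_subset)
  show "set_pmf (Pi_pmf I False p) \<subseteq> PiE_dflt I False (\<lambda>_. UNIV)"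
    using set_Pi_pmf_subset'[OF assms, of False p] by (auto simp: PiE_dflt_def)
qed (use assms in auto)

lemma expectation_Pi_bernoulli_remove:
  fixes pr :: "'a \<Rightarrow> real" and f :: "('a \<Rightarrow> bool) \<Rightarrow> real"
  assumes I: "finite I" "i \<in> I" and p: "0 \<le> pr i" "pr i \<le> 1"
  defines "H \<equiv> \<lambda>I. Pi_pmf I False (\<lambda>i. bernoulli_pmf (pr i))"
  shows "measure_pmf.expectation (H I) f
     = pr i * measure_pmf.expectation (H (I - {i})) (\<lambda>h. f (h(i := True)))
     + (1 - pr i) * measure_pmf.expectation (H (I - {i})) (\<lambda>h. f (h(i := False)))"
proof -
  have fin: "finite (set_pmf (H J))" if "finite J" for J
    unfolding H_def by (rule finite_set_Pi_pmf_bool[OF that])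
  have "H I = H (insert i (I - {i}))" using I by (simp add: insert_absorb)
  also have "\<dots> = bernoulli_pmf (pr i) \<bind> (\<lambda>y. map_pmf (\<lambda>h. h(i := y)) (H (I - {i})))"
    unfolding H_def by (subst Pi_pmf_insert') (use I in \<open>auto simp: map_pmf_def\<close>)
  finally have H: "H I = bernoulli_pmf (pr i) \<bind> (\<lambda>y. map_pmf (\<lambda>h. h(i := y)) (H (I - {i})))" .
  have "measure_pmf.expectation (H I) f
      = (\<Sum>y\<in>UNIV. pmf (bernoulli_pmf (pr i)) y *\<^sub>R measure_pmf.expectation (map_pmf (\<lambda>h. h(i := y)) (H (I - {i}))) f)"
    unfolding H by (rule pmf_expectation_bind) (use fin I in auto)
  also have "\<dots> = pr i * measure_pmf.expectation (H (I - {i})) (\<lambda>h. f (h(i := True)))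
     + (1 - pr i) * measure_pmf.expectation (H (I - {i})) (\<lambda>h. f (h(i := False)))"
    using p by (simp add: UNIV_bool)
  finally show ?thesis .
qed

text \<open>The conditioning formula is applied to both sides; on the right the integrand ignores
  the value of h at i, so both branches agree. The result stays on one measure for all i, which
  allows summation over i.\<close>

lemma expectation_Pi_bernoulli_resample:
  fixes pr :: "'a \<Rightarrow> real" and f :: "('a \<Rightarrow> bool) \<Rightarrow> real"
  assumes I: "finite I" "i \<in> I" and p: "0 \<le> pr i" "pr i \<le> 1"
  defines "H \<equiv> Pi_pmf I False (\<lambda>i. bernoulli_pmf (pr i))"
  shows "measure_pmf.expectation H f
     = measure_pmf.expectation H (\<lambda>h. pr i * f (h(i := True)) + (1 - pr i) * f (h(i := False)))"
proof -
  let ?H = "Pi_pmf (I - {i}) False (\<lambda>i. bernoulli_pmf (pr i))"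
  have fin: "finite (set_pmf ?H)" by (rule finite_set_Pi_pmf_bool) (use I in auto)
  have add: "measure_pmf.expectation ?H (\<lambda>h. c * g h + e * g' h)
      = c * measure_pmf.expectation ?H g + e * measure_pmf.expectation ?H g'"
    for c e :: real and g g' :: "('a \<Rightarrow> bool) \<Rightarrow> real"
    by (subst Bochner_Integration.integral_add) (simp_all add: integrable_measure_pmf_finite[OF fin])
  show ?thesis
    unfolding H_def expectation_Pi_bernoulli_remove[where pr = pr and i = i, OF I p]
    by (simp add: add) (simp add: algebra_simps)
qed

text \<open>\<open>mean_le\<close> is the operator inequality: the sum of pr_i v_i v_i^T is at most
  d I. Beside independence and the bound on the norms it carries the whole estimate; the dimension
  appears only through the trace of the identity.\<close>

locale bernoulli_rank_one_sum =
  fixes n :: nat and I :: "'a set" and v :: "'a \<Rightarrow> nat \<Rightarrow> real" and pr :: "'a \<Rightarrow> real" and d :: real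
  assumes finite_I: "finite I"
    and pr_nonneg: "i \<in> I \<Longrightarrow> 0 \<le> pr i" and pr_le_1: "i \<in> I \<Longrightarrow> pr i \<le> 1"
    and norm_le_1: "i \<in> I \<Longrightarrow> ip n (v i) (v i) \<le> 1"
    and d_nonneg: "0 \<le> d"
    and mean_le: "(\<Sum>i\<in>I. pr i * (ip n (v i) x)\<^sup>2) \<le> d * ip n x x"
begin

definition H :: "('a \<Rightarrow> bool) pmf" where
  "H = Pi_pmf I False (\<lambda>i. bernoulli_pmf (pr i))"

definition X :: "('a \<Rightarrow> bool) \<Rightarrow> nat \<Rightarrow> nat \<Rightarrow> real" where
  "X h a b = (\<Sum>i\<in>I. (of_bool (h i) - pr i) * (v i a * v i b))"

abbreviation E :: "(('a \<Rightarrow> bool) \<Rightarrow> real) \<Rightarrow> real" where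
  "E \<equiv> measure_pmf.expectation H"

lemma symm_X: "symm n (X h)"
  by (simp add: symm_def X_def mult_ac)

lemma integrable_H: "integrable H (f :: ('a \<Rightarrow> bool) \<Rightarrow> real)"
  unfolding H_def by (intro integrable_measure_pmf_finite finite_set_Pi_pmf_bool finite_I)

lemma ip_X: "ip n x (mv n (X h) y) = (\<Sum>i\<in>I. (of_bool (h i) - pr i) * (ip n (v i) x * ip n (v i) y))"
proof -
  have "ip n x (mv n (X h) y) = (\<Sum>a<n. \<Sum>b<n. \<Sum>i\<in>I. (of_bool (h i) - pr i) * (v i a * x a * (v i b * y b)))"
    unfolding ip_mv X_def by (simp add: sum_distrib_left sum_distrib_right mult_ac)
  also have "\<dots> = (\<Sum>a<n. \<Sum>i\<in>I. \<Sum>b<n. (of_bool (h i) - pr i) * (v i a * x a * (v i b * y b)))"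
    by (rule sum.cong[OF refl], rule sum.swap)
  also have "\<dots> = (\<Sum>i\<in>I. \<Sum>a<n. \<Sum>b<n. (of_bool (h i) - pr i) * (v i a * x a * (v i b * y b)))"
    by (rule sum.swap)
  also have "\<dots> = (\<Sum>i\<in>I. (of_bool (h i) - pr i) * (ip n (v i) x * ip n (v i) y))"
    unfolding ip_def sum_product by (simp add: sum_distrib_left)
  finally show ?thesis .
qed

text \<open>Only one of the q+1 factors is expanded into rank-one terms. Each contributes v^T X^q v
  by cyclicity of the trace, here seen by evaluation in an eigenbasis of X.\<close>

lemma trace_pow_Suc:
  "trace_pow n (X h) (Suc q) = (\<Sum>i\<in>I. (of_bool (h i) - pr i) * quad_pow n (X h) q (v i))"
proof -
  obtain u l where W: "eigenbasis n (X h) u l" using eigenbasis_ex[OF symm_X] by blast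
  have "(\<Sum>i\<in>I. (of_bool (h i) - pr i) * quad_pow n (X h) q (v i))
      = (\<Sum>i\<in>I. \<Sum>j<n. l j ^ q * ((of_bool (h i) - pr i) * (ip n (v i) (u j) * ip n (v i) (u j))))"
    unfolding quad_pow_eigenbasis[OF symm_X W] by (simp add: sum_distrib_left power2_eq_square mult_ac)
  also have "\<dots> = (\<Sum>j<n. l j ^ q * ip n (u j) (mv n (X h) (u j)))"
    unfolding ip_X by (subst sum.swap) (simp add: sum_distrib_left)
  also have "\<dots> = (\<Sum>j<n. l j ^ q * (l j * ip n (u j) (u j)))"
  proof (intro sum.cong refl arg_cong2[where f = "(*)"])
    fix j assume "j \<in> {..<n}"
    then have "ip n (u j) (mv n (X h) (u j)) = ip n (u j) (\<lambda>i. l j * u j i)"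
      using W unfolding eigenbasis_def by (intro ip_cong) auto
    then show "ip n (u j) (mv n (X h) (u j)) = l j * ip n (u j) (u j)" by (simp add: ip_scale_right)
  qed
  also have "\<dots> = (\<Sum>j<n. l j ^ Suc q)" using W unfolding eigenbasis_def by (simp add: mult_ac)
  finally show ?thesis unfolding trace_pow_eigenbasis[OF symm_X W] by simp
qed

text \<open>For B = sum of pr_i v_i v_i^T <= d I one has tr(B X^(2m)) <= d tr X^(2m), because X^(2m)
  is positive semidefinite.\<close>

lemma mean_quad_pow_le:
  "(\<Sum>i\<in>I. pr i * quad_pow n (X h) (2 * m) (v i)) \<le> d * trace_pow n (X h) (2 * m)"
proof -
  obtain u l where W: "eigenbasis n (X h) u l" using eigenbasis_ex[OF symm_X] by blast
  have "(\<Sum>i\<in>I. pr i * quad_pow n (X h) (2 * m) (v i))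
      = (\<Sum>i\<in>I. \<Sum>j<n. l j ^ (2 * m) * (pr i * (ip n (v i) (u j))\<^sup>2))"
    unfolding quad_pow_eigenbasis[OF symm_X W] by (simp add: sum_distrib_left mult_ac)
  also have "\<dots> = (\<Sum>j<n. l j ^ (2 * m) * (\<Sum>i\<in>I. pr i * (ip n (v i) (u j))\<^sup>2))"
    by (subst sum.swap) (simp add: sum_distrib_left)
  also have "\<dots> \<le> (\<Sum>j<n. l j ^ (2 * m) * (d * ip n (u j) (u j)))"
    by (intro sum_mono mult_left_mono mean_le) (simp add: power_mult)
  also have "\<dots> = d * (\<Sum>j<n. l j ^ (2 * m))"
    using W unfolding eigenbasis_def by (simp add: sum_distrib_left mult_ac)
  finally show ?thesis unfolding trace_pow_eigenbasis[OF symm_X W] .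
qed

text \<open>
  Resampling the coordinate \<open>i\<close> changes \<open>X\<close> by a rank-one matrix, so the left-hand side is a
  difference of odd powers of two matrices that differ by a rank-one update.
\<close>

lemma expectation_resample_le:
  assumes i: "i \<in> I"
  shows "E (\<lambda>h. (of_bool (h i) - pr i) * quad_pow n (X h) (2 * m + 1) (v i))
     \<le> real (2 * m + 1) / 2 * E (\<lambda>h. (of_bool (h i) + pr i) * quad_pow n (X h) (2 * m) (v i))"
proof -
  note res = expectation_Pi_bernoulli_resample[where pr = pr and i = i, OF finite_I i pr_nonneg[OF i] pr_le_1[OF i], folded H_def]
  let ?T = "\<lambda>h. X (h(i := True))" and ?F = "\<lambda>h. X (h(i := False))"
  let ?p = "pr i" and ?c = "real (2 * m + 1) / 2"
  have p: "0 \<le> ?p" "?p \<le> 1" using pr_nonneg pr_le_1 i by auto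
  have upd: "?T h a b = ?F h a b + v i a * v i b" for h a b
    unfolding X_def using i finite_I by (simp add: sum.remove[of I i] algebra_simps)
  \<comment> \<open>Both sides are the resampled integrands. The left one is p(1-p) times the
    difference of the two odd quadratic forms.\<close>
  have "?p * ((1 - ?p) * quad_pow n (?T h) (2 * m + 1) (v i)) + (1 - ?p) * ((0 - ?p) * quad_pow n (?F h) (2 * m + 1) (v i))
      \<le> ?c * (?p * ((1 + ?p) * quad_pow n (?T h) (2 * m) (v i)) + (1 - ?p) * ((0 + ?p) * quad_pow n (?F h) (2 * m) (v i)))" for h
  proof -
    let ?t = "quad_pow n (?T h) (2 * m) (v i)" and ?f = "quad_pow n (?F h) (2 * m) (v i)"
    have nn: "0 \<le> ?t" using quad_pow_even_nonneg[OF symm_X] .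
    have "quad_pow n (?T h) (2 * m + 1) (v i) - quad_pow n (?F h) (2 * m + 1) (v i) \<le> ?c * (?t + ?f)"
      by (rule quad_pow_rank_one_update_le[OF _ upd norm_le_1[OF i]]) (simp add: X_def mult_ac)
    then have "(?p * (1 - ?p)) * (quad_pow n (?T h) (2 * m + 1) (v i) - quad_pow n (?F h) (2 * m + 1) (v i))
        \<le> (?p * (1 - ?p)) * (?c * (?t + ?f))"
      by (rule mult_left_mono) (use p in auto)
    also have "\<dots> = ?c * (?p * (1 - ?p) * ?t + (1 - ?p) * ?p * ?f)" by (simp add: field_simps)
    \<comment> \<open>On the branch where the coordinate is true, 1-p is enlarged to 1+p, the value
      of \<open>of_bool (h i) + pr i\<close> there; on the other branch that value is already
      p.\<close>
    also have "\<dots> \<le> ?c * (?p * (1 + ?p) * ?t + (1 - ?p) * ?p * ?f)"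
      by (intro mult_left_mono add_mono mult_right_mono) (use p nn in auto)
    finally show ?thesis by (simp add: algebra_simps)
  qed
  then have "E (\<lambda>h. ?p * ((1 - ?p) * quad_pow n (?T h) (2 * m + 1) (v i)) + (1 - ?p) * ((0 - ?p) * quad_pow n (?F h) (2 * m + 1) (v i)))
     \<le> E (\<lambda>h. ?c * (?p * ((1 + ?p) * quad_pow n (?T h) (2 * m) (v i)) + (1 - ?p) * ((0 + ?p) * quad_pow n (?F h) (2 * m) (v i))))"
    by (intro integral_mono integrable_H)
  then show ?thesis
    by (subst (1 2) res) simp
qed

text \<open>Expanding one factor and resampling leaves the weight h_i + p_i = (h_i - p_i) + 2 p_i.
  The centered part reassembles tr X^(2m+1), and the mean costs 2d tr X^(2m). With weight c = P the
  odd trace returns half of the left-hand side, which is absorbed. P must dominate (2m+1)/2, whence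
  m+1 <= P.\<close>

lemma expectation_trace_pow_step:
  fixes P :: nat
  assumes m: "m + 1 \<le> P"
  shows "E (\<lambda>h. trace_pow n (X h) (2 * (m + 1))) \<le> ((real P)\<^sup>2 + 4 * P * d) * E (\<lambda>h. trace_pow n (X h) (2 * m))"
proof -
  let ?c = "real (2 * m + 1) / 2"
  let ?t = "\<lambda>q. E (\<lambda>h. trace_pow n (X h) q)"
  have P: "real P > 0" and cP: "0 \<le> ?c" "?c \<le> P" using m by auto
  have nn: "0 \<le> ?t (2 * m)" "0 \<le> ?t (2 * (m + 1))"
    by (intro integral_nonneg_AE AE_I2 trace_pow_even_nonneg[OF symm_X])+
  have "?t (2 * (m + 1)) = (\<Sum>i\<in>I. E (\<lambda>h. (of_bool (h i) - pr i) * quad_pow n (X h) (2 * m + 1) (v i)))"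
    using trace_pow_Suc[of _ "2 * m + 1"] by (simp add: integrable_H)
  also have "\<dots> \<le> (\<Sum>i\<in>I. ?c * E (\<lambda>h. (of_bool (h i) + pr i) * quad_pow n (X h) (2 * m) (v i)))"
    by (intro sum_mono expectation_resample_le)
  also have "\<dots> = ?c * E (\<lambda>h. \<Sum>i\<in>I. (of_bool (h i) + pr i) * quad_pow n (X h) (2 * m) (v i))"
    by (simp add: integrable_H sum_distrib_left del: of_nat_Suc)
  also have "\<dots> \<le> ?c * E (\<lambda>h. (trace_pow n (X h) (2 * (m + 1)) / P + P * trace_pow n (X h) (2 * m)) / 2
        + 2 * d * trace_pow n (X h) (2 * m))"
  proof (intro mult_left_mono integral_mono integrable_H cP)
    fix h
    have "(\<Sum>i\<in>I. (of_bool (h i) + pr i) * quad_pow n (X h) (2 * m) (v i))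
        = trace_pow n (X h) (2 * m + 1) + 2 * (\<Sum>i\<in>I. pr i * quad_pow n (X h) (2 * m) (v i))"
      using trace_pow_Suc[of h "2 * m"] by (simp add: algebra_simps sum.distrib sum_subtractf)
    also have "\<dots> \<le> (trace_pow n (X h) (2 * m + 2) / P + P * trace_pow n (X h) (2 * m)) / 2 + 2 * (d * trace_pow n (X h) (2 * m))"
      using trace_pow_odd_le[OF symm_X P] mean_quad_pow_le by (intro add_mono mult_left_mono) auto
    finally show "(\<Sum>i\<in>I. (of_bool (h i) + pr i) * quad_pow n (X h) (2 * m) (v i))
        \<le> (trace_pow n (X h) (2 * (m + 1)) / P + P * trace_pow n (X h) (2 * m)) / 2 + 2 * d * trace_pow n (X h) (2 * m)"
      by simp
  qed
  also have "\<dots> = ?c * ((?t (2 * (m + 1)) / P + P * ?t (2 * m)) / 2 + 2 * d * ?t (2 * m))"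
    by (simp add: integrable_H)
  also have "\<dots> \<le> P * ((?t (2 * (m + 1)) / P + P * ?t (2 * m)) / 2 + 2 * d * ?t (2 * m))"
    using cP P nn d_nonneg by (intro mult_right_mono add_nonneg_nonneg) auto
  also have "\<dots> = ?t (2 * (m + 1)) / 2 + ((real P)\<^sup>2 + 4 * P * d) * ?t (2 * m) / 2"
    using P by (simp add: field_simps power2_eq_square)
  finally show ?thesis by simp
qed

lemma expectation_trace_pow_le:
  fixes P :: nat
  assumes "m \<le> P"
  shows "E (\<lambda>h. trace_pow n (X h) (2 * m)) \<le> n * ((real P)\<^sup>2 + 4 * P * d) ^ m"
  using assms
proof (induction m)
  case 0
  have "trace_pow n (X h) 0 = n" for h
    unfolding trace_pow_def by (simp add: ip_def)
  then show ?case by simp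
next
  case (Suc m)
  have "0 \<le> (real P)\<^sup>2 + 4 * P * d" using d_nonneg by simp
  then have "((real P)\<^sup>2 + 4 * P * d) * E (\<lambda>h. trace_pow n (X h) (2 * m)) \<le> ((real P)\<^sup>2 + 4 * P * d) * (n * ((real P)\<^sup>2 + 4 * P * d) ^ m)"
    using Suc by (intro mult_left_mono) auto
  with expectation_trace_pow_step[of m P] Suc.prems show ?case by (simp add: mult_ac)
qed

text \<open>Markov's inequality for tr X^(2P). The moment is at most n V^P with V = P^2 + 4Pd, and
  the threshold e sqrt V has 2P-th power exp(2P) V^P; the quotient is small once P >= ln n.\<close>

lemma op_bound_probability:
  fixes P :: nat
  assumes P: "P \<ge> 1"
  shows "measure_pmf.prob H {h. \<not> op_bound n (X h) (exp 1 * sqrt ((real P)\<^sup>2 + 4 * P * d))} \<le> n * exp (- 2 * P)"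
proof -
  let ?V = "(real P)\<^sup>2 + 4 * P * d"
  let ?T = "exp 1 * sqrt ?V"
  have "1 \<le> real P" using P by simp
  then have V: "?V > 0" using d_nonneg by (intro add_pos_nonneg) auto
  then have T: "?T > 0" by simp
  have "?T ^ 2 = exp 2 * ?V" using V by (simp add: power_mult_distrib flip: exp_of_nat_mult)
  then have T2: "?T ^ (2 * P) = exp (2 * P) * ?V ^ P"
    by (simp only: power_mult) (simp add: power_mult_distrib mult_ac flip: exp_of_nat_mult)
  have "measure_pmf.prob H {h. \<not> op_bound n (X h) ?T} \<le> measure_pmf.prob H {h \<in> space H. ?T ^ (2 * P) \<le> trace_pow n (X h) (2 * P)}"
  proof (rule measure_pmf.finite_measure_mono)
    show "{h. \<not> op_bound n (X h) ?T} \<subseteq> {h \<in> space H. ?T ^ (2 * P) \<le> trace_pow n (X h) (2 * P)}"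
    proof
      fix h assume h: "h \<in> {h. \<not> op_bound n (X h) ?T}"
      show "h \<in> {h \<in> space H. ?T ^ (2 * P) \<le> trace_pow n (X h) (2 * P)}"
      proof (rule ccontr)
        assume "\<not> ?thesis"
        then have le: "trace_pow n (X h) (2 * P) \<le> ?T ^ (2 * P)" by simp
        have "op_bound n (X h) ?T"
          by (rule op_bound_if_trace_pow_le[OF symm_X le _ less_imp_le[OF T]]) (use P in simp)
        with h show False by simp
      qed
    qed
  qed simp
  also have "\<dots> \<le> E (\<lambda>h. trace_pow n (X h) (2 * P)) / ?T ^ (2 * P)"
    using T by (intro integral_Markov_inequality_measure[where A = "{}"] integrable_H AE_I2 trace_pow_even_nonneg[OF symm_X]) auto
  also have "\<dots> \<le> n * ?V ^ P / ?T ^ (2 * P)"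
    using T expectation_trace_pow_le[of P P] by (intro divide_right_mono) auto
  also have "\<dots> = n * exp (- 2 * P)"
    unfolding T2 using V by (simp add: exp_minus field_simps)
  finally show ?thesis .
qed

end

section \<open>Perturbation of eigenspaces\<close>

text \<open>The system is padded with zero rows to a square matrix; with fewer than K equations the
  last row is zero, and expansion along it shows that the determinant vanishes.\<close>

lemma homogeneous_system_nontrivial:
  fixes A :: "'a \<Rightarrow> nat \<Rightarrow> real"
  assumes J: "finite J" "card J < K"
  obtains y where "\<exists>c<K. y c \<noteq> 0" "\<And>j. j \<in> J \<Longrightarrow> (\<Sum>c<K. A j c * y c) = 0"
proof -
  obtain e where e: "bij_betw e {0..<card J} J" using ex_bij_betw_nat_finite[OF J(1)] by blast
  define M where "M = Matrix.mat K K (\<lambda>(i,c). if i < card J then A (e i) c else 0)"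
  have M: "M \<in> carrier_mat K K" by (simp add: M_def)
  have K: "0 < K" "K - 1 < K" using J by auto
  have "det M = (\<Sum>j<K. M $$ (K - 1, j) * cofactor M (K - 1) j)"
    by (rule laplace_expansion_row[OF M K(2)])
  also have "\<dots> = 0" using J by (intro sum.neutral) (auto simp: M_def)
  finally obtain v where v: "v \<in> carrier_vec K" "v \<noteq> 0\<^sub>v K" "M *\<^sub>v v = 0\<^sub>v K"
    using det_0_iff_vec_prod_zero[OF M] by blast
  have "\<exists>c<K. v $ c \<noteq> 0"
  proof (rule ccontr)
    assume "\<not> ?thesis"
    then have "v = 0\<^sub>v K" using v(1) by (intro eq_vecI) auto
    with v(2) show False by blast
  qed
  moreover have "(\<Sum>c<K. A j c * v $ c) = 0" if "j \<in> J" for j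
  proof -
    have "j \<in> e ` {0..<card J}" using e that by (simp add: bij_betw_def)
    then obtain i where i: "i < card J" "e i = j" by auto
    then have iK: "i < K" using J by simp
    have "(M *\<^sub>v v) $ i = 0" using v(3) iK by simp
    then show ?thesis using i iK v(1) by (simp add: M_def scalar_prod_def atLeast0LessThan)
  qed
  ultimately show ?thesis using that[of "\<lambda>c. v $ c"] by blast
qed

definition orthonormal :: "nat \<Rightarrow> nat \<Rightarrow> (nat \<Rightarrow> nat \<Rightarrow> real) \<Rightarrow> bool" where
  "orthonormal n K Y \<longleftrightarrow> (\<forall>c<K. \<forall>d<K. ip n (Y c) (Y d) = of_bool (c = d))"

text \<open>For orthonormal Y this is the component of x orthogonal to the span of Y; for a unit
  vector x its norm is the sine of the angle to that span.\<close>

definition residual :: "nat \<Rightarrow> nat \<Rightarrow> (nat \<Rightarrow> nat \<Rightarrow> real) \<Rightarrow> (nat \<Rightarrow> real) \<Rightarrow> nat \<Rightarrow> real" where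
  "residual n K Y x = (\<lambda>i. x i - (\<Sum>c<K. ip n (Y c) x * Y c i))"

lemma ip_combination:
  assumes "orthonormal n K Y" "c < K"
  shows "ip n (Y c) (\<lambda>i. \<Sum>d<K. y d * Y d i) = y c"
proof -
  have "ip n (Y c) (\<lambda>i. \<Sum>d<K. y d * Y d i) = (\<Sum>d<K. y d * ip n (Y c) (Y d))"
    by (simp add: ip_sum_right ip_scale_right)
  also have "\<dots> = (\<Sum>d<K. if d = c then y d else 0)"
    using assms unfolding orthonormal_def by (intro sum.cong) auto
  finally show ?thesis using assms by simp
qed

lemma ip_combination_self:
  assumes "orthonormal n K Y"
  shows "ip n (\<lambda>i. \<Sum>d<K. y d * Y d i) (\<lambda>i. \<Sum>d<K. y d * Y d i) = (\<Sum>c<K. (y c)\<^sup>2)"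
  by (subst ip_sum_left) (auto intro!: sum.cong simp: ip_scale_left ip_combination[OF assms] power2_eq_square)

lemma residual_orthogonal:
  assumes "orthonormal n K Y" "c < K"
  shows "ip n (Y c) (residual n K Y x) = 0"
  unfolding residual_def ip_diff_right using ip_combination[OF assms] by simp

lemma ip_residual_left:
  assumes "orthonormal n K Y"
  shows "ip n (residual n K Y x) x = ip n (residual n K Y x) (residual n K Y x)"
proof -
  have "ip n (residual n K Y x) (\<lambda>i. \<Sum>c<K. ip n (Y c) x * Y c i) = 0"
    by (simp add: ip_sum_right ip_scale_right residual_orthogonal[OF assms] ip_commute[of n "residual n K Y x"])
  then show ?thesis
    unfolding residual_def[of n K Y x] using ip_diff_right[of n "residual n K Y x" x] by (simp add: residual_def)
qed

lemma ip_residual_self: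
  assumes "orthonormal n K Y"
  shows "ip n (residual n K Y x) (residual n K Y x) = ip n x x - (\<Sum>c<K. (ip n (Y c) x)\<^sup>2)"
proof -
  have "ip n (residual n K Y x) x = ip n x x - (\<Sum>c<K. ip n (Y c) x * ip n (Y c) x)"
    unfolding residual_def ip_diff_left by (simp add: ip_sum_left ip_scale_left)
  then show ?thesis using ip_residual_left[OF assms] by (simp add: power2_eq_square)
qed

text \<open>One direction of the Courant-Fischer principle, by a dimension count.\<close>

lemma card_small_eigenvalues:
  assumes sym: "symm n W" and W: "eigenbasis n W u l" and Y: "orthonormal n K Y"
    and le: "\<And>y. let x = (\<lambda>i. \<Sum>c<K. y c * Y c i) in ip n x (mv n W x) \<le> t * ip n x x"
  shows "K \<le> card {i. i < n \<and> l i \<le> t}"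
proof (rule ccontr)
  let ?J = "{i. i < n \<and> l i \<le> t}"
  assume "\<not> ?thesis"
  then have "card ?J < K" by simp
  then obtain y where y: "\<exists>c<K. y c \<noteq> 0" and zero: "\<And>j. j \<in> ?J \<Longrightarrow> (\<Sum>c<K. ip n (Y c) (u j) * y c) = 0"
    using homogeneous_system_nontrivial[of ?J K "\<lambda>j c. ip n (Y c) (u j)"] by auto
  define x where "x = (\<lambda>i. \<Sum>c<K. y c * Y c i)"
  have zero': "ip n x (u j) = 0" if "j < n" "l j \<le> t" for j
    using zero[of j] that unfolding x_def by (simp add: ip_sum_left ip_scale_left mult.commute)
  obtain c where c: "c < K" "y c \<noteq> 0" using y by blast
  have xx: "ip n x x > 0"
    unfolding x_def ip_combination_self[OF Y] using c by (intro sum_pos2[of _ c]) auto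
  have "(\<Sum>j<n. l j * (ip n x (u j))\<^sup>2) \<le> (\<Sum>j<n. t * (ip n x (u j))\<^sup>2)"
  proof -
    have "ip n x (mv n W x) \<le> t * ip n x x" using le[of y] by (simp add: x_def Let_def)
    then show ?thesis
      using ip_power_eigenbasis[OF sym W, of x 1] ip_eigenbasis[OF W, of x x]
      by (simp add: sum_distrib_left power2_eq_square)
  qed
  then have *: "(\<Sum>j<n. (l j - t) * (ip n x (u j))\<^sup>2) \<le> 0" by (simp add: algebra_simps sum_subtractf)
  have nn: "0 \<le> (l j - t) * (ip n x (u j))\<^sup>2" if "j < n" for j
    using zero'[OF that] by (cases "l j \<le> t") auto
  have "(\<Sum>j<n. (l j - t) * (ip n x (u j))\<^sup>2) = 0"
    using * nn by (intro antisym sum_nonneg) auto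
  then have "\<forall>j<n. (l j - t) * (ip n x (u j))\<^sup>2 = 0"
    by (subst (asm) sum_nonneg_eq_0_iff) (use nn in auto)
  then have "ip n x (u j) = 0" if "j < n" for j
    using zero'[OF that] that by (cases "l j \<le> t") fastforce+
  then have "ip n x x = 0" by (subst ip_eigenbasis[OF W]) simp
  with xx show False by simp
qed

text \<open>The list es is not sorted; it only separates its first K entries from the rest. If one
  of the first K exceeded t, so would all entries from K on, leaving at most K-1 entries <= t.
  Equality of the root multisets of the two factorizations transfers the count from l to es.\<close>

lemma smallest_eigenvalue_le:
  assumes es: "length es = n" "(\<Prod>j<n. [:- l j, 1:]) = (\<Prod>e\<leftarrow>es. [:- e, 1 :: real:])"
    and small: "\<forall>i<K. \<forall>j\<in>{K..<n}. es ! i \<le> es ! j"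
    and K: "K \<le> n" "K \<le> card {i. i < n \<and> l i \<le> t}" and j: "j < K"
  shows "es ! j \<le> t"
proof (rule ccontr)
  assume "\<not> ?thesis"
  then have gt: "t < es ! j" by simp
  have proots_list: "proots (\<Prod>e\<leftarrow>es. [:- e, 1:]) = mset es" for es :: "real list"
  proof (induction es)
    case (Cons a es)
    have "(\<Prod>e\<leftarrow>es. [:- e, 1 :: real:]) \<noteq> 0" by (auto simp: prod_list_zero_iff)
    then have "proots ([:- a, 1:] * (\<Prod>e\<leftarrow>es. [:- e, 1:])) = proots [:- a, 1:] + proots (\<Prod>e\<leftarrow>es. [:- e, 1:])"
      by (intro proots_mult) simp
    then show ?case using Cons by (simp del: mult_pCons_left)
  qed simp
  have "image_mset l (mset_set {..<n}) = (\<Sum>j<n. {#l j#})"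
    by (induction n) (auto simp: lessThan_Suc)
  also have "\<dots> = proots (\<Prod>j<n. [:- l j, 1:])"
    by (subst proots_prod) auto
  also have "\<dots> = mset es"
    unfolding es(2) by (rule proots_list)
  finally have eq: "image_mset l (mset_set {..<n}) = mset es" .
  have "card {i. i < n \<and> l i \<le> t} = size (filter_mset (\<lambda>x. x \<le> t) (image_mset l (mset_set {..<n})))"
    by (simp add: filter_mset_image_mset)
  also have "\<dots> = card {i. i < n \<and> es ! i \<le> t}"
    unfolding eq by (simp add: mset_filter[symmetric] length_filter_conv_card es(1) del: mset_filter)
  also have "\<dots> \<le> card ({..<K} - {j})"
  proof (rule card_mono)
    show "{i. i < n \<and> es ! i \<le> t} \<subseteq> {..<K} - {j}"
      using small j gt by (auto simp: not_less[symmetric]) (meson atLeastLessThan_iff less_le_trans not_less order_trans)+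
  qed simp
  also have "\<dots> = K - 1" using j by simp
  finally show False using K j by linarith
qed

text \<open>M is the scalar \<nu> on the complement of span Y and has form at most \<nu> - \<delta>
  on the span, so L has at least K eigenvalues <= \<nu> - \<delta> + \<epsilon> <= \<nu> -
  \<delta>/2. For a chosen eigenvector x of L with eigenvalue \<lambda> and residual z, comparing
  z^T L x = \<lambda> |z|^2 with z^T M x = \<nu> |z|^2 gives (\<nu> - \<lambda>)|z|^2 <= \<epsilon>
  |z|. An upper bound on the span suffices, so M is not diagonalized there.\<close>

lemma davis_kahan:
  assumes sym: "symm n L" and symM: "symm n M" and Y: "orthonormal n K Y" and K: "K \<le> n"
    and eps: "op_bound n (\<lambda>i j. L i j - M i j) \<epsilon>" and gap: "0 < \<delta>" "2 * \<epsilon> \<le> \<delta>" "0 \<le> \<epsilon>"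
    and perp: "\<And>z i. (\<And>c. c < K \<Longrightarrow> ip n (Y c) z = 0) \<Longrightarrow> i < n \<Longrightarrow> mv n M z i = \<nu> * z i"
    and span: "\<And>y. let x = (\<lambda>i. \<Sum>c<K. y c * Y c i) in ip n x (mv n M x) \<le> (\<nu> - \<delta>) * ip n x x"
    and X: "smallest_eigenvectors n K (Matrix.mat n n (\<lambda>(i,j). L i j)) X"
    and j: "j < K"
  defines "z \<equiv> residual n K Y (\<lambda>i. X $$ (i,j))"
  shows "ip n z z \<le> (2 * \<epsilon> / \<delta>)\<^sup>2"
proof -
  let ?L = "Matrix.mat n n (\<lambda>(i,j). L i j)"
  define x where "x = (\<lambda>i. X $$ (i,j))"
  obtain es where es: "length es = n" "char_poly ?L = (\<Prod>e\<leftarrow>es. [:- e, 1:])"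
      "\<forall>i<K. \<forall>j\<in>{K..<n}. es ! i \<le> es ! j" "eigenvector ?L (col X j) (es ! j)"
    and Xc: "X \<in> carrier_mat n K" and XX: "transpose_mat X * X = 1\<^sub>m K"
    using X j unfolding smallest_eigenvectors_def by blast
  have xx: "ip n x x = 1"
    using arg_cong[OF XX, of "\<lambda>A. A $$ (j,j)"] j Xc by (simp add: x_def ip_def scalar_prod_def atLeast0LessThan)
  have Lx: "mv n L x i = es ! j * x i" if "i < n" for i
  proof -
    have "(?L *\<^sub>v col X j) $ i = (es ! j \<cdot>\<^sub>v col X j) $ i" using es(4) by (simp add: eigenvector_def)
    then show ?thesis using that j Xc by (simp add: x_def mv_def scalar_prod_def atLeast0LessThan)
  qed
  have diff: "ip n a (mv n L b) = ip n a (mv n M b) + ip n a (mv n (\<lambda>i j. L i j - M i j) b)" for a b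
    unfolding ip_mv by (simp add: sum.distrib[symmetric] algebra_simps)
  obtain u l where W: "eigenbasis n L u l" and cp: "char_poly ?L = (\<Prod>j<n. [:- l j, 1:])"
    using eigenbasis_exists[OF sym] by metis
  have "es ! j \<le> \<nu> - \<delta> + \<epsilon>"
  proof (rule smallest_eigenvalue_le[where l = l and n = n and K = K])
    show "K \<le> card {i. i < n \<and> l i \<le> \<nu> - \<delta> + \<epsilon>}"
    proof (rule card_small_eigenvalues[OF sym W Y])
      fix y
      define w where "w = (\<lambda>i. \<Sum>c<K. y c * Y c i)"
      have "ip n w (mv n (\<lambda>i j. L i j - M i j) w) \<le> \<epsilon> * ip n w w"
        using eps[unfolded op_bound_def, rule_format, of w w] ip_self_nonneg[of n w] by simp
      then have "ip n w (mv n L w) \<le> (\<nu> - \<delta> + \<epsilon>) * ip n w w"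
        using span[of y] unfolding diff[of w w] Let_def w_def[symmetric] by (simp add: algebra_simps)
      then show "let x = (\<lambda>i. \<Sum>c<K. y c * Y c i) in ip n x (mv n L x) \<le> (\<nu> - \<delta> + \<epsilon>) * ip n x x"
        by (simp add: Let_def w_def)
    qed
  qed (use es cp K j in auto)
  then have lam: "\<delta> / 2 \<le> \<nu> - es ! j" using gap by simp
  have z: "z = residual n K Y x" by (simp add: z_def x_def)
  have zx: "ip n z x = ip n z z" unfolding z by (rule ip_residual_left[OF Y])
  have "ip n z (mv n L x) = es ! j * ip n z z"
    using ip_cong[of n z z "mv n L x" "\<lambda>i. es ! j * x i"] Lx zx by (simp add: ip_scale_right)
  moreover have "ip n z (mv n M x) = \<nu> * ip n z z"
  proof -
    have "ip n z (mv n M x) = ip n (mv n M z) x" by (rule ip_mv_sym[OF symM, symmetric])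
    also have "\<dots> = ip n (\<lambda>i. \<nu> * z i) x"
      using perp[of z] residual_orthogonal[OF Y, of _ x] by (intro ip_cong) (auto simp: z)
    finally show ?thesis by (simp add: ip_scale_left zx)
  qed
  ultimately have "(\<nu> - es ! j) * ip n z z = - ip n z (mv n (\<lambda>i j. L i j - M i j) x)"
    using diff[of z x] by (simp add: algebra_simps)
  also have "\<dots> \<le> \<epsilon> * sqrt (ip n z z)"
    using eps[unfolded op_bound_def, rule_format, of z x] xx by simp
  finally have 1: "(\<nu> - es ! j) * ip n z z \<le> \<epsilon> * sqrt (ip n z z)" .
  have "\<delta> / 2 * ip n z z \<le> (\<nu> - es ! j) * ip n z z"
    by (intro mult_right_mono lam ip_self_nonneg)
  with 1 have 2: "\<delta> / 2 * (sqrt (ip n z z))\<^sup>2 \<le> \<epsilon> * sqrt (ip n z z)" using ip_self_nonneg[of n z] by simp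
  have "s \<le> 2 * \<epsilon> / \<delta>" if "0 \<le> s" "\<delta> / 2 * s\<^sup>2 \<le> \<epsilon> * s" for s
  proof (cases "s = 0")
    case False
    then have "\<delta> / 2 * s \<le> \<epsilon>" using that mult_right_le_imp_le[of "\<delta> / 2 * s" s \<epsilon>] by (simp add: power2_eq_square)
    then show ?thesis using gap by (simp add: field_simps)
  qed (use gap in simp)
  from this[OF _ 2] have "sqrt (ip n z z) \<le> 2 * \<epsilon> / \<delta>" by (simp add: ip_self_nonneg)
  then have "(sqrt (ip n z z))\<^sup>2 \<le> (2 * \<epsilon> / \<delta>)\<^sup>2" by (intro power_mono) (simp_all add: ip_self_nonneg)
  then show ?thesis using ip_self_nonneg[of n z] by simp
qed

section \<open>Clustering of separated data\<close>

lemma L2_set_divide: "0 \<le> c \<Longrightarrow> L2_set (\<lambda>j. f j / c) A = L2_set f A / c"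
  using L2_set_right_distrib[of "1 / c" f A] by simp

lemma L2_set_diff_commute: "L2_set (\<lambda>j. f j - g j) A = L2_set (\<lambda>j. g j - f j) A"
  by (simp add: L2_set_def power2_commute)

lemma L2_set_triangle3:
  "L2_set (\<lambda>j. f j - h j) A \<le> L2_set (\<lambda>j. f j - g j) A + L2_set (\<lambda>j. g j - h j) A"
  using L2_set_triangle_ineq[of "\<lambda>j. f j - g j" "\<lambda>j. g j - h j" A] by simp

lemma L2_set_reverse_triangle: "\<bar>L2_set f A - L2_set g A\<bar> \<le> L2_set (\<lambda>j. f j - g j) A"
  using L2_set_triangle3[of f "\<lambda>_. 0" A g] L2_set_triangle3[of g "\<lambda>_. 0" A f] L2_set_diff_commute[of f g A]
  by simp

text \<open>The difference is split at x/|m|: the radial part has length ||m| - |x||/|m|, the other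
  |x - m|/|m|, so each is at most |x - m|/|m|. For x = 0 the convention x / 0 = 0 leaves a unit
  vector, which the factor 2 covers.\<close>

lemma normalize_Lipschitz:
  assumes A: "finite A" and m: "L2_set m A > 0"
  shows "L2_set (\<lambda>j. x j / L2_set x A - m j / L2_set m A) A \<le> 2 * L2_set (\<lambda>j. x j - m j) A / L2_set m A"
proof (cases "L2_set x A = 0")
  case True
  then have "\<forall>j\<in>A. x j = 0" using A by (simp add: L2_set_eq_0_iff)
  then have "L2_set (\<lambda>j. x j - m j) A = L2_set m A" by (auto simp: L2_set_def intro!: sum.cong)
  moreover have "L2_set (\<lambda>j. x j / L2_set x A - m j / L2_set m A) A = L2_set (\<lambda>j. m j / L2_set m A) A"
    unfolding True by (simp add: L2_set_def)
  ultimately show ?thesis using m by (simp add: L2_set_divide)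
next
  case False
  then have x: "L2_set x A > 0" using L2_set_nonneg[of x A] by linarith
  let ?x = "L2_set x A" and ?m = "L2_set m A"
  have 1: "L2_set (\<lambda>j. x j / ?x - x j / ?m) A = \<bar>1 / ?x - 1 / ?m\<bar> * ?x"
  proof -
    have "L2_set (\<lambda>j. x j / ?x - x j / ?m) A = L2_set (\<lambda>j. \<bar>1 / ?x - 1 / ?m\<bar> * x j) A"
      by (simp add: L2_set_def power_mult_distrib flip: left_diff_distrib divide_inverse) (simp add: algebra_simps divide_inverse power_mult_distrib flip: power_mult_distrib)
    then show ?thesis using L2_set_right_distrib[of "\<bar>1 / ?x - 1 / ?m\<bar>" x A] by simp
  qed
  also have "\<dots> = \<bar>?m - ?x\<bar> / ?m"
    using x m by (simp add: abs_if field_simps)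
  also have "\<dots> \<le> L2_set (\<lambda>j. x j - m j) A / ?m"
    using L2_set_reverse_triangle[of x A m] m by (intro divide_right_mono) auto
  finally have 2: "L2_set (\<lambda>j. x j / ?x - x j / ?m) A \<le> L2_set (\<lambda>j. x j - m j) A / ?m" .
  have 3: "L2_set (\<lambda>j. x j / ?m - m j / ?m) A = L2_set (\<lambda>j. x j - m j) A / ?m"
    using m L2_set_divide[of ?m "\<lambda>j. x j - m j" A] by (simp add: diff_divide_distrib)
  show ?thesis
    using L2_set_triangle3[of "\<lambda>j. x j / ?x" "\<lambda>j. m j / ?m" A "\<lambda>j. x j / ?m"] 2 3 by simp
qed

lemma L2_set_power2: "(L2_set f A)\<^sup>2 = (\<Sum>j\<in>A. (f j)\<^sup>2)"
  by (simp add: L2_set_def sum_nonneg)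

section \<open>Data close to well separated centers\<close>

definition fdist :: "nat \<Rightarrow> nat \<Rightarrow> (nat \<Rightarrow> nat \<Rightarrow> real) \<Rightarrow> (nat \<Rightarrow> nat \<Rightarrow> real) \<Rightarrow> real" where
  "fdist n K f g = L2_set (\<lambda>(i,j). f i j - g i j) ({..<n} \<times> {..<K})"

lemma fdist_power2: "(fdist n K f g)\<^sup>2 = (\<Sum>i<n. (L2_set (\<lambda>j. f i j - g i j) {..<K})\<^sup>2)"
  by (simp add: fdist_def L2_set_power2 sum.cartesian_product case_prod_unfold)

lemma fdist_nonneg: "0 \<le> fdist n K f g"
  by (simp add: fdist_def)

lemma fdist_triangle: "fdist n K f h \<le> fdist n K f g + fdist n K g h"
  using L2_set_triangle3[of "\<lambda>(i,j). f i j" "\<lambda>(i,j). h i j" "{..<n} \<times> {..<K}" "\<lambda>(i,j). g i j"]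
  by (simp add: fdist_def case_prod_unfold)

lemma fdist_commute: "fdist n K f g = fdist n K g f"
  using L2_set_diff_commute[of "\<lambda>(i,j). f i j" "\<lambda>(i,j). g i j" "{..<n} \<times> {..<K}"]
  by (simp add: fdist_def case_prod_unfold)

lemma frobenius_norm_diff:
  assumes "A \<in> carrier_mat n K" "B \<in> carrier_mat n K"
  shows "frobenius_norm (A - B) = fdist n K (\<lambda>i j. A $$ (i,j)) (\<lambda>i j. B $$ (i,j))"
  using assms by (simp add: frobenius_norm_def fdist_def L2_set_def sum.cartesian_product case_prod_unfold)

lemma set_rows: "set (rows A) = row A ` {..<dim_row A}"
  by (simp add: rows_def atLeast0LessThan)

text \<open>At most K distinct rows admit an injective numbering by {..<K}, so the choice operator
  in \<open>cluster_labels\<close> has a witness.\<close>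

lemma cluster_labels_few_rows:
  assumes S: "S \<in> few_rows_mats n K K"
  shows "\<forall>i<n. cluster_labels S i < K" "\<forall>i<n. \<forall>j<n. cluster_labels S i = cluster_labels S j \<longleftrightarrow> row S i = row S j"
proof -
  have Sc: "dim_row S = n" "dim_col S = K" and rows: "card (set (rows S)) \<le> K" using S by (auto simp: few_rows_mats_def)
  obtain f where f: "f ` set (rows S) \<subseteq> {..<K}" "inj_on f (set (rows S))"
    using card_le_inj[of "set (rows S)" "{..<K}"] rows by auto
  have "(\<forall>i<dim_row S. f (row S i) < dim_col S) \<and>
     (\<forall>i<dim_row S. \<forall>j<dim_row S. f (row S i) = f (row S j) \<longleftrightarrow> row S i = row S j)"
    using f unfolding set_rows Sc by (auto simp: inj_on_def)
  then have "(\<forall>i<dim_row S. cluster_labels S i < dim_col S) \<and>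
     (\<forall>i<dim_row S. \<forall>j<dim_row S. cluster_labels S i = cluster_labels S j \<longleftrightarrow> row S i = row S j)"
    unfolding cluster_labels_def by (rule someI[where x = "\<lambda>i. f (row S i)"])
  then show "\<forall>i<n. cluster_labels S i < K" "\<forall>i<n. \<forall>j<n. cluster_labels S i = cluster_labels S j \<longleftrightarrow> row S i = row S j"
    unfolding Sc by auto
qed

text \<open>The centers have mutual distance at least 1, so a point within 1/2 of a center
  determines it; \<tau> is a budget for the total squared distance of the data from their
  centers.\<close>

locale separated_data =
  fixes n K s :: nat and \<psi> :: "nat \<Rightarrow> nat" and Xb :: "real mat" and C :: "nat \<Rightarrow> nat \<Rightarrow> real" and \<tau> :: real
  assumes psi: "i < n \<Longrightarrow> \<psi> i < K"
    and class_size: "c < K \<Longrightarrow> card {i. i < n \<and> \<psi> i = c} = s"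
    and Xb: "Xb \<in> carrier_mat n K"
    and separated: "c < K \<Longrightarrow> d < K \<Longrightarrow> c \<noteq> d \<Longrightarrow> 1 \<le> L2_set (\<lambda>j. C c j - C d j) {..<K}"
    and close: "fdist n K (\<lambda>i j. Xb $$ (i,j)) (\<lambda>i. C (\<psi> i)) \<le> sqrt \<tau>"
    and tau_nonneg: "0 \<le> \<tau>"
begin

lemma center_unique:
  assumes "c < K" "d < K" "L2_set (\<lambda>j. C c j - x j) {..<K} < 1 / 2" "L2_set (\<lambda>j. C d j - x j) {..<K} < 1 / 2"
  shows "c = d"
proof (rule ccontr)
  assume "c \<noteq> d"
  from separated[OF assms(1,2) this] show False
    using L2_set_triangle3[of "C c" "C d" "{..<K}" x] assms(3,4) L2_set_diff_commute[of "C d" x "{..<K}"] by simp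
qed

lemma bdd_below_frobenius: "bdd_below ((\<lambda>S. frobenius_norm (Xb - S)) ` A)"
  by (rule bdd_belowI[of _ 0]) (auto simp: frobenius_norm_def intro!: sum_nonneg)

lemma kmeans_eta_le: "kmeans_eta K Xb \<le> sqrt \<tau>"
proof -
  let ?S = "Matrix.mat n K (\<lambda>(i,j). C (\<psi> i) j)"
  have "set (rows ?S) \<subseteq> (\<lambda>c. Matrix.vec K (C c)) ` {..<K}"
    unfolding set_rows using psi by (auto simp: image_iff intro!: bexI[of _ "\<psi> _"] eq_vecI)
  then have "card (set (rows ?S)) \<le> card ((\<lambda>c. Matrix.vec K (C c)) ` {..<K})" by (intro card_mono) auto
  also have "\<dots> \<le> K" using card_image_le[of "{..<K}"] by simp
  finally have S: "?S \<in> few_rows_mats n K K" by (simp add: few_rows_mats_def)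
  have "kmeans_eta K Xb \<le> frobenius_norm (Xb - ?S)"
    unfolding kmeans_eta_def using Xb S by (intro cINF_lower bdd_below_frobenius) auto
  also have "\<dots> = fdist n K (\<lambda>i j. Xb $$ (i,j)) (\<lambda>i. C (\<psi> i))"
    by (subst frobenius_norm_diff[OF Xb]) (auto simp: fdist_def L2_set_def intro!: sum.cong)
  finally show ?thesis using close by simp
qed

text \<open>K-1 distinct rows cannot come within 1/2 of all K centers, as rows close to different
  centers are distinct. Hence all s rows of some class stay at distance 1/2 or more from its center
  and contribute at least s/4 to the square.\<close>

lemma fdist_few_rows:
  assumes K: "K \<ge> 2" and S: "S \<in> few_rows_mats n K (K - 1)"
  shows "sqrt s / 2 \<le> fdist n K (\<lambda>i. C (\<psi> i)) (\<lambda>i j. S $$ (i,j))"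
proof -
  let ?S = "\<lambda>i j. S $$ (i,j)"
  have Sc: "S \<in> carrier_mat n K" and rows: "card (set (rows S)) \<le> K - 1" using S by (auto simp: few_rows_mats_def)
  have "\<exists>c<K. \<forall>i<n. \<psi> i = c \<longrightarrow> 1 / 2 \<le> L2_set (\<lambda>j. C c j - ?S i j) {..<K}"
  proof (rule ccontr)
    assume "\<not> ?thesis"
    then have "\<forall>c<K. \<exists>i<n. L2_set (\<lambda>j. C c j - ?S i j) {..<K} < 1 / 2" by (auto simp: not_le)
    then obtain g where g: "\<And>c. c < K \<Longrightarrow> g c < n \<and> L2_set (\<lambda>j. C c j - ?S (g c) j) {..<K} < 1 / 2" by metis
    have "inj_on (\<lambda>c. row S (g c)) {..<K}"
    proof (rule inj_onI)
      fix c d assume cd: "c \<in> {..<K}" "d \<in> {..<K}" and eq: "row S (g c) = row S (g d)"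
      have "?S (g c) j = ?S (g d) j" if "j < K" for j
        using arg_cong[OF eq, of "\<lambda>v. vec_index v j"] that carrier_matD[OF Sc] g[of c] g[of d] cd by simp
      then have "L2_set (\<lambda>j. C d j - ?S (g c) j) {..<K} < 1 / 2"
        using g[of d] cd by (simp cong: L2_set_cong_simp)
      then show "c = d" using center_unique[of c d "?S (g c)"] g[of c] cd by simp
    qed
    then have "K = card ((\<lambda>c. row S (g c)) ` {..<K})" by (simp add: card_image)
    also have "\<dots> \<le> card (set (rows S))"
      unfolding set_rows using g Sc by (intro card_mono) auto
    finally show False using rows K by simp
  qed
  then obtain c where c: "c < K" "\<And>i. i < n \<Longrightarrow> \<psi> i = c \<Longrightarrow> 1 / 2 \<le> L2_set (\<lambda>j. C c j - ?S i j) {..<K}" by blast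
  have "(sqrt s / 2)\<^sup>2 = (\<Sum>i\<in>{i. i < n \<and> \<psi> i = c}. (1 / 2)\<^sup>2)"
    using class_size[OF c(1)] by (simp add: power2_eq_square)
  also have "\<dots> \<le> (\<Sum>i\<in>{i. i < n \<and> \<psi> i = c}. (L2_set (\<lambda>j. C (\<psi> i) j - ?S i j) {..<K})\<^sup>2)"
    using c(2) by (intro sum_mono power_mono) auto
  also have "\<dots> \<le> (\<Sum>i<n. (L2_set (\<lambda>j. C (\<psi> i) j - ?S i j) {..<K})\<^sup>2)"
    by (rule sum_mono2) auto
  also have "\<dots> = (fdist n K (\<lambda>i. C (\<psi> i)) ?S)\<^sup>2" by (simp add: fdist_power2)
  finally show ?thesis by (rule power2_le_imp_le) (rule fdist_nonneg)
qed

lemma kmeans_eta_ge: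
  assumes K: "K \<ge> 2"
  shows "sqrt s / 2 - sqrt \<tau> \<le> kmeans_eta (K - 1) Xb"
  unfolding kmeans_eta_def
proof (rule cINF_greatest)
  \<comment> \<open>The infimum needs a nonempty set; the zero matrix has at most one distinct row,
    and 1 <= K-1.\<close>
  have "row (0\<^sub>m n K :: real mat) i = 0\<^sub>v K" if "i < n" for i
    by (rule eq_vecI) (use that in auto)
  then have "set (rows (0\<^sub>m n K :: real mat)) \<subseteq> {0\<^sub>v K}" unfolding set_rows by auto
  then have "card (set (rows (0\<^sub>m n K :: real mat))) \<le> card {0\<^sub>v K :: real Matrix.vec}" by (intro card_mono) auto
  then have "0\<^sub>m n K \<in> few_rows_mats n K (K - 1)" using K by (simp add: few_rows_mats_def)
  then show "few_rows_mats (dim_row Xb) (dim_col Xb) (K - 1) \<noteq> {}" using Xb by auto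
next
  fix S assume "S \<in> few_rows_mats (dim_row Xb) (dim_col Xb) (K - 1)"
  then have S: "S \<in> few_rows_mats n K (K - 1)" using Xb by simp
  then have Sc: "S \<in> carrier_mat n K" by (simp add: few_rows_mats_def)
  show "sqrt s / 2 - sqrt \<tau> \<le> frobenius_norm (Xb - S)"
    unfolding frobenius_norm_diff[OF Xb Sc]
    using fdist_few_rows[OF K S] close fdist_commute[of n K "\<lambda>i j. Xb $$ (i,j)" "\<lambda>i. C (\<psi> i)"]
      fdist_triangle[of n K "\<lambda>i. C (\<psi> i)" "\<lambda>i j. S $$ (i,j)" "\<lambda>i j. Xb $$ (i,j)"] by linarith
qed

text \<open>
  If fewer than \<open>s\<close> rows of \<open>S\<close> are far from their class center, then every class has a close row.
  Since close rows of different classes differ and \<open>S\<close> has at most \<open>K\<close> distinct rows, all close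
  rows of one class coincide.
\<close>

lemma Err_le:
  assumes S: "S \<in> few_rows_mats n K K" and SX: "frobenius_norm (Xb - S) \<le> 2 * sqrt \<tau>" and small: "36 * \<tau> < s"
  shows "real (Err n K \<psi> (cluster_labels S)) \<le> 36 * \<tau>"
proof -
  let ?S = "\<lambda>i j. S $$ (i,j)" and ?l = "cluster_labels S"
  have Sc: "S \<in> carrier_mat n K" and rows: "card (set (rows S)) \<le> K" using S by (auto simp: few_rows_mats_def)
  define dst where "dst = (\<lambda>i. L2_set (\<lambda>j. C (\<psi> i) j - ?S i j) {..<K})"
  define bad where "bad = {i. i < n \<and> 1 / 2 \<le> dst i}"
  have finbad: "finite bad" by (simp add: bad_def)
  \<comment> \<open>The distance is 2 sqrt \<tau> from S to the data plus sqrt \<tau> from the data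
    to the centers. The later 36 is 4 times 3^2, because a bad row costs at least 1/4.\<close>
  have "fdist n K (\<lambda>i. C (\<psi> i)) ?S \<le> 3 * sqrt \<tau>"
    using fdist_triangle[of n K "\<lambda>i. C (\<psi> i)" ?S "\<lambda>i j. Xb $$ (i,j)"] close SX
      fdist_commute[of n K "\<lambda>i j. Xb $$ (i,j)" "\<lambda>i. C (\<psi> i)"] unfolding frobenius_norm_diff[OF Xb Sc] by linarith
  then have "(fdist n K (\<lambda>i. C (\<psi> i)) ?S)\<^sup>2 \<le> (3 * sqrt \<tau>)\<^sup>2" by (intro power_mono fdist_nonneg)
  then have sq: "(\<Sum>i<n. (dst i)\<^sup>2) \<le> 9 * \<tau>" using tau_nonneg by (simp add: fdist_power2 dst_def power_mult_distrib)
  have "card bad * (1 / 4) = (\<Sum>i\<in>bad. (1 / 2)\<^sup>2)" by (simp add: power2_eq_square)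
  also have "\<dots> \<le> (\<Sum>i\<in>bad. (dst i)\<^sup>2)" by (intro sum_mono power_mono) (auto simp: bad_def)
  also have "\<dots> \<le> (\<Sum>i<n. (dst i)\<^sup>2)" by (rule sum_mono2) (auto simp: bad_def)
  finally have bad: "card bad \<le> 36 * \<tau>" using sq by simp
  have "\<exists>i<n. \<psi> i = c \<and> dst i < 1 / 2" if c: "c < K" for c
  proof (rule ccontr)
    assume "\<not> ?thesis"
    then have "{i. i < n \<and> \<psi> i = c} \<subseteq> bad" by (auto simp: bad_def not_less)
    then have "s \<le> card bad" using card_mono[OF finbad] class_size[OF c] by metis
    with bad small show False by linarith
  qed
  then obtain g where g: "\<And>c. c < K \<Longrightarrow> g c < n \<and> \<psi> (g c) = c \<and> dst (g c) < 1 / 2" by metis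
  have rowS: "?S i j = ?S i' j" if "row S i = row S i'" "i < n" "i' < n" "j < K" for i i' j
    using arg_cong[OF that(1), of "\<lambda>v. vec_index v j"] that(2-4) carrier_matD[OF Sc] by simp
  have same: "\<psi> i = \<psi> i'" if "row S i = row S i'" "i < n" "i' < n" "dst i < 1 / 2" "dst i' < 1 / 2" for i i'
  proof (rule center_unique[of _ _ "?S i"])
    have "L2_set (\<lambda>j. C (\<psi> i') j - ?S i j) {..<K} = L2_set (\<lambda>j. C (\<psi> i') j - ?S i' j) {..<K}"
      using rowS[OF that(1-3)] by (intro L2_set_cong) auto
    then show "L2_set (\<lambda>j. C (\<psi> i') j - ?S i j) {..<K} < 1 / 2" using that(5) by (simp add: dst_def)
  qed (use that psi in \<open>auto simp: dst_def\<close>)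
  have inj: "inj_on (\<lambda>c. row S (g c)) {..<K}"
    by (rule inj_onI) (metis g lessThan_iff same)
  have sub: "(\<lambda>c. row S (g c)) ` {..<K} \<subseteq> set (rows S)" unfolding set_rows using g Sc by auto
  have all: "(\<lambda>c. row S (g c)) ` {..<K} = set (rows S)"
    by (rule card_seteq[OF _ sub]) (use rows inj in \<open>auto simp: card_image\<close>)
  have good: "row S i = row S (g (\<psi> i))" if i: "i < n" "dst i < 1 / 2" for i
  proof -
    have "row S i \<in> (\<lambda>c. row S (g c)) ` {..<K}" unfolding all set_rows using i Sc by auto
    then obtain c where c: "c < K" "row S i = row S (g c)" by auto
    then have "\<psi> i = c" using same[of i "g c"] g[OF c(1)] i by auto
    with c show ?thesis by simp
  qed
  note lab = cluster_labels_few_rows[OF S]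
  define lam where "lam = (\<lambda>c. ?l (g c))"
  have laminj: "inj_on lam {..<K}"
    using inj lab(2) g unfolding lam_def inj_on_def by auto
  have lamsub: "lam ` {..<K} \<subseteq> {..<K}" using lab(1) g by (auto simp: lam_def)
  have lamK: "lam ` {..<K} = {..<K}"
    by (rule card_seteq[OF _ lamsub]) (use laminj in \<open>auto simp: card_image\<close>)
  then have bij: "bij_betw lam {..<K} {..<K}" using laminj by (simp add: bij_betw_def)
  \<comment> \<open>The labels of the representatives exhaust {..<K}, so the inverse of
    \<open>lam\<close>, extended by the identity, is a relabelling.\<close>
  define \<sigma> where "\<sigma> = (\<lambda>x. if x \<in> {..<K} then inv_into {..<K} lam x else x)"
  have "bij_betw \<sigma> {..<K} {..<K}"
    using bij_betw_inv_into[OF bij] by (rule bij_betw_cong[THEN iffD1, rotated]) (simp add: \<sigma>_def)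
  then have perm: "\<sigma> permutes {..<K}" by (rule bij_imp_permutes) (simp add: \<sigma>_def)
  have "\<psi> i = \<sigma> (?l i)" if i: "i < n" "i \<notin> bad" for i
  proof -
    have "dst i < 1 / 2" using i by (simp add: bad_def not_le)
    then have "row S i = row S (g (\<psi> i))" using good i by simp
    then have "?l i = lam (\<psi> i)" using lab(2) i g[OF psi[OF i(1)]] by (simp add: lam_def)
    moreover have "lam (\<psi> i) < K" using lamsub psi[OF i(1)] by auto
    ultimately show ?thesis using psi[OF i(1)] laminj by (simp add: \<sigma>_def inv_into_f_f)
  qed
  then have "card {i. i < n \<and> \<psi> i \<noteq> \<sigma> (?l i)} \<le> card bad"
    by (intro card_mono finbad) (auto)
  moreover have "Err n K \<psi> ?l \<le> card {i. i < n \<and> \<psi> i \<noteq> \<sigma> (?l i)}"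
    unfolding Err_def using perm by (intro Min_le finite_imageI finite_permutations) auto
  ultimately show ?thesis using bad by simp
qed

end

text \<open>\<epsilon> is chosen so that the data satisfy the condition of the k-means guarantee. K
  centers cost at most sqrt(8 s \<kappa>), and K-1 centers at least sqrt s / 2 - sqrt(8 s \<kappa>);
  for sqrt \<kappa> <= 1/20 the ratio is at most 12 sqrt \<kappa>, as sqrt 8 <= 3 <= 12 (1/2 -
  3/20). The condition 147 \<epsilon>^2 <= 3, with 147 = 4 * 37 - 1, says that the approximation
  factor is at most 2. Finally 288 = 36 * 8.\<close>

lemma (in separated_data) spectral_labels_probability:
  fixes \<kappa> \<epsilon> p :: real
  assumes K: "K \<ge> 2" and s: "s > 0" and kappa: "0 < \<kappa>" "\<kappa> \<le> 1 / 400" and tau: "\<tau> = 8 * real s * \<kappa>"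
    and eps: "\<epsilon> = 12 * sqrt \<kappa>" "147 * \<epsilon>\<^sup>2 \<le> 3"
    and supp: "set_pmf (km Xb) \<subseteq> few_rows_mats n K K"
    and guarantee: "kmeans_eta K Xb \<le> \<epsilon> * kmeans_eta (K - 1) Xb \<Longrightarrow>
       p \<le> measure_pmf.prob (km Xb)
             {S. frobenius_norm (Xb - S) \<le> sqrt ((1 - \<epsilon>\<^sup>2) / (1 - 37 * \<epsilon>\<^sup>2)) * kmeans_eta K Xb}"
  shows "p \<le> measure_pmf.prob (map_pmf cluster_labels (km Xb)) {\<psi>'. real (Err n K \<psi> \<psi>') \<le> 288 * real s * \<kappa>}"
proof -
  have st: "sqrt \<tau> = sqrt 8 * sqrt s * sqrt \<kappa>" unfolding tau by (simp add: real_sqrt_mult)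
  have sk: "sqrt \<kappa> \<le> 1 / 20" by (rule real_le_lsqrt) (use kappa in \<open>auto simp: power2_eq_square\<close>)
  have s8: "sqrt 8 \<le> 3" by (rule real_le_lsqrt) auto
  have "sqrt 8 * sqrt \<kappa> \<le> 3 * (1 / 20)" using s8 sk kappa by (intro mult_mono) auto
  moreover have "3 \<le> 12 * (1 / 2 - t)" if "t \<le> 3 * (1 / 20)" for t :: real using that by simp
  ultimately have "3 \<le> 12 * (1 / 2 - sqrt 8 * sqrt \<kappa>)" by blast
  then have "sqrt 8 * (sqrt s * sqrt \<kappa>) \<le> (12 * (1 / 2 - sqrt 8 * sqrt \<kappa>)) * (sqrt s * sqrt \<kappa>)"
    using kappa by (intro mult_right_mono order_trans[OF s8]) auto
  then have "sqrt \<tau> \<le> \<epsilon> * (sqrt s / 2 - sqrt \<tau>)"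
    unfolding st eps by (simp add: algebra_simps)
  also have "\<dots> \<le> \<epsilon> * kmeans_eta (K - 1) Xb"
    using kmeans_eta_ge[OF K] kappa by (intro mult_left_mono) (auto simp: eps)
  finally have eta: "kmeans_eta K Xb \<le> \<epsilon> * kmeans_eta (K - 1) Xb" using kmeans_eta_le by simp
  have "1 - 37 * \<epsilon>\<^sup>2 > 0" using eps(2) by simp
  then have "(1 - \<epsilon>\<^sup>2) / (1 - 37 * \<epsilon>\<^sup>2) \<le> 2\<^sup>2" using eps(2) by (simp add: field_simps)
  then have gam: "sqrt ((1 - \<epsilon>\<^sup>2) / (1 - 37 * \<epsilon>\<^sup>2)) \<le> 2" using real_sqrt_le_mono by fastforce
  have eta0: "0 \<le> kmeans_eta K Xb"
  proof -
    have "0\<^sub>m n K \<in> few_rows_mats n K K"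
    proof -
      have "row (0\<^sub>m n K :: real mat) i = 0\<^sub>v K" if "i < n" for i
        by (rule eq_vecI) (use that in auto)
      then have "set (rows (0\<^sub>m n K :: real mat)) \<subseteq> {0\<^sub>v K}" unfolding set_rows by auto
      then have "card (set (rows (0\<^sub>m n K :: real mat))) \<le> card {0\<^sub>v K :: real Matrix.vec}" by (intro card_mono) auto
      then show ?thesis using K by (simp add: few_rows_mats_def)
    qed
    then show ?thesis
      unfolding kmeans_eta_def using Xb by (intro cINF_greatest) (auto simp: frobenius_norm_def intro!: sum_nonneg)
  qed
  have small: "36 * \<tau> < s" using kappa s by (simp add: tau field_simps)
  have "p \<le> measure_pmf.prob (km Xb)
             {S. frobenius_norm (Xb - S) \<le> sqrt ((1 - \<epsilon>\<^sup>2) / (1 - 37 * \<epsilon>\<^sup>2)) * kmeans_eta K Xb}"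
    by (rule guarantee[OF eta])
  \<comment> \<open>Outputs outside \<open>few_rows_mats\<close> have probability zero, so the
    inclusion of events is needed only almost surely.\<close>
  also have "\<dots> \<le> measure_pmf.prob (km Xb) (cluster_labels -` {\<psi>'. real (Err n K \<psi> \<psi>') \<le> 288 * real s * \<kappa>})"
  proof (rule measure_pmf.finite_measure_mono_AE)
    show "AE S in km Xb. S \<in> {S. frobenius_norm (Xb - S) \<le> sqrt ((1 - \<epsilon>\<^sup>2) / (1 - 37 * \<epsilon>\<^sup>2)) * kmeans_eta K Xb} \<longrightarrow>
        S \<in> cluster_labels -` {\<psi>'. real (Err n K \<psi> \<psi>') \<le> 288 * real s * \<kappa>}"
    proof (rule AE_pmfI, intro impI)
      fix S assume S: "S \<in> set_pmf (km Xb)"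
        "S \<in> {S. frobenius_norm (Xb - S) \<le> sqrt ((1 - \<epsilon>\<^sup>2) / (1 - 37 * \<epsilon>\<^sup>2)) * kmeans_eta K Xb}"
      have "frobenius_norm (Xb - S) \<le> 2 * sqrt \<tau>"
        using S(2) mult_mono[OF gam kmeans_eta_le _ eta0] by simp
      then have "real (Err n K \<psi> (cluster_labels S)) \<le> 36 * \<tau>"
        using S supp by (intro Err_le small) auto
      then show "S \<in> cluster_labels -` {\<psi>'. real (Err n K \<psi> \<psi>') \<le> 288 * real s * \<kappa>}" by (simp add: tau)
    qed
  qed simp
  also have "\<dots> = measure_pmf.prob (map_pmf cluster_labels (km Xb)) {\<psi>'. real (Err n K \<psi> \<psi>') \<le> 288 * real s * \<kappa>}"
    by simp
  finally show ?thesis .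
qed

text \<open>
  The matrix of inner products of the class indicators with the eigenvectors is almost orthogonal,
  hence the class averages of the rows of \<open>X\<close> are almost orthonormal up to scaling.
\<close>

lemma separated_normalized_rows:
  fixes \<kappa> :: real
  assumes psi: "\<And>i. i < n \<Longrightarrow> \<psi> i < K" and size: "\<And>c. c < K \<Longrightarrow> card {i. i < n \<and> \<psi> i = c} = s" and s: "s > 0"
    and Xc: "X \<in> carrier_mat n K" and XX: "transpose_mat X * X = 1\<^sub>m K"
  defines "Y \<equiv> \<lambda>c i. of_bool (\<psi> i = c) / sqrt (real s)"
  assumes Y: "orthonormal n K Y"
    and res: "(\<Sum>j<K. ip n (residual n K Y (\<lambda>i. X $$ (i,j))) (residual n K Y (\<lambda>i. X $$ (i,j)))) \<le> \<kappa>"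
    and kappa: "\<kappa> \<le> 1 / 400"
  shows "\<exists>C. separated_data n K s \<psi> (normalize_rows X) C (8 * real s * \<kappa>)"
proof -
  define x where "x = (\<lambda>j i. X $$ (i,j))"
  define M where "M = (\<lambda>c j. ip n (Y c) (x j))"
  define r where "r = (\<lambda>c. residual n K x (Y c))"
  have x: "orthonormal n K x"
    unfolding orthonormal_def
  proof (intro allI impI)
    fix c d assume "c < K" "d < K"
    then show "ip n (x c) (x d) = of_bool (c = d)"
      using arg_cong[OF XX, of "\<lambda>A. A $$ (c,d)"] Xc by (simp add: x_def ip_def scalar_prod_def atLeast0LessThan)
  qed
  have res0: "0 \<le> (\<Sum>j<K. ip n (residual n K Y (x j)) (residual n K Y (x j)))"
    by (intro sum_nonneg ip_self_nonneg)
  have k0: "0 \<le> \<kappa>" using res0 res by (simp add: x_def)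
  have rr: "ip n (r c) (r c) = 1 - (\<Sum>j<K. (M c j)\<^sup>2)" if "c < K" for c
    using ip_residual_self[OF x, of "Y c"] Y that by (simp add: r_def M_def orthonormal_def ip_commute[of n "x _"])
  \<comment> \<open>The two families of K orthonormal vectors play symmetric roles: both total
    squared residuals equal K minus the sum of the squared entries of M.\<close>
  have "(\<Sum>c<K. ip n (r c) (r c)) = K - (\<Sum>c<K. \<Sum>j<K. (M c j)\<^sup>2)"
    using rr by (simp add: sum_subtractf)
  also have "(\<Sum>c<K. \<Sum>j<K. (M c j)\<^sup>2) = (\<Sum>j<K. \<Sum>c<K. (M c j)\<^sup>2)" by (rule sum.swap)
  also have "K - (\<Sum>j<K. \<Sum>c<K. (M c j)\<^sup>2) = (\<Sum>j<K. ip n (residual n K Y (x j)) (residual n K Y (x j)))"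
    using x by (simp add: ip_residual_self[OF Y] orthonormal_def sum_subtractf M_def)
  finally have sumr: "(\<Sum>c<K. ip n (r c) (r c)) \<le> \<kappa>" using res by (simp add: x_def)
  have rk: "ip n (r c) (r c) \<le> \<kappa>" if "c < K" for c
  proof -
    have "ip n (r c) (r c) \<le> (\<Sum>c<K. ip n (r c) (r c))"
      by (rule member_le_sum) (use that in \<open>auto simp: ip_self_nonneg\<close>)
    with sumr show ?thesis by simp
  qed
  have Mlow: "1 - \<kappa> \<le> (\<Sum>j<K. (M c j)\<^sup>2)" if "c < K" for c
    using rr[OF that] rk[OF that] by simp
  have rxr: "ip n (r c) (r d) = - (\<Sum>j<K. M c j * M d j)" if "c < K" "d < K" "c \<noteq> d" for c d
  proof -
    have "ip n (r c) (r d) = ip n (r c) (Y d) - ip n (r c) (\<lambda>i. \<Sum>j<K. ip n (x j) (Y d) * x j i)"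
      unfolding r_def residual_def[of n K x "Y d"] by (rule ip_diff_right)
    also have "ip n (r c) (\<lambda>i. \<Sum>j<K. ip n (x j) (Y d) * x j i) = 0"
      unfolding r_def by (simp add: ip_sum_right ip_scale_right residual_orthogonal[OF x] ip_commute[of n "residual n K x (Y c)"])
    also have "ip n (r c) (Y d) = ip n (Y c) (Y d) - (\<Sum>j<K. ip n (x j) (Y c) * ip n (x j) (Y d))"
      unfolding r_def residual_def ip_diff_left by (simp add: ip_sum_left ip_scale_left)
    finally show ?thesis using Y that by (simp add: orthonormal_def M_def ip_commute[of n "x _"])
  qed
  \<comment> \<open>Y_c and Y_d are orthogonal, so the (c,d) entry of M M^T is minus the inner
    product of two residuals, each of norm at most sqrt \<kappa>.\<close>
  have MM: "(\<Sum>j<K. M c j * M d j) \<le> \<kappa>" if cd: "c < K" "d < K" "c \<noteq> d" for c d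
  proof -
    have "- (\<Sum>j<K. M c j * M d j) \<ge> - (sqrt (ip n (r c) (r c)) * sqrt (ip n (r d) (r d)))"
      using ip_Cauchy_Schwarz_abs[of n "r c" "r d"] unfolding rxr[OF cd] by linarith
    moreover have "sqrt (ip n (r c) (r c)) * sqrt (ip n (r d) (r d)) \<le> sqrt \<kappa> * sqrt \<kappa>"
      using rk cd k0 by (intro mult_mono) (auto simp: ip_self_nonneg)
    ultimately show ?thesis using k0 by simp
  qed
  define \<mu> where "\<mu> = (\<lambda>c. L2_set (M c) {..<K})"
  have mu2: "(\<mu> c)\<^sup>2 = (\<Sum>j<K. (M c j)\<^sup>2)" for c by (simp add: \<mu>_def L2_set_power2)
  have mu: "\<mu> c > 0" if "c < K" for c
  proof -
    have "(\<mu> c)\<^sup>2 > 0" using Mlow[OF that] kappa unfolding mu2 by simp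
    moreover have "0 \<le> \<mu> c" by (simp add: \<mu>_def)
    ultimately show ?thesis by (cases "\<mu> c = 0") auto
  qed
  \<comment> \<open>The centers are the rows of M scaled to unit length. Unit vectors with inner
    product at most 1/2 are at distance at least 1.\<close>
  define C where "C = (\<lambda>c j. M c j / \<mu> c)"
  have sep: "1 \<le> L2_set (\<lambda>j. C c j - C d j) {..<K}" if cd: "c < K" "d < K" "c \<noteq> d" for c d
  proof -
    have m: "\<mu> c > 0" "\<mu> d > 0" using mu cd by auto
    have one: "(\<Sum>j<K. (C c j)\<^sup>2) = 1" if "c < K" for c
      using mu[OF that] by (simp add: C_def power_divide sum_divide_distrib[symmetric] mu2[symmetric])
    have "1 - \<kappa> \<le> sqrt ((\<mu> c)\<^sup>2) * sqrt ((\<mu> d)\<^sup>2)"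
    proof -
      have "(1 - \<kappa>)\<^sup>2 \<le> (\<mu> c)\<^sup>2 * (\<mu> d)\<^sup>2"
        unfolding power2_eq_square[of "1 - \<kappa>"] using Mlow cd kappa mu2 by (intro mult_mono) (auto intro: sum_nonneg)
      then show ?thesis using real_le_rsqrt by (simp add: real_sqrt_mult[symmetric] del: real_sqrt_abs)
    qed
    then have mm: "1 - \<kappa> \<le> \<mu> c * \<mu> d" using m by simp
    have "(\<Sum>j<K. C c j * C d j) = (\<Sum>j<K. M c j * M d j) / (\<mu> c * \<mu> d)"
      by (simp add: C_def sum_divide_distrib)
    also have "\<dots> \<le> \<kappa> / (\<mu> c * \<mu> d)"
      using MM[OF cd] m by (intro divide_right_mono) auto
    also have "\<dots> \<le> \<kappa> / (1 - \<kappa>)"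
      using mm k0 kappa m by (intro divide_left_mono) auto
    also have "\<dots> \<le> 1 / 2" using kappa by (simp add: field_simps)
    finally have CC: "(\<Sum>j<K. C c j * C d j) \<le> 1 / 2" .
    have "(L2_set (\<lambda>j. C c j - C d j) {..<K})\<^sup>2 = (\<Sum>j<K. (C c j)\<^sup>2) + (\<Sum>j<K. (C d j)\<^sup>2) - 2 * (\<Sum>j<K. C c j * C d j)"
      by (simp add: L2_set_power2 power2_diff sum.distrib sum_subtractf sum_distrib_left algebra_simps)
    then have "1\<^sup>2 \<le> (L2_set (\<lambda>j. C c j - C d j) {..<K})\<^sup>2" using CC one cd by simp
    then show ?thesis by (rule power2_le_imp_le) simp
  qed
  have proj: "residual n K Y (x j) i = X $$ (i,j) - M (\<psi> i) j / sqrt s" if "i < n" for i j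
  proof -
    have "(\<Sum>c<K. ip n (Y c) (x j) * Y c i) = (\<Sum>c<K. if c = \<psi> i then M c j / sqrt s else 0)"
      by (intro sum.cong) (auto simp: Y_def M_def)
    then show ?thesis using psi[OF that] by (simp add: residual_def x_def)
  qed
  have row: "(L2_set (\<lambda>j. normalize_rows X $$ (i,j) - C (\<psi> i) j) {..<K})\<^sup>2
      \<le> 8 * real s * (\<Sum>j<K. (residual n K Y (x j) i)\<^sup>2)" if i: "i < n" for i
  proof -
    \<comment> \<open>Scaling by sqrt s leaves the normalized row unchanged and makes row i of X
      approximate row \<open>\<psi> i\<close> of M, since the projection of X onto the class
      indicators has entries M / sqrt s.\<close>
    let ?x = "\<lambda>j. sqrt s * X $$ (i,j)"
    have pi: "\<psi> i < K" using psi i by simp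
    have Lx: "L2_set ?x {..<K} = sqrt s * L2_set (\<lambda>j. X $$ (i,j)) {..<K}"
      by (rule L2_set_right_distrib[symmetric]) simp
    have "L2_set (\<lambda>j. normalize_rows X $$ (i,j) - C (\<psi> i) j) {..<K}
        = L2_set (\<lambda>j. ?x j / L2_set ?x {..<K} - M (\<psi> i) j / L2_set (M (\<psi> i)) {..<K}) {..<K}"
      unfolding Lx using i Xc s by (intro L2_set_cong) (auto simp: normalize_rows_def L2_set_def C_def \<mu>_def)
    also have "\<dots> \<le> 2 * L2_set (\<lambda>j. ?x j - M (\<psi> i) j) {..<K} / \<mu> (\<psi> i)"
      unfolding \<mu>_def using mu[OF pi] by (intro normalize_Lipschitz) (auto simp: \<mu>_def)
    finally have "(L2_set (\<lambda>j. normalize_rows X $$ (i,j) - C (\<psi> i) j) {..<K})\<^sup>2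
        \<le> (2 * L2_set (\<lambda>j. ?x j - M (\<psi> i) j) {..<K} / \<mu> (\<psi> i))\<^sup>2"
      by (intro power_mono) auto
    also have "\<dots> = 4 * (L2_set (\<lambda>j. ?x j - M (\<psi> i) j) {..<K})\<^sup>2 / (\<mu> (\<psi> i))\<^sup>2"
      by (simp add: power_divide power_mult_distrib)
    \<comment> \<open>The square of \<mu> is at least 1 - \<kappa> >= 1/2, which gives the factor
      8.\<close>
    also have "\<dots> \<le> 4 * (L2_set (\<lambda>j. ?x j - M (\<psi> i) j) {..<K})\<^sup>2 / (1 / 2)"
      using Mlow[OF pi] kappa mu2[of "\<psi> i"] by (intro divide_left_mono) auto
    also have "(L2_set (\<lambda>j. ?x j - M (\<psi> i) j) {..<K})\<^sup>2 = (\<Sum>j<K. s * (residual n K Y (x j) i)\<^sup>2)"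
      unfolding L2_set_power2
    proof (intro sum.cong refl)
      fix j
      have "sqrt s * X $$ (i,j) - M (\<psi> i) j = sqrt s * (X $$ (i,j) - M (\<psi> i) j / sqrt s)"
        using s by (simp add: field_simps)
      then show "(?x j - M (\<psi> i) j)\<^sup>2 = s * (residual n K Y (x j) i)\<^sup>2"
        unfolding proj[OF i] by (simp add: power_mult_distrib)
    qed
    finally show ?thesis by (simp only: sum_distrib_left[symmetric]) (simp add: mult_ac)
  qed
  have "(fdist n K (\<lambda>i j. normalize_rows X $$ (i,j)) (\<lambda>i. C (\<psi> i)))\<^sup>2
      \<le> (\<Sum>i<n. 8 * real s * (\<Sum>j<K. (residual n K Y (x j) i)\<^sup>2))"
    unfolding fdist_power2 by (intro sum_mono row) auto
  also have "\<dots> = 8 * real s * (\<Sum>j<K. ip n (residual n K Y (x j)) (residual n K Y (x j)))"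
    unfolding sum_distrib_left[symmetric] by (subst sum.swap) (simp add: ip_def power2_eq_square)
  also have "\<dots> \<le> 8 * real s * \<kappa>" using res by (intro mult_left_mono) (auto simp: x_def)
  finally have "fdist n K (\<lambda>i j. normalize_rows X $$ (i,j)) (\<lambda>i. C (\<psi> i)) \<le> sqrt (8 * real s * \<kappa>)"
    by (rule real_le_rsqrt)
  then have "separated_data n K s \<psi> (normalize_rows X) C (8 * real s * \<kappa>)"
    using psi size sep k0 Xc by unfold_locales (auto simp: normalize_rows_def)
  then show ?thesis by blast
qed

section \<open>The planted model\<close>

definition sets_containing :: "nat \<Rightarrow> nat set \<Rightarrow> nat set \<Rightarrow> nat set set" where
  "sets_containing M U T = {\<xi>. \<xi> \<subseteq> U \<and> T \<subseteq> \<xi> \<and> 2 \<le> card \<xi> \<and> card \<xi> \<le> M}"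

text \<open>The binomial coefficient counts the m-sets of an N-set through t fixed elements. With t
  <= 2 <= m the difference m - t is not truncated; N - t has its meaning when the t elements lie in
  the N-set.\<close>

definition weighted_count :: "nat \<Rightarrow> (nat \<Rightarrow> real) \<Rightarrow> nat \<Rightarrow> nat \<Rightarrow> real" where
  "weighted_count M w N t = (\<Sum>m=2..M. w m * real ((N - t) choose (m - t)))"

lemma card_supersets:
  assumes U: "finite U" and T: "T \<subseteq> U" and m: "card T \<le> m"
  shows "card {\<xi>. \<xi> \<subseteq> U \<and> T \<subseteq> \<xi> \<and> card \<xi> = m} = (card U - card T) choose (m - card T)"
proof -
  have fT: "finite T" using U T finite_subset by blast
  have "bij_betw (\<lambda>A. A \<union> T) {A. A \<subseteq> U - T \<and> card A = m - card T} {\<xi>. \<xi> \<subseteq> U \<and> T \<subseteq> \<xi> \<and> card \<xi> = m}"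
  proof (rule bij_betw_byWitness[where f' = "\<lambda>\<xi>. \<xi> - T"])
    show "(\<lambda>A. A \<union> T) ` {A. A \<subseteq> U - T \<and> card A = m - card T} \<subseteq> {\<xi>. \<xi> \<subseteq> U \<and> T \<subseteq> \<xi> \<and> card \<xi> = m}"
    proof safe
      fix A assume A: "A \<subseteq> U - T" "card A = m - card T"
      have "finite A" using A U finite_subset by blast
      then show "card (A \<union> T) = m" using A fT m by (subst card_Un_disjoint) auto
    qed (use T in auto)
    show "(\<lambda>\<xi>. \<xi> - T) ` {\<xi>. \<xi> \<subseteq> U \<and> T \<subseteq> \<xi> \<and> card \<xi> = m} \<subseteq> {A. A \<subseteq> U - T \<and> card A = m - card T}"
      using fT by (auto simp: card_Diff_subset)
  qed auto
  from bij_betw_same_card[OF this] show ?thesis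
    using n_subsets[of "U - T" "m - card T"] U T fT by (simp add: card_Diff_subset)
qed

lemma sum_sets_containing:
  assumes U: "finite U" and T: "T \<subseteq> U" and t: "card T \<le> 2"
  shows "(\<Sum>\<xi>\<in>sets_containing M U T. w (card \<xi>)) = weighted_count M w (card U) (card T)"
proof -
  have fin: "finite (sets_containing M U T)"
    by (rule finite_subset[of _ "Pow U"]) (use U in \<open>auto simp: sets_containing_def\<close>)
  have "(\<Sum>\<xi>\<in>sets_containing M U T. w (card \<xi>))
      = (\<Sum>m\<in>{2..M}. \<Sum>\<xi>\<in>{\<xi>\<in>sets_containing M U T. card \<xi> = m}. w (card \<xi>))"
    by (rule sum.group[symmetric]) (use fin in \<open>auto simp: sets_containing_def\<close>)
  also have "\<dots> = (\<Sum>m\<in>{2..M}. w m * real ((card U - card T) choose (m - card T)))"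
  proof (rule sum.cong[OF refl])
    fix m assume m: "m \<in> {2..M}"
    then have "{\<xi>\<in>sets_containing M U T. card \<xi> = m} = {\<xi>. \<xi> \<subseteq> U \<and> T \<subseteq> \<xi> \<and> card \<xi> = m}"
      by (auto simp: sets_containing_def)
    then show "(\<Sum>\<xi>\<in>{\<xi>\<in>sets_containing M U T. card \<xi> = m}. w (card \<xi>)) = w m * real ((card U - card T) choose (m - card T))"
      using card_supersets[OF U T, of m] m t by (simp add: mult.commute)
  qed
  finally show ?thesis by (simp add: weighted_count_def)
qed

lemma weighted_count_nonneg: "(\<And>m. m \<in> {2..M} \<Longrightarrow> 0 \<le> w m) \<Longrightarrow> 0 \<le> weighted_count M w N t"
  unfolding weighted_count_def by (intro sum_nonneg mult_nonneg_nonneg) auto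

lemma weighted_count_ge_term:
  assumes "\<And>m. m \<in> {2..M} \<Longrightarrow> 0 \<le> w m" "m \<in> {2..M}"
  shows "w m * real ((N - t) choose (m - t)) \<le> weighted_count M w N t"
  unfolding weighted_count_def
  by (rule member_le_sum[of _ _ "\<lambda>m. w m * real ((N - t) choose (m - t))"]) (use assms in auto)

section \<open>Means of the planted model and positivity of \<delta>\<close>

locale planted_model =
  fixes n K M :: nat and \<psi> :: "nat \<Rightarrow> nat" and p q :: real and \<alpha> :: "nat \<Rightarrow> real"
  assumes balanced: "balanced_classes n K \<psi>"
    and n_pos: "0 < n"
    and p: "0 < p" and q: "0 < q" and pq: "p + q \<le> 1"
    and alpha_nonneg: "m \<in> {2..M} \<Longrightarrow> 0 \<le> \<alpha> m" and alpha_le_1: "m \<in> {2..M} \<Longrightarrow> \<alpha> m \<le> 1"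
begin

definition s :: nat where "s = n div K"

lemma K_pos: "0 < K" and psi: "i < n \<Longrightarrow> \<psi> i < K" and class_size: "c < K \<Longrightarrow> card {i. i < n \<and> \<psi> i = c} = s"
  and n_eq: "n = K * s" and s_pos: "0 < s" and K_le_n: "K \<le> n"
proof -
  show K: "0 < K" and "i < n \<Longrightarrow> \<psi> i < K" and "c < K \<Longrightarrow> card {i. i < n \<and> \<psi> i = c} = s"
    using balanced by (auto simp: balanced_classes_def s_def)
  show n: "n = K * s" using balanced by (simp add: balanced_classes_def s_def)
  show "0 < s" using n n_pos by (cases s) auto
  then show "K \<le> n" using n by (cases s) auto
qed

abbreviation PE :: "nat set set" where "PE \<equiv> potential_edges n M"

definition pr :: "nat set \<Rightarrow> real" where
  "pr \<xi> = (if \<forall>i\<in>\<xi>. \<forall>j\<in>\<xi>. \<psi> i = \<psi> j then \<alpha> (card \<xi>) * (p + q) else \<alpha> (card \<xi>) * q)"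

abbreviation H :: "(nat set \<Rightarrow> bool) pmf" where "H \<equiv> planted_hypergraph n M \<psi> p q \<alpha>"

lemma H_eq: "H = Pi_pmf PE False (\<lambda>\<xi>. bernoulli_pmf (pr \<xi>))"
  by (simp add: planted_hypergraph_def pr_def)

lemma finite_PE: "finite PE"
  by (rule finite_subset[of _ "Pow {..<n}"]) (auto simp: potential_edges_def)

lemma pr_bounds:
  assumes "\<xi> \<in> PE" shows "0 \<le> pr \<xi>" "pr \<xi> \<le> 1"
proof -
  have m: "card \<xi> \<in> {2..M}" using assms by (simp add: potential_edges_def)
  show "0 \<le> pr \<xi>" using alpha_nonneg[OF m] p q by (simp add: pr_def)
  have "\<alpha> (card \<xi>) * c \<le> 1" if "0 \<le> c" "c \<le> 1" for c
    using alpha_nonneg[OF m] alpha_le_1[OF m] that by (intro mult_le_one) auto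
  then show "pr \<xi> \<le> 1" using p q pq by (simp add: pr_def)
qed

lemma integrable_H: "integrable H (f :: (nat set \<Rightarrow> bool) \<Rightarrow> real)"
  unfolding H_eq by (intro integrable_measure_pmf_finite finite_set_Pi_pmf_bool finite_PE)

lemma expectation_edge: "\<xi> \<in> PE \<Longrightarrow> measure_pmf.expectation H (\<lambda>h. of_bool (h \<xi>)) = pr \<xi>"
  unfolding H_eq
  by (subst expectation_Pi_bernoulli_resample[where i = \<xi>]) (simp_all add: finite_PE pr_bounds)

text \<open>Every set has probability at least \<alpha> q, and a set inside one class gains an
  additional \<alpha> p. Each mean is therefore a q-part counted among all n nodes plus, where
  applicable, a p-part counted inside a class of size s. Below, \<open>a_gap\<close> is the p-part
  for two distinct nodes of one class; it is the signal.\<close>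

definition d :: real where
  "d = q * weighted_count M \<alpha> n 1 + p * weighted_count M \<alpha> s 1"

definition a_diag :: real where
  "a_diag = q * weighted_count M (\<lambda>m. \<alpha> m / m) n 1 + p * weighted_count M (\<lambda>m. \<alpha> m / m) s 1"

definition a_out :: real where
  "a_out = q * weighted_count M (\<lambda>m. \<alpha> m / m) n 2"

definition a_gap :: real where
  "a_gap = p * weighted_count M (\<lambda>m. \<alpha> m / m) s 2"

definition Amean :: "nat \<Rightarrow> nat \<Rightarrow> real" where
  "Amean i j = (\<Sum>\<xi>\<in>PE. pr \<xi> / card \<xi> * (of_bool (i \<in> \<xi>) * of_bool (j \<in> \<xi>)))"

text \<open>A monochromatic superset of T lies inside the class of any element of T, which turns the
  p-part into a count in a set of size s; a T meeting two classes has no such superset.\<close>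

lemma sum_pr_containing:
  assumes T: "T \<subseteq> {..<n}" "T \<noteq> {}" "card T \<le> 2"
  shows "(\<Sum>\<xi>\<in>{\<xi>\<in>PE. T \<subseteq> \<xi>}. pr \<xi> * w (card \<xi>))
      = q * weighted_count M (\<lambda>m. \<alpha> m * w m) n (card T)
      + (if \<forall>i\<in>T. \<forall>j\<in>T. \<psi> i = \<psi> j then p * weighted_count M (\<lambda>m. \<alpha> m * w m) s (card T) else 0)"
proof -
  define mono where "mono = (\<lambda>\<xi>. \<forall>i\<in>\<xi>. \<forall>j\<in>\<xi>. \<psi> i = \<psi> j)"
  have pr_eq: "pr \<xi> = (if mono \<xi> then \<alpha> (card \<xi>) * (p + q) else \<alpha> (card \<xi>) * q)" for \<xi>
    by (simp only: pr_def mono_def)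
  obtain i0 where i0: "i0 \<in> T" using T by blast
  then have i0n: "i0 < n" using T by auto
  define U where "U = {i. i < n \<and> \<psi> i = \<psi> i0}"
  have U: "finite U" "card U = s" using class_size[OF psi[OF i0n]] by (auto simp: U_def)
  have PE: "{\<xi>\<in>PE. T \<subseteq> \<xi>} = sets_containing M {..<n} T"
    by (auto simp: potential_edges_def sets_containing_def)
  have fin: "finite (sets_containing M {..<n} T)"
    by (rule finite_subset[of _ "Pow {..<n}"]) (auto simp: sets_containing_def)
  have "(\<Sum>\<xi>\<in>{\<xi>\<in>PE. T \<subseteq> \<xi>}. pr \<xi> * w (card \<xi>))
      = (\<Sum>\<xi>\<in>sets_containing M {..<n} T. q * (\<alpha> (card \<xi>) * w (card \<xi>)) + (if mono \<xi> then p * (\<alpha> (card \<xi>) * w (card \<xi>)) else 0))"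
    unfolding PE by (rule sum.cong) (auto simp: pr_eq algebra_simps)
  also have "\<dots> = q * (\<Sum>\<xi>\<in>sets_containing M {..<n} T. \<alpha> (card \<xi>) * w (card \<xi>))
      + (\<Sum>\<xi>\<in>{\<xi>\<in>sets_containing M {..<n} T. mono \<xi>}. p * (\<alpha> (card \<xi>) * w (card \<xi>)))"
    using fin by (simp add: sum.distrib sum_distrib_left sum.inter_filter)
  also have "(\<Sum>\<xi>\<in>sets_containing M {..<n} T. \<alpha> (card \<xi>) * w (card \<xi>)) = weighted_count M (\<lambda>m. \<alpha> m * w m) n (card T)"
    using sum_sets_containing[where U = "{..<n}" and T = T and M = M and w = "\<lambda>m. \<alpha> m * w m"] T by simp
  also have "(\<Sum>\<xi>\<in>{\<xi>\<in>sets_containing M {..<n} T. mono \<xi>}. p * (\<alpha> (card \<xi>) * w (card \<xi>)))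
      = (if mono T then p * weighted_count M (\<lambda>m. \<alpha> m * w m) s (card T) else 0)"
  proof (cases "mono T")
    case True
    have "{\<xi>\<in>sets_containing M {..<n} T. mono \<xi>} = sets_containing M U T"
    proof (intro equalityI subsetI)
      fix \<xi> assume "\<xi> \<in> {\<xi>\<in>sets_containing M {..<n} T. mono \<xi>}"
      then show "\<xi> \<in> sets_containing M U T" using i0 unfolding sets_containing_def U_def mono_def by blast
    next
      fix \<xi> assume "\<xi> \<in> sets_containing M U T"
      then show "\<xi> \<in> {\<xi>\<in>sets_containing M {..<n} T. mono \<xi>}"
        unfolding sets_containing_def U_def mono_def by (auto simp: subset_iff)
    qed
    moreover have "T \<subseteq> U"
    proof
      fix i assume i: "i \<in> T"
      then have "\<psi> i = \<psi> i0" using True i0 unfolding mono_def by blast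
      with i T(1) show "i \<in> U" by (auto simp: U_def)
    qed
    then have "(\<Sum>\<xi>\<in>sets_containing M U T. \<alpha> (card \<xi>) * w (card \<xi>)) = weighted_count M (\<lambda>m. \<alpha> m * w m) s (card T)"
      using sum_sets_containing[where U = U and T = T and M = M and w = "\<lambda>m. \<alpha> m * w m"] U T(3) by metis
    ultimately show ?thesis
      using True by (simp only: sum_distrib_left[symmetric] if_True)
  next
    case False
    then have "{\<xi>\<in>sets_containing M {..<n} T. mono \<xi>} = {}" unfolding sets_containing_def mono_def by blast
    then show ?thesis using False by (simp only: sum.empty if_False)
  qed
  finally show ?thesis by (simp only: mono_def)
qed

lemma sum_PE_indicator:
  "(\<Sum>\<xi>\<in>PE. f \<xi> * (of_bool (i \<in> \<xi>) * of_bool (j \<in> \<xi>))) = (\<Sum>\<xi>\<in>{\<xi>\<in>PE. {i,j} \<subseteq> \<xi>}. f \<xi> :: real)"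
  by (subst sum.inter_filter[OF finite_PE]) (auto intro!: sum.cong)

lemma Amean_eq:
  assumes "i < n" "j < n"
  shows "Amean i j = (if i = j then a_diag else a_out + (if \<psi> i = \<psi> j then a_gap else 0))"
proof -
  have "Amean i j = (\<Sum>\<xi>\<in>{\<xi>\<in>PE. {i,j} \<subseteq> \<xi>}. pr \<xi> * (1 / card \<xi>))"
    unfolding Amean_def by (subst sum_PE_indicator) simp
  also have "\<dots> = q * weighted_count M (\<lambda>m. \<alpha> m * (1 / m)) n (card {i,j})
      + (if \<psi> i = \<psi> j then p * weighted_count M (\<lambda>m. \<alpha> m * (1 / m)) s (card {i,j}) else 0)"
    using assms by (subst sum_pr_containing[of "{i,j}" "\<lambda>m. 1 / m"]) (auto simp: card_insert_if)
  finally show ?thesis by (auto simp: a_diag_def a_out_def a_gap_def numeral_2_eq_2)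
qed

lemma sum_pr_degree:
  assumes "i < n"
  shows "(\<Sum>\<xi>\<in>PE. pr \<xi> * of_bool (i \<in> \<xi>)) = d"
proof -
  have "(\<Sum>\<xi>\<in>PE. pr \<xi> * of_bool (i \<in> \<xi>)) = (\<Sum>\<xi>\<in>PE. pr \<xi> * (of_bool (i \<in> \<xi>) * of_bool (i \<in> \<xi>)))"
    by (intro sum.cong) auto
  also have "\<dots> = (\<Sum>\<xi>\<in>{\<xi>\<in>PE. {i} \<subseteq> \<xi>}. pr \<xi> * 1)"
    by (subst sum_PE_indicator) simp
  also have "\<dots> = d"
    using assms by (subst sum_pr_containing[of "{i}" "\<lambda>_. 1"]) (auto simp: d_def)
  finally show ?thesis .
qed

lemma expected_degree:
  assumes "i < n" shows "expected_mat n H (degree_mat n M) $$ (i,i) = d"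
proof -
  have "expected_mat n H (degree_mat n M) $$ (i,i) = (\<Sum>\<xi>\<in>PE. measure_pmf.expectation H (\<lambda>h. of_bool (h \<xi>)) * of_bool (i \<in> \<xi>))"
    using assms by (simp add: expected_mat_def degree_mat_def integrable_H)
  also have "\<dots> = d" using sum_pr_degree[OF assms] by (simp add: expectation_edge cong: sum.cong)
  finally show ?thesis .
qed

lemma expected_adjacency:
  assumes "i < n" "j < n" shows "expected_mat n H (adjacency_mat n M) $$ (i,j) = Amean i j"
proof -
  have "expected_mat n H (adjacency_mat n M) $$ (i,j)
      = (\<Sum>\<xi>\<in>PE. measure_pmf.expectation H (\<lambda>h. of_bool (h \<xi>)) / card \<xi> * (of_bool (i \<in> \<xi>) * of_bool (j \<in> \<xi>)))"
    using assms by (simp add: expected_mat_def adjacency_mat_def integrable_H)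
  also have "\<dots> = Amean i j" unfolding Amean_def by (simp add: expectation_edge cong: sum.cong)
  finally show ?thesis .
qed

lemma weights_nonneg: "m \<in> {2..M} \<Longrightarrow> 0 \<le> \<alpha> m / real m"
  using alpha_nonneg by auto

lemma a_out_nonneg: "0 \<le> a_out" and a_gap_nonneg: "0 \<le> a_gap" and d_nonneg: "0 \<le> d"
  using weighted_count_nonneg[where w = "\<lambda>m. \<alpha> m / m" and M = M, OF weights_nonneg]
    weighted_count_nonneg[where w = \<alpha> and M = M, OF alpha_nonneg] p q
  by (simp_all add: a_out_def a_gap_def d_def)

text \<open>The class matrix is \<open>a_out\<close> times the all-ones matrix plus
  \<open>a_gap\<close> times the identity. An eigenvector whose coordinates sum to zero has
  eigenvalue \<open>a_gap\<close>, and summing the eigenvalue equation gives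
  \<open>K * a_out + a_gap\<close> for every other one. The expected degrees agree for all nodes,
  and so do the diagonal entries, hence the subtracted maximum is 0. Sets of size 2 make
  \<open>a_gap\<close> positive.\<close>

lemma planted_delta_pos:
  assumes s2: "2 \<le> s" and M: "2 \<le> M" and alpha2: "0 < \<alpha> 2"
  shows "0 < planted_delta n K M \<psi> p q \<alpha>"
proof -
  have m2: "2 \<in> {2..M}" using M by simp
  have gap: "0 < a_gap"
    using weighted_count_ge_term[where w = "\<lambda>m. \<alpha> m / m" and M = M and m = 2 and N = s and t = 2, OF weights_nonneg m2] p alpha2 unfolding a_gap_def by auto
  have "K * 2 \<le> K * s" using s2 by simp
  also have "K * s = n" by (rule n_eq[symmetric])
  finally have n2: "2 \<le> n" using K_pos by linarith
  have "0 < \<alpha> 2 * real ((n - 1) choose (2 - 1))" using n2 alpha2 by simp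
  then have "0 < weighted_count M \<alpha> n 1"
    using weighted_count_ge_term[where w = \<alpha> and M = M and m = 2 and N = n and t = 1, OF alpha_nonneg m2] by linarith
  then have d: "0 < d" using q p weighted_count_nonneg[where w = \<alpha> and M = M and N = s and t = 1, OF alpha_nonneg] unfolding d_def
    by (intro add_pos_nonneg) auto
  let ?D = "expected_mat n H (degree_mat n M)" and ?A = "expected_mat n H (adjacency_mat n M)"
  define G where "G = class_mat n K \<psi> ?A"
  have G: "G $$ (c,c') = a_out + (if c = c' then a_gap else 0)" if cc: "c < K" "c' < K" for c c'
  proof -
    let ?P = "\<lambda>x. \<exists>i<n. \<exists>j<n. i \<noteq> j \<and> \<psi> i = c \<and> \<psi> j = c' \<and> x = ?A $$ (i,j)"
    let ?v = "a_out + (if c = c' then a_gap else 0)"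
    have val: "x = ?v" if "?P x" for x
      using that by (auto simp: expected_adjacency Amean_eq)
    \<comment> \<open>Two distinct nodes are available even for c = c' because s >= 2; otherwise the
      \<open>THE\<close> of a diagonal entry would be unspecified.\<close>
    have "\<exists>i<n. \<exists>j<n. i \<noteq> j \<and> \<psi> i = c \<and> \<psi> j = c'"
    proof -
      have "{i. i < n \<and> \<psi> i = c} \<noteq> {}" using class_size[OF cc(1)] s2 by force
      then obtain i where i: "i < n" "\<psi> i = c" by blast
      have "card ({j. j < n \<and> \<psi> j = c'} - {i}) \<ge> 1"
        using class_size[OF cc(2)] s2 by (cases "i \<in> {j. j < n \<and> \<psi> j = c'}") (auto simp: card_Diff_singleton_if)
      then have "{j. j < n \<and> \<psi> j = c'} - {i} \<noteq> {}" by force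
      with i show ?thesis by blast
    qed
    then obtain i j where "i < n" "j < n" "i \<noteq> j" "\<psi> i = c" "\<psi> j = c'" by blast
    then have P: "?P (?A $$ (i,j))" by blast
    have "?P ?v" by (rule subst[where P = ?P, OF val[OF P] P])
    then have "(THE x. ?P x) = ?v" using val by (rule the_equality)
    then show ?thesis using cc by (simp add: G_def class_mat_def)
  qed
  have Gc: "G \<in> carrier_mat K K" by (simp add: G_def class_mat_def)
  have Gv: "(\<Sum>j<K. G $$ (i,j) * v j) = a_out * (\<Sum>j<K. v j) + a_gap * v i" if "i < K" for i v
  proof -
    have "(\<Sum>j<K. G $$ (i,j) * v j) = (\<Sum>j<K. a_out * v j + (if j = i then a_gap * v i else 0))"
      using that by (intro sum.cong) (auto simp: G algebra_simps)
    then show ?thesis using that by (simp add: sum.distrib sum_distrib_left)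
  qed
  have epos: "0 < e" if e: "eigenvalue G e" for e
  proof -
    obtain v where v: "v \<in> carrier_vec K" "v \<noteq> 0\<^sub>v K" "G *\<^sub>v v = e \<cdot>\<^sub>v v"
      using e Gc by (auto simp: eigenvalue_def eigenvector_def)
    have ev: "a_out * (\<Sum>j<K. v $ j) + a_gap * v $ i = e * v $ i" if i: "i < K" for i
    proof -
      have "(G *\<^sub>v v) $ i = (e \<cdot>\<^sub>v v) $ i" by (simp only: v(3))
      then have "(\<Sum>j<K. G $$ (i,j) * v $ j) = e * v $ i"
        using i v(1) Gc by (simp add: scalar_prod_def atLeast0LessThan)
      then show ?thesis using Gv[OF i, of "\<lambda>j. v $ j"] by simp
    qed
    show ?thesis
    proof (cases "(\<Sum>j<K. v $ j) = 0")
      case True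
      obtain i where i: "i < K" "v $ i \<noteq> 0"
      proof -
        have "\<exists>i<K. v $ i \<noteq> 0"
        proof (rule ccontr)
          assume "\<not> ?thesis"
          then have "v = 0\<^sub>v K" using v(1) by (intro eq_vecI) auto
          with v(2) show False by blast
        qed
        with that show ?thesis by blast
      qed
      then show ?thesis using ev[OF i(1)] True gap by simp
    next
      case False
      have "(\<Sum>i<K. a_out * (\<Sum>j<K. v $ j) + a_gap * v $ i) = (\<Sum>i<K. e * v $ i)"
        using ev by (intro sum.cong) auto
      then have "(K * a_out + a_gap) * (\<Sum>j<K. v $ j) = e * (\<Sum>j<K. v $ j)"
        unfolding sum.distrib sum_distrib_left[symmetric] by (simp add: algebra_simps)
      then have "e = K * a_out + a_gap" using False by simp
      then show ?thesis using gap a_out_nonneg by (simp add: add_nonneg_pos)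
    qed
  qed
  have fin: "finite {x. eigenvalue G x}"
  proof -
    have "char_poly G \<noteq> 0" using degree_monic_char_poly[OF Gc] by auto
    then show ?thesis unfolding eigenvalue_root_char_poly[OF Gc] by (rule poly_roots_finite)
  qed
  \<comment> \<open>The all-ones vector shows that the set of eigenvalues is nonempty, so that
    \<open>Min\<close> is one of them.\<close>
  have "eigenvalue G (K * a_out + a_gap)"
    unfolding eigenvalue_def eigenvector_def
  proof (intro exI[of _ "Matrix.vec K (\<lambda>_. 1)"] conjI)
    show "G *\<^sub>v Matrix.vec K (\<lambda>_. 1) = (K * a_out + a_gap) \<cdot>\<^sub>v Matrix.vec K (\<lambda>_. 1)"
      using Gc Gv[of _ "\<lambda>_. 1"] by (intro eq_vecI) (auto simp: scalar_prod_def atLeast0LessThan)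
    show "Matrix.vec K (\<lambda>_. 1) \<noteq> (0\<^sub>v (dim_row G) :: real Matrix.vec)"
    proof
      assume "Matrix.vec K (\<lambda>_. 1) = (0\<^sub>v (dim_row G) :: real Matrix.vec)"
      from arg_cong[OF this, of "\<lambda>v. vec_index v 0"] show False using K_pos Gc by simp
    qed
  qed (use Gc in auto)
  then have lam: "0 < Min {x. eigenvalue G x}" using epos fin by (subst Min_gr_iff) auto
  have ratio: "0 < Min ((\<lambda>i. real (card {j. j < n \<and> \<psi> j = \<psi> i}) / ?D $$ (i,i)) ` {..<n})"
    using n_pos d s_pos psi by (subst Min_gr_iff) (auto simp: expected_degree class_size)
  have "(\<lambda>(i, j). \<bar>(G $$ (\<psi> i, \<psi> i) - ?A $$ (i, i)) / ?D $$ (i, i) - (G $$ (\<psi> j, \<psi> j) - ?A $$ (j, j)) / ?D $$ (j, j)\<bar>) ` ({..<n} \<times> {..<n}) = {0}"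
    (is "?f ` ?S = _")
  proof -
    have "?f x = 0" if "x \<in> ?S" for x
      using that psi by (auto simp: expected_degree expected_adjacency Amean_eq G)
    then have "?f ` ?S = (\<lambda>_. 0) ` ?S" by (rule image_cong[OF refl])
    moreover have "?S \<noteq> {}" using n_pos by (simp add: lessThan_empty_iff)
    ultimately show ?thesis by (simp only: image_constant_conv if_False)
  qed
  then show ?thesis
    using lam ratio by (simp add: planted_delta_def delta_def Let_def G_def)
qed

end

section \<open>Concentration of the adjacency matrix and of the degrees\<close>

context planted_model
begin

definition Arand :: "(nat set \<Rightarrow> bool) \<Rightarrow> nat \<Rightarrow> nat \<Rightarrow> real" where
  "Arand h i j = (\<Sum>\<xi>\<in>PE. of_bool (h \<xi>) / real (card \<xi>) * (of_bool (i \<in> \<xi>) * of_bool (j \<in> \<xi>)))"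

definition Drand :: "(nat set \<Rightarrow> bool) \<Rightarrow> nat \<Rightarrow> real" where
  "Drand h i = (\<Sum>\<xi>\<in>PE. of_bool (h \<xi>) * of_bool (i \<in> \<xi>))"

definition edge_vec :: "nat set \<Rightarrow> nat \<Rightarrow> real" where
  "edge_vec \<xi> i = of_bool (i \<in> \<xi>) / sqrt (real (card \<xi>))"

lemma edge_vec_mult: "edge_vec \<xi> i * edge_vec \<xi> j = of_bool (i \<in> \<xi>) * of_bool (j \<in> \<xi>) / card \<xi>"
  by (simp add: edge_vec_def)

lemma edge_vec_unit:
  assumes "\<xi> \<in> PE" shows "ip n (edge_vec \<xi>) (edge_vec \<xi>) = 1"
proof -
  have "\<xi> \<subseteq> {..<n}" "card \<xi> \<noteq> 0" using assms by (auto simp: potential_edges_def)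
  then have "{..<n} \<inter> \<xi> = \<xi>" by auto
  have "ip n (edge_vec \<xi>) (edge_vec \<xi>) = (\<Sum>i<n. of_bool (i \<in> \<xi>)) / card \<xi>"
    unfolding ip_def edge_vec_mult sum_divide_distrib by (intro sum.cong) auto
  also have "(\<Sum>i<n. of_bool (i \<in> \<xi>)) = real (card ({..<n} \<inter> \<xi>))" by (simp add: of_bool_def sum.If_cases)
  finally show ?thesis using \<open>{..<n} \<inter> \<xi> = \<xi>\<close> \<open>card \<xi> \<noteq> 0\<close> by simp
qed

text \<open>Cauchy-Schwarz restricted to the support of \<xi> bounds the squared inner product by
  the sum of x_i^2 over \<xi>; averaging over edges collects each x_i^2 with the expected degree. In
  matrix form this is E[A] <= E[D].\<close>

lemma mean_edge_vec_le: "(\<Sum>\<xi>\<in>PE. pr \<xi> * (ip n (edge_vec \<xi>) x)\<^sup>2) \<le> d * ip n x x"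
proof -
  have "(\<Sum>\<xi>\<in>PE. pr \<xi> * (ip n (edge_vec \<xi>) x)\<^sup>2) \<le> (\<Sum>\<xi>\<in>PE. pr \<xi> * (\<Sum>i<n. of_bool (i \<in> \<xi>) * (x i)\<^sup>2))"
  proof (intro sum_mono mult_left_mono)
    fix \<xi> assume xi: "\<xi> \<in> PE"
    let ?x = "\<lambda>i. of_bool (i \<in> \<xi>) * x i"
    have "(ip n (edge_vec \<xi>) x)\<^sup>2 = (ip n (edge_vec \<xi>) ?x)\<^sup>2"
      by (intro arg_cong[where f = "\<lambda>t. t\<^sup>2"]) (auto simp: ip_def edge_vec_def intro!: sum.cong)
    also have "\<dots> \<le> ip n (edge_vec \<xi>) (edge_vec \<xi>) * ip n ?x ?x" by (rule ip_Cauchy_Schwarz)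
    also have "\<dots> = ip n ?x ?x" by (simp add: edge_vec_unit[OF xi])
    also have "\<dots> = (\<Sum>i<n. of_bool (i \<in> \<xi>) * (x i)\<^sup>2)"
      unfolding ip_def by (intro sum.cong refl) (simp add: power2_eq_square of_bool_def)
    finally show "(ip n (edge_vec \<xi>) x)\<^sup>2 \<le> (\<Sum>i<n. of_bool (i \<in> \<xi>) * (x i)\<^sup>2)" .
  qed (rule pr_bounds)
  also have "\<dots> = (\<Sum>i<n. (\<Sum>\<xi>\<in>PE. pr \<xi> * of_bool (i \<in> \<xi>)) * (x i)\<^sup>2)"
    unfolding sum_distrib_left sum_distrib_right by (subst sum.swap) (simp add: mult_ac)
  also have "\<dots> = (\<Sum>i<n. d * (x i)\<^sup>2)" by (intro sum.cong) (auto simp: sum_pr_degree)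
  finally show ?thesis by (simp add: ip_def sum_distrib_left power2_eq_square)
qed

lemma Amean_edge_vec: "Amean i j = (\<Sum>\<xi>\<in>PE. pr \<xi> * (edge_vec \<xi> i * edge_vec \<xi> j))"
  by (simp add: Amean_def edge_vec_mult)

lemma symm_Amean: "symm n Amean"
  by (simp add: symm_def Amean_edge_vec mult_ac)

text \<open>The bilinear form is an inner product of two vectors indexed by edges, with entries
  sqrt(pr) times the inner product with the edge vector; \<open>mean_edge_vec_le\<close> bounds the
  squared norm of each.\<close>

lemma op_bound_Amean: "op_bound n Amean d"
  unfolding op_bound_def
proof (intro allI)
  fix x y
  let ?f = "\<lambda>x \<xi>. sqrt (pr \<xi>) * ip n (edge_vec \<xi>) x"
  have sq: "L2_set (?f x) PE \<le> sqrt d * sqrt (ip n x x)" for x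
  proof -
    have "(\<Sum>\<xi>\<in>PE. (?f x \<xi>)\<^sup>2) = (\<Sum>\<xi>\<in>PE. pr \<xi> * (ip n (edge_vec \<xi>) x)\<^sup>2)"
      by (intro sum.cong) (auto simp: power_mult_distrib pr_bounds)
    then show ?thesis unfolding L2_set_def using mean_edge_vec_le[of x] by (simp flip: real_sqrt_mult)
  qed
  have "ip n x (mv n Amean y) = (\<Sum>i<n. \<Sum>\<xi>\<in>PE. \<Sum>j<n. pr \<xi> * (edge_vec \<xi> i * x i * (edge_vec \<xi> j * y j)))"
    unfolding ip_mv Amean_edge_vec sum_distrib_left sum_distrib_right
    by (rule sum.cong[OF refl], subst sum.swap) (simp add: mult_ac)
  also have "\<dots> = (\<Sum>\<xi>\<in>PE. \<Sum>i<n. \<Sum>j<n. pr \<xi> * (edge_vec \<xi> i * x i * (edge_vec \<xi> j * y j)))"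
    by (rule sum.swap)
  also have "\<dots> = (\<Sum>\<xi>\<in>PE. pr \<xi> * (ip n (edge_vec \<xi>) x * ip n (edge_vec \<xi>) y))"
    unfolding ip_def sum_product by (simp only: sum_distrib_left)
  also have "\<dots> = (\<Sum>\<xi>\<in>PE. ?f x \<xi> * ?f y \<xi>)"
  proof (rule sum.cong[OF refl])
    fix \<xi> assume "\<xi> \<in> PE"
    then have "pr \<xi> = sqrt (pr \<xi>) * sqrt (pr \<xi>)" using pr_bounds by simp
    then show "pr \<xi> * (ip n (edge_vec \<xi>) x * ip n (edge_vec \<xi>) y) = ?f x \<xi> * ?f y \<xi>"
      by (metis mult.assoc mult.left_commute)
  qed
  finally have "\<bar>ip n x (mv n Amean y)\<bar> \<le> (\<Sum>\<xi>\<in>PE. \<bar>?f x \<xi>\<bar> * \<bar>?f y \<xi>\<bar>)"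
    using sum_abs[of "\<lambda>\<xi>. ?f x \<xi> * ?f y \<xi>" PE] by (simp add: abs_mult)
  also have "\<dots> \<le> L2_set (?f x) PE * L2_set (?f y) PE" by (rule L2_set_mult_ineq)
  also have "\<dots> \<le> (sqrt d * sqrt (ip n x x)) * (sqrt d * sqrt (ip n y y))"
    by (intro mult_mono sq) (auto simp: d_nonneg ip_self_nonneg)
  also have "\<dots> = d * (sqrt (ip n x x) * sqrt (ip n y y))" using d_nonneg by (simp add: mult_ac)
  finally show "\<bar>ip n x (mv n Amean y)\<bar> \<le> d * (sqrt (ip n x x) * sqrt (ip n y y))" .
qed

definition concentrated :: "real \<Rightarrow> (nat set \<Rightarrow> bool) \<Rightarrow> bool" where
  "concentrated T h \<longleftrightarrow> op_bound n (\<lambda>i j. Arand h i j - Amean i j) T \<and> (\<forall>i<n. \<bar>Drand h i - d\<bar> \<le> T)"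

text \<open>A degree is a sum of \<open>1 \<times> 1\<close> matrices, so both parts are instances of the same bound.\<close>

lemma concentrated_probability:
  fixes P :: nat
  assumes P: "P \<ge> 1"
  defines "T \<equiv> exp 1 * sqrt ((real P)\<^sup>2 + 4 * P * d)"
  shows "measure_pmf.prob H {h. \<not> concentrated T h} \<le> 2 * n * exp (- 2 * P)"
proof -
  interpret A: bernoulli_rank_one_sum n PE edge_vec pr d
    by unfold_locales (auto simp: finite_PE pr_bounds edge_vec_unit d_nonneg mean_edge_vec_le)
  have HA: "A.H = H" by (simp add: A.H_def H_eq)
  have XA: "A.X h = (\<lambda>i j. Arand h i j - Amean i j)" for h
    by (intro ext) (simp add: A.X_def Arand_def Amean_edge_vec left_diff_distrib sum_subtractf edge_vec_mult diff_divide_distrib)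
  have PA: "measure_pmf.prob H {h. \<not> op_bound n (\<lambda>i j. Arand h i j - Amean i j) T} \<le> n * exp (- 2 * P)"
    using A.op_bound_probability[OF P] unfolding HA XA T_def .
  have PD: "measure_pmf.prob H {h. \<not> \<bar>Drand h i - d\<bar> \<le> T} \<le> exp (- 2 * P)" if i: "i < n" for i
  proof -
    interpret D: bernoulli_rank_one_sum 1 PE "\<lambda>\<xi> _. of_bool (i \<in> \<xi>)" pr d
    proof unfold_locales
      fix x :: "nat \<Rightarrow> real"
      have "(\<Sum>\<xi>\<in>PE. pr \<xi> * (ip 1 (\<lambda>_. of_bool (i \<in> \<xi>)) x)\<^sup>2) = (\<Sum>\<xi>\<in>PE. pr \<xi> * of_bool (i \<in> \<xi>)) * (x 0)\<^sup>2"
        unfolding sum_distrib_right by (intro sum.cong) (auto simp: ip_def)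
      then show "(\<Sum>\<xi>\<in>PE. pr \<xi> * (ip 1 (\<lambda>_. of_bool (i \<in> \<xi>)) x)\<^sup>2) \<le> d * ip 1 x x"
        by (simp add: sum_pr_degree[OF i] ip_def power2_eq_square)
    qed (auto simp: finite_PE pr_bounds d_nonneg ip_def)
    have HD: "D.H = H" by (simp add: D.H_def H_eq)
    have obb: "of_bool b * of_bool b = (of_bool b :: real)" for b by (cases b) auto
    have XD: "D.X h a b = Drand h i - d" for h a b
      using sum_pr_degree[OF i] by (simp add: D.X_def Drand_def left_diff_distrib sum_subtractf obb)
    have "{h. \<not> \<bar>Drand h i - d\<bar> \<le> T} \<subseteq> {h. \<not> op_bound 1 (D.X h) T}"
    proof (intro Collect_mono impI, erule contrapos_nn)
      fix h assume "op_bound 1 (D.X h) T"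
      from this[unfolded op_bound_def, rule_format, of "\<lambda>_. 1" "\<lambda>_. 1"]
      show "\<bar>Drand h i - d\<bar> \<le> T" by (simp add: ip_def mv_def XD)
    qed
    then have "measure_pmf.prob H {h. \<not> \<bar>Drand h i - d\<bar> \<le> T} \<le> measure_pmf.prob H {h. \<not> op_bound 1 (D.X h) T}"
      by (intro measure_pmf.finite_measure_mono) auto
    also have "\<dots> \<le> exp (- 2 * P)" using D.op_bound_probability[OF P] unfolding HD T_def by simp
    finally show ?thesis .
  qed
  have "{h. \<not> concentrated T h} \<subseteq> {h. \<not> op_bound n (\<lambda>i j. Arand h i j - Amean i j) T} \<union> (\<Union>i\<in>{..<n}. {h. \<not> \<bar>Drand h i - d\<bar> \<le> T})"
    by (auto simp: concentrated_def)
  then have "measure_pmf.prob H {h. \<not> concentrated T h}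
      \<le> measure_pmf.prob H ({h. \<not> op_bound n (\<lambda>i j. Arand h i j - Amean i j) T} \<union> (\<Union>i\<in>{..<n}. {h. \<not> \<bar>Drand h i - d\<bar> \<le> T}))"
    by (intro measure_pmf.finite_measure_mono) auto
  also have "\<dots> \<le> measure_pmf.prob H {h. \<not> op_bound n (\<lambda>i j. Arand h i j - Amean i j) T}
      + measure_pmf.prob H (\<Union>i\<in>{..<n}. {h. \<not> \<bar>Drand h i - d\<bar> \<le> T})"
    by (rule measure_Un_le) auto
  also have "\<dots> \<le> n * exp (- 2 * P) + (\<Sum>i\<in>{..<n}. exp (- 2 * P))"
  proof (intro add_mono PA)
    have "measure_pmf.prob H (\<Union>i\<in>{..<n}. {h. \<not> \<bar>Drand h i - d\<bar> \<le> T}) \<le> (\<Sum>i\<in>{..<n}. measure_pmf.prob H {h. \<not> \<bar>Drand h i - d\<bar> \<le> T})"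
      by (rule measure_UNION_le) auto
    also have "\<dots> \<le> (\<Sum>i\<in>{..<n}. exp (- 2 * P))" by (intro sum_mono PD) auto
    finally show "measure_pmf.prob H (\<Union>i\<in>{..<n}. {h. \<not> \<bar>Drand h i - d\<bar> \<le> T}) \<le> (\<Sum>i\<in>{..<n}. exp (- 2 * P))" .
  qed
  finally show ?thesis by simp
qed

section \<open>Perturbation of the normalized Laplacian\<close>

definition Lrand :: "(nat set \<Rightarrow> bool) \<Rightarrow> nat \<Rightarrow> nat \<Rightarrow> real" where
  "Lrand h i j = of_bool (i = j) - Arand h i j / (sqrt (Drand h i) * sqrt (Drand h j))"

text \<open>All expected degrees equal d, so normalizing by them is division by d. This is the
  Laplacian of the expected matrices, not the expectation of the random Laplacian.\<close>

definition Lmean :: "nat \<Rightarrow> nat \<Rightarrow> real" where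
  "Lmean i j = of_bool (i = j) - Amean i j / d"

lemma laplacian_eq: "laplacian n M h = Matrix.mat n n (\<lambda>(i,j). Lrand h i j)"
proof -
  let ?R = "Matrix.mat n n (\<lambda>(i, j). if i = j then 1 / sqrt (degree_mat n M h $$ (i, i)) else 0)"
  have R: "?R = mat_diag n (\<lambda>i. 1 / sqrt (Drand h i))"
    by (rule eq_matI) (auto simp: mat_diag_def degree_mat_def Drand_def)
  have A: "adjacency_mat n M h \<in> carrier_mat n n" by (simp add: adjacency_mat_def)
  have RA: "?R * adjacency_mat n M h = Matrix.mat n n (\<lambda>(i,j). 1 / sqrt (Drand h i) * adjacency_mat n M h $$ (i,j))"
    unfolding R by (rule mat_diag_mult_left[OF A])
  have "?R * adjacency_mat n M h * ?R = Matrix.mat n n (\<lambda>(i,j). (1 / sqrt (Drand h i) * adjacency_mat n M h $$ (i,j)) * (1 / sqrt (Drand h j)))"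
    unfolding RA unfolding R by (subst mat_diag_mult_right[of _ n]) auto
  then show ?thesis
    unfolding laplacian_def Let_def
    by (intro eq_matI) (auto simp: Lrand_def adjacency_mat_def Arand_def)
qed

lemma symm_Lrand: "symm n (Lrand h)"
  by (auto simp: symm_def Lrand_def Arand_def mult_ac)

lemma symm_Lmean: "symm n Lmean"
  using symm_Amean by (auto simp: symm_def Lmean_def)

text \<open>With \<rho>_i = sqrt(d / D_i) the difference is -(\<rho> A \<rho> - E[A]) / d, and
  \<rho> A \<rho> - E[A] telescopes into \<rho> (A - E[A]) \<rho> + (\<rho> - 1) E[A] \<rho> + E[A]
  (\<rho> - 1). The hypothesis 2T <= d gives \<rho>^2 <= 2 and |\<rho> - 1| <= 2T/d, so the parts
  are at most 2T, 2 sqrt 2 T and 2T, together at most 7T.\<close>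

lemma op_bound_laplacian:
  assumes good: "concentrated T h" and T: "2 * T \<le> d" "0 \<le> T" and d: "0 < d"
  shows "op_bound n (\<lambda>i j. Lrand h i j - Lmean i j) (7 * T / d)"
  unfolding op_bound_def
proof (intro allI)
  fix x y :: "nat \<Rightarrow> real"
  define \<rho> where "\<rho> = (\<lambda>i. sqrt (d / Drand h i))"
  let ?N = "\<lambda>x. sqrt (ip n x x)"
  have D: "d / 2 \<le> Drand h i" "\<bar>Drand h i - d\<bar> \<le> T" if "i < n" for i
    using good that T unfolding concentrated_def by (force+)
  have rho2: "(\<rho> i)\<^sup>2 \<le> 2" if "i < n" for i
    using D[OF that] d by (simp add: \<rho>_def field_simps)
  have rho1: "\<bar>\<rho> i - 1\<bar> \<le> 2 * T / d" if i: "i < n" for i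
  proof -
    have pos: "Drand h i > 0" using D[OF i] d by linarith
    have "\<rho> i \<ge> 0" using pos d by (simp add: \<rho>_def)
    then have "\<bar>\<rho> i - 1\<bar> * 1 \<le> \<bar>\<rho> i - 1\<bar> * \<bar>\<rho> i + 1\<bar>" by (intro mult_left_mono) auto
    also have "\<dots> = \<bar>(\<rho> i)\<^sup>2 - 1\<bar>" by (simp add: abs_mult[symmetric] power2_eq_square algebra_simps)
    also have "(\<rho> i)\<^sup>2 - 1 = (d - Drand h i) / Drand h i" using pos d by (simp add: \<rho>_def field_simps)
    also have "\<bar>(d - Drand h i) / Drand h i\<bar> = \<bar>Drand h i - d\<bar> / Drand h i" using pos by (simp add: abs_minus_commute)
    also have "\<dots> \<le> T / (d / 2)" using D[OF i] d T by (intro frac_le) auto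
    finally show ?thesis by (simp add: mult.commute)
  qed
  have N1: "?N (\<lambda>i. \<rho> i * x i) \<le> sqrt 2 * ?N x" for x
  proof -
    have "ip n (\<lambda>i. \<rho> i * x i) (\<lambda>i. \<rho> i * x i) \<le> (\<Sum>i<n. 2 * (x i * x i))"
      unfolding ip_def
    proof (rule sum_mono)
      fix i assume "i \<in> {..<n}"
      then have "(\<rho> i)\<^sup>2 * (x i)\<^sup>2 \<le> 2 * (x i)\<^sup>2" using rho2 by (intro mult_right_mono) auto
      then show "\<rho> i * x i * (\<rho> i * x i) \<le> 2 * (x i * x i)" by (simp add: power2_eq_square mult_ac)
    qed
    also have "\<dots> = 2 * ip n x x" by (simp add: ip_def sum_distrib_left)
    finally show ?thesis by (simp flip: real_sqrt_mult)
  qed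
  have N2: "?N (\<lambda>i. \<rho> i * x i - x i) \<le> 2 * T / d * ?N x" for x
  proof -
    have "ip n (\<lambda>i. \<rho> i * x i - x i) (\<lambda>i. \<rho> i * x i - x i) \<le> (\<Sum>i<n. (2 * T / d)\<^sup>2 * (x i * x i))"
      unfolding ip_def
    proof (rule sum_mono)
      fix i assume "i \<in> {..<n}"
      then have "\<bar>\<rho> i - 1\<bar>\<^sup>2 \<le> (2 * T / d)\<^sup>2" using rho1 by (intro power_mono) auto
      then have "(\<rho> i - 1)\<^sup>2 * (x i)\<^sup>2 \<le> (2 * T / d)\<^sup>2 * (x i)\<^sup>2" by (intro mult_right_mono) auto
      then show "(\<rho> i * x i - x i) * (\<rho> i * x i - x i) \<le> (2 * T / d)\<^sup>2 * (x i * x i)"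
        by (simp add: power2_eq_square algebra_simps)
    qed
    also have "\<dots> = (2 * T / d)\<^sup>2 * ip n x x" by (simp add: ip_def sum_distrib_left)
    finally have "?N (\<lambda>i. \<rho> i * x i - x i) \<le> sqrt ((2 * T / d)\<^sup>2 * ip n x x)" by (rule real_sqrt_le_mono)
    also have "\<dots> = 2 * T / d * ?N x" using T d by (simp add: real_sqrt_mult)
    finally show ?thesis .
  qed
  define B where "B = ip n (\<lambda>i. \<rho> i * x i) (mv n (\<lambda>i j. Arand h i j - Amean i j) (\<lambda>j. \<rho> j * y j))
      + ip n (\<lambda>i. \<rho> i * x i - x i) (mv n Amean (\<lambda>j. \<rho> j * y j)) + ip n x (mv n Amean (\<lambda>j. \<rho> j * y j - y j))"
  have "ip n x (mv n (\<lambda>i j. Lrand h i j - Lmean i j) y) = - (B / d)"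
  proof -
    have "Lrand h i j - Lmean i j = - ((\<rho> i * \<rho> j * Arand h i j - Amean i j) / d)" if "i < n" "j < n" for i j
    proof -
      have pos: "Drand h i > 0" "Drand h j > 0" using D that d by force+
      have "\<rho> i * \<rho> j = d / (sqrt (Drand h i) * sqrt (Drand h j))"
        using d by (simp add: \<rho>_def real_sqrt_divide)
      then show ?thesis using d by (simp add: Lrand_def Lmean_def diff_divide_distrib)
    qed
    then have "ip n x (mv n (\<lambda>i j. Lrand h i j - Lmean i j) y)
        = (\<Sum>i<n. \<Sum>j<n. - ((\<rho> i * \<rho> j * Arand h i j - Amean i j) / d) * (x i * y j))"
      unfolding ip_mv by (intro sum.cong refl) auto
    also have "\<dots> = - ((\<Sum>i<n. \<Sum>j<n. (\<rho> i * \<rho> j * Arand h i j - Amean i j) * (x i * y j)) / d)"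
      by (simp add: sum_divide_distrib sum_negf)
    also have "(\<Sum>i<n. \<Sum>j<n. (\<rho> i * \<rho> j * Arand h i j - Amean i j) * (x i * y j)) = B"
      unfolding B_def ip_mv sum.distrib[symmetric] by (intro sum.cong refl) (simp add: algebra_simps)
    finally show ?thesis .
  qed
  then have abs_eq: "\<bar>ip n x (mv n (\<lambda>i j. Lrand h i j - Lmean i j) y)\<bar> = \<bar>B\<bar> / d" using d by simp
  have "\<bar>B\<bar> \<le> T * (?N (\<lambda>i. \<rho> i * x i) * ?N (\<lambda>j. \<rho> j * y j))
      + d * (?N (\<lambda>i. \<rho> i * x i - x i) * ?N (\<lambda>j. \<rho> j * y j)) + d * (?N x * ?N (\<lambda>j. \<rho> j * y j - y j))"
    unfolding B_def using good op_bound_Amean unfolding concentrated_def op_bound_def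
    by (intro order_trans[OF abs_triangle_ineq] add_mono) blast+
  also have "\<dots> \<le> T * ((sqrt 2 * ?N x) * (sqrt 2 * ?N y))
      + d * ((2 * T / d * ?N x) * (sqrt 2 * ?N y)) + d * (?N x * (2 * T / d * ?N y))"
    using T d by (intro add_mono mult_left_mono mult_mono N1 N2) (auto simp: ip_self_nonneg)
  also have "\<dots> = (4 + 2 * sqrt 2) * (T * (?N x * ?N y))"
    using d by (simp add: field_simps)
  also have "\<dots> \<le> 7 * (T * (?N x * ?N y))"
  proof -
    have "sqrt 2 \<le> 3 / 2" by (rule real_le_lsqrt) (auto simp: power2_eq_square)
    then show ?thesis using T by (intro mult_right_mono) (auto simp: ip_self_nonneg)
  qed
  finally have "\<bar>B\<bar> / d \<le> 7 * (T * (?N x * ?N y)) / d" using d by (intro divide_right_mono) auto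
  then show "\<bar>ip n x (mv n (\<lambda>i j. Lrand h i j - Lmean i j) y)\<bar> \<le> 7 * T / d * (?N x * ?N y)"
    unfolding abs_eq by simp
qed

section \<open>Spectrum of the mean Laplacian\<close>

definition Y :: "nat \<Rightarrow> nat \<Rightarrow> real" where
  "Y = (\<lambda>c i. of_bool (\<psi> i = c) / sqrt (real s))"

lemma class_sum:
  assumes "c < K" shows "(\<Sum>i<n. of_bool (\<psi> i = c)) = real s"
proof -
  have "(\<Sum>i<n. of_bool (\<psi> i = c)) = real (card ({..<n} \<inter> {i. \<psi> i = c}))" by (simp add: of_bool_def sum.If_cases)
  also have "{..<n} \<inter> {i. \<psi> i = c} = {i. i < n \<and> \<psi> i = c}" by auto
  finally show ?thesis using class_size[OF assms] by simp
qed

lemma orthonormal_Y: "orthonormal n K Y"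
  unfolding orthonormal_def
proof (intro allI impI)
  fix c e assume ce: "c < K" "e < K"
  have "ip n (Y c) (Y e) = (\<Sum>i<n. of_bool (\<psi> i = c) * of_bool (c = e) / s)"
    unfolding ip_def by (intro sum.cong) (auto simp: Y_def)
  also have "\<dots> = (\<Sum>i<n. of_bool (\<psi> i = c)) * of_bool (c = e) / s"
    by (simp only: sum_distrib_right sum_divide_distrib)
  finally show "ip n (Y c) (Y e) = of_bool (c = e)" using class_sum[OF ce(1)] s_pos by simp
qed

lemma sum_Amean:
  assumes "i < n"
  shows "(\<Sum>j<n. Amean i j * z j) = (a_diag - a_out - a_gap) * z i + a_out * (\<Sum>j<n. z j) + a_gap * (\<Sum>j<n. of_bool (\<psi> j = \<psi> i) * z j)"
proof -
  have "(\<Sum>j<n. Amean i j * z j)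
      = (\<Sum>j<n. (if j = i then (a_diag - a_out - a_gap) * z i else 0) + a_out * z j + a_gap * (of_bool (\<psi> j = \<psi> i) * z j))"
    using assms by (intro sum.cong) (auto simp: Amean_eq algebra_simps)
  then show ?thesis unfolding sum.distrib sum_distrib_left using assms by simp
qed

text \<open>The eigenvalue of the mean Laplacian on vectors that sum to zero over every
  class.\<close>

definition \<nu> :: real where "\<nu> = 1 - (a_diag - a_out - a_gap) / d"

lemma mv_Lmean: "i < n \<Longrightarrow> mv n Lmean z i = z i - (\<Sum>j<n. Amean i j * z j) / d"
proof -
  assume i: "i < n"
  have "mv n Lmean z i = (\<Sum>j<n. (if j = i then z i else 0) - Amean i j * z j / d)"
    unfolding mv_def by (intro sum.cong) (auto simp: Lmean_def algebra_simps)
  then show ?thesis using i by (simp add: sum_subtractf sum_divide_distrib)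
qed

lemma Lmean_orthogonal:
  assumes z: "\<And>c. c < K \<Longrightarrow> ip n (Y c) z = 0" and i: "i < n" and d: "0 < d"
  shows "mv n Lmean z i = \<nu> * z i"
proof -
  have cls: "(\<Sum>j<n. of_bool (\<psi> j = c) * z j) = 0" if "c < K" for c
    using z[OF that] s_pos by (simp add: ip_def Y_def sum_divide_distrib[symmetric])
  have "(\<Sum>j<n. z j) = (\<Sum>j<n. \<Sum>c<K. of_bool (\<psi> j = c) * z j)"
  proof (rule sum.cong[OF refl])
    fix j assume "j \<in> {..<n}"
    then have "(\<Sum>c<K. of_bool (\<psi> j = c) * z j) = (\<Sum>c<K. if c = \<psi> j then z j else 0)" by (intro sum.cong) auto
    then show "z j = (\<Sum>c<K. of_bool (\<psi> j = c) * z j)" using psi \<open>j \<in> {..<n}\<close> by simp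
  qed
  also have "\<dots> = (\<Sum>c<K. \<Sum>j<n. of_bool (\<psi> j = c) * z j)" by (rule sum.swap)
  also have "\<dots> = 0" using cls by simp
  finally have "(\<Sum>j<n. z j) = 0" .
  then show ?thesis
    unfolding mv_Lmean[OF i] sum_Amean[OF i] cls[OF psi[OF i]] \<nu>_def using d by (simp add: field_simps)
qed

text \<open>On vectors that are constant on classes the within-class excess lowers the form by the
  factor s a_gap / d. The \<open>a_out\<close> term lowers it further, by a_out (sum of x)^2 / d,
  and is dropped; hence an inequality.\<close>

lemma Lmean_span:
  assumes d: "0 < d"
  defines "x \<equiv> \<lambda>y i. \<Sum>c<K. y c * Y c i"
  shows "ip n (x y) (mv n Lmean (x y)) \<le> (\<nu> - s * a_gap / d) * ip n (x y) (x y)"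
proof -
  have xi: "x y i = y (\<psi> i) / sqrt s" if "i < n" for i
  proof -
    have "x y i = (\<Sum>c<K. if c = \<psi> i then y c / sqrt s else 0)" unfolding x_def by (intro sum.cong) (auto simp: Y_def)
    then show ?thesis using psi[OF that] by simp
  qed
  have cls: "(\<Sum>j<n. of_bool (\<psi> j = \<psi> i) * x y j) = s * x y i" if i: "i < n" for i
  proof -
    have "(\<Sum>j<n. of_bool (\<psi> j = \<psi> i) * x y j) = (\<Sum>j<n. of_bool (\<psi> j = \<psi> i) * x y i)"
      using i by (intro sum.cong) (auto simp: xi)
    then show ?thesis using class_sum[OF psi[OF i]] by (simp add: sum_distrib_right[symmetric])
  qed
  let ?S = "\<Sum>j<n. x y j"
  have "ip n (x y) (mv n Lmean (x y)) = ip n (x y) (\<lambda>i. (\<nu> - s * a_gap / d) * x y i - a_out * ?S / d)"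
  proof (rule ip_cong[OF refl])
    fix i assume i: "i < n"
    show "mv n Lmean (x y) i = (\<nu> - s * a_gap / d) * x y i - a_out * ?S / d"
      unfolding mv_Lmean[OF i] sum_Amean[OF i] cls[OF i] \<nu>_def using d by (simp add: field_simps)
  qed
  also have "\<dots> = (\<nu> - s * a_gap / d) * ip n (x y) (x y) - a_out * ?S / d * ?S"
  proof -
    have "ip n (x y) (\<lambda>_. a_out * ?S / d) = ?S * (a_out * ?S / d)"
      unfolding ip_def sum_distrib_right ..
    then show ?thesis unfolding ip_diff_right ip_scale_right by (simp add: mult.commute)
  qed
  also have "\<dots> \<le> (\<nu> - s * a_gap / d) * ip n (x y) (x y)"
  proof -
    have "a_out * ?S / d * ?S = a_out * ?S\<^sup>2 / d" by (simp add: power2_eq_square)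
    also have "0 \<le> a_out * ?S\<^sup>2 / d" using a_out_nonneg d by simp
    finally show ?thesis by simp
  qed
  finally show ?thesis .
qed

text \<open>Perturbation 7T/d and gap s a_gap / d give 14 T / (s a_gap) for each of the K
  eigenvectors; d cancels. The bound \<kappa> <= 1/400 also secures that the perturbation is at most
  half the gap, as \<open>davis_kahan\<close> requires.\<close>

lemma residual_eigenvectors_le:
  fixes \<kappa> :: real
  assumes good: "concentrated T h" and T: "2 * T \<le> d" "0 \<le> T" and d: "0 < d" and gap: "0 < a_gap"
    and kappa: "K * (14 * T / (s * a_gap))\<^sup>2 \<le> \<kappa>" "\<kappa> \<le> 1 / 400"
    and X: "smallest_eigenvectors n K (laplacian n M h) X"
  shows "(\<Sum>j<K. ip n (residual n K Y (\<lambda>i. X $$ (i,j))) (residual n K Y (\<lambda>i. X $$ (i,j)))) \<le> \<kappa>"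
proof -
  let ?e = "7 * T / d" and ?g = "s * a_gap / d"
  have sg: "0 < s * a_gap" using s_pos gap by simp
  have quot: "2 * ?e / ?g = 14 * T / (s * a_gap)" using d by simp
  have "(14 * T / (s * a_gap))\<^sup>2 \<le> K * (14 * T / (s * a_gap))\<^sup>2"
    using K_pos by (simp add: mult_le_cancel_right1)
  then have "(14 * T / (s * a_gap))\<^sup>2 \<le> (1 / 20)\<^sup>2" using kappa by (simp add: power2_eq_square)
  then have "14 * T / (s * a_gap) \<le> 1" using T sg power2_le_imp_le[of "14 * T / (s * a_gap)" "1 / 20"] by simp
  then have "14 * T \<le> s * a_gap" using sg by (simp add: field_simps)
  then have e2: "2 * ?e \<le> ?g" using d by (simp add: field_simps)
  have "ip n (residual n K Y (\<lambda>i. X $$ (i,j))) (residual n K Y (\<lambda>i. X $$ (i,j))) \<le> (14 * T / (s * a_gap))\<^sup>2" if j: "j < K" for j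
    unfolding quot[symmetric]
  proof (rule davis_kahan[OF symm_Lrand symm_Lmean orthonormal_Y K_le_n op_bound_laplacian[OF good T d] _ e2 _ Lmean_orthogonal _ _ j])
    show "smallest_eigenvectors n K (Matrix.mat n n (\<lambda>(i,j). Lrand h i j)) X" using X by (simp add: laplacian_eq)
    show "let x = \<lambda>i. \<Sum>c<K. y c * Y c i in ip n x (mv n Lmean x) \<le> (\<nu> - ?g) * ip n x x" for y
      using Lmean_span[OF d] by (simp add: Let_def)
  qed (use sg d T in auto)
  then have "(\<Sum>j<K. ip n (residual n K Y (\<lambda>i. X $$ (i,j))) (residual n K Y (\<lambda>i. X $$ (i,j)))) \<le> (\<Sum>j<K. (14 * T / (s * a_gap))\<^sup>2)"
    by (intro sum_mono) auto
  also have "\<dots> = K * (14 * T / (s * a_gap))\<^sup>2" by simp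
  finally show ?thesis using kappa by simp
qed

end

section \<open>The sparse regime\<close>

lemma prob_bind_pmf:
  "measure_pmf.prob (bind_pmf p f) A = measure_pmf.expectation p (\<lambda>x. measure_pmf.prob (f x) A)"
proof -
  have "emeasure (measure_pmf (bind_pmf p f)) A = (\<integral>\<^sup>+x. ennreal (measure_pmf.prob (f x) A) \<partial>measure_pmf p)"
    by (subst emeasure_bind_pmf) (simp only: measure_pmf.emeasure_eq_measure)
  then have "measure_pmf.prob (bind_pmf p f) A = enn2real (\<integral>\<^sup>+x. ennreal (measure_pmf.prob (f x) A) \<partial>measure_pmf p)"
    by (simp add: measure_def)
  also have "\<dots> = measure_pmf.expectation p (\<lambda>x. measure_pmf.prob (f x) A)"
    by (rule integral_eq_nn_integral[symmetric]) auto
  finally show ?thesis .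
qed

lemma prob_bind_pmf_ge:
  assumes good: "\<And>x. G x \<Longrightarrow> 1 - \<eta> \<le> measure_pmf.prob (f x) A"
    and bad: "measure_pmf.prob p {x. \<not> G x} \<le> \<beta>" and eta: "0 \<le> \<eta>"
  shows "1 - (\<beta> + \<eta>) \<le> measure_pmf.prob (bind_pmf p f) A"
proof -
  let ?I = "indicator {x. \<not> G x} :: _ \<Rightarrow> real"
  have int: "integrable p (\<lambda>x. measure_pmf.prob (f x) A)"
    by (rule measure_pmf.integrable_const_bound[where B = 1]) auto
  have intI: "integrable p ?I" by (rule measure_pmf.integrable_const_bound[where B = 1]) auto
  have "1 - (\<beta> + \<eta>) \<le> measure_pmf.expectation p (\<lambda>x. (1 - \<eta>) - ?I x)"
    using bad intI by simp
  also have "\<dots> \<le> measure_pmf.expectation p (\<lambda>x. measure_pmf.prob (f x) A)"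
  proof (rule integral_mono[OF _ int])
    show "(1 - \<eta>) - ?I x \<le> measure_pmf.prob (f x) A" for x
    proof (cases "G x")
      case False
      then have "(1 - \<eta>) - ?I x \<le> 0" using eta by simp
      also have "0 \<le> measure_pmf.prob (f x) A" by simp
      finally show ?thesis .
    qed (use good in simp)
  qed (use intI in simp)
  finally show ?thesis by (simp add: prob_bind_pmf)
qed

context planted_model
begin

text \<open>With one class all labels coincide and no error is possible. The case stands apart
  because the k-means guarantee starts at k = 2.\<close>

lemma Err_one_class:
  assumes K1: "K = 1" and supp: "set_pmf (km Xb) \<subseteq> few_rows_mats n K K" and e: "0 \<le> e"
  shows "measure_pmf.prob (map_pmf cluster_labels (km Xb)) {\<psi>'. real (Err n K \<psi> \<psi>') \<le> e} = 1"
proof -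
  have "real (Err n K \<psi> (cluster_labels S)) \<le> e" if "S \<in> set_pmf (km Xb)" for S
  proof -
    have lab: "\<forall>i<n. cluster_labels S i < K" using cluster_labels_few_rows(1) supp that by blast
    have "Err n K \<psi> (cluster_labels S) \<le> card {i. i < n \<and> \<psi> i \<noteq> id (cluster_labels S i)}"
      unfolding Err_def by (intro Min_le finite_imageI finite_permutations image_eqI[where x = id]) (auto simp: permutes_id)
    also have "{i. i < n \<and> \<psi> i \<noteq> id (cluster_labels S i)} = {}" using lab psi K1 by fastforce
    finally show ?thesis using e by simp
  qed
  then show ?thesis by (subst measure_pmf.prob_eq_1) (auto simp: AE_measure_pmf_iff)
qed

text \<open>The non-asymptotic form of recovery. The single number \<kappa> bounds the spectral
  error, fixes \<epsilon> and bounds the fraction of errors; the failure probability is that of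
  concentration plus that of the k-means method.\<close>

lemma recovery_probability:
  fixes \<kappa> \<epsilon> K\<^sub>0 T :: real and P :: nat
  assumes P: "P \<ge> 1" and T: "T = exp 1 * sqrt ((real P)\<^sup>2 + 4 * P * d)" "2 * T \<le> d"
    and d: "0 < d" and gap: "0 < a_gap"
    and kappa: "K * (14 * T / (s * a_gap))\<^sup>2 \<le> \<kappa>" "0 < \<kappa>" "\<kappa> \<le> 1 / 400"
    and eps: "\<epsilon> = 12 * sqrt \<kappa>" "147 * \<epsilon>\<^sup>2 \<le> 3" and K0: "0 < K\<^sub>0"
    and supp: "\<And>Xb. Xb \<in> carrier_mat n K \<Longrightarrow> set_pmf (km Xb) \<subseteq> few_rows_mats n K K"
    and guarantee: "\<And>Xb. 2 \<le> K \<Longrightarrow> Xb \<in> carrier_mat n K \<Longrightarrow> kmeans_eta K Xb \<le> \<epsilon> * kmeans_eta (K - 1) Xb \<Longrightarrow>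
       1 - K\<^sub>0 * sqrt \<epsilon> \<le> measure_pmf.prob (km Xb)
             {S. frobenius_norm (Xb - S) \<le> sqrt ((1 - \<epsilon>\<^sup>2) / (1 - 37 * \<epsilon>\<^sup>2)) * kmeans_eta K Xb}"
    and X: "\<And>h. smallest_eigenvectors n K (laplacian n M h) (X h)"
  shows "1 - (2 * n * exp (- 2 * P) + K\<^sub>0 * sqrt \<epsilon>)
    \<le> measure_pmf.prob (bind_pmf H (\<lambda>h. spectral_labels km (X h))) {\<psi>'. real (Err n K \<psi> \<psi>') \<le> 288 * n * \<kappa>}"
proof (rule prob_bind_pmf_ge)
  show "measure_pmf.prob H {h. \<not> concentrated T h} \<le> 2 * n * exp (- 2 * P)"
    unfolding T(1) by (rule concentrated_probability[OF P])
  show "0 \<le> K\<^sub>0 * sqrt \<epsilon>" using K0 kappa by (simp add: eps(1))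
  fix h assume h: "concentrated T h"
  let ?Xb = "normalize_rows (X h)"
  have Xc: "X h \<in> carrier_mat n K" and XX: "transpose_mat (X h) * X h = 1\<^sub>m K"
    using X[of h] by (auto simp: smallest_eigenvectors_def)
  have Xb: "?Xb \<in> carrier_mat n K" using Xc by (simp add: normalize_rows_def)
  have T0: "0 \<le> T" unfolding T(1) using d by simp
  show "1 - K\<^sub>0 * sqrt \<epsilon> \<le> measure_pmf.prob (spectral_labels km (X h)) {\<psi>'. real (Err n K \<psi> \<psi>') \<le> 288 * n * \<kappa>}"
  proof (cases "K = 1")
    case True
    have "0 \<le> K\<^sub>0 * sqrt \<epsilon>" using K0 kappa by (simp add: eps(1))
    then show ?thesis
      unfolding spectral_labels_def using Err_one_class[where km = km, OF True supp[OF Xb], of "288 * n * \<kappa>"] kappa by simp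
  next
    case False
    then have K2: "2 \<le> K" using K_pos by simp
    have "(\<Sum>j<K. ip n (residual n K Y (\<lambda>i. X h $$ (i,j))) (residual n K Y (\<lambda>i. X h $$ (i,j)))) \<le> \<kappa>"
      by (rule residual_eigenvectors_le[OF h T(2) T0 d gap kappa(1,3) X])
    then obtain C where C: "separated_data n K s \<psi> ?Xb C (8 * real s * \<kappa>)"
      using separated_normalized_rows[of n \<psi> K s "X h" \<kappa>, OF psi class_size s_pos Xc XX] orthonormal_Y kappa(3)
      unfolding Y_def by blast
    interpret separated_data n K s \<psi> ?Xb C "8 * real s * \<kappa>" by (rule C)
    have "1 - K\<^sub>0 * sqrt \<epsilon> \<le> measure_pmf.prob (map_pmf cluster_labels (km ?Xb)) {\<psi>'. real (Err n K \<psi> \<psi>') \<le> 288 * real s * \<kappa>}"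
      by (rule spectral_labels_probability[where km = km and \<kappa> = \<kappa>, OF K2 s_pos kappa(2,3) refl eps supp[OF Xb]]) (rule guarantee[OF K2 Xb])
    also have "\<dots> \<le> measure_pmf.prob (map_pmf cluster_labels (km ?Xb)) {\<psi>'. real (Err n K \<psi> \<psi>') \<le> 288 * n * \<kappa>}"
    proof (rule measure_pmf.finite_measure_mono)
      have "real s \<le> real n" unfolding s_def by (simp add: div_le_dividend)
      then have "288 * real s * \<kappa> \<le> 288 * n * \<kappa>" using kappa(2) by simp
      then show "{\<psi>'. real (Err n K \<psi> \<psi>') \<le> 288 * real s * \<kappa>} \<subseteq> {\<psi>'. real (Err n K \<psi> \<psi>') \<le> 288 * n * \<kappa>}" by auto
    qed simp
    finally show ?thesis by (simp add: spectral_labels_def)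
  qed
qed

end

text \<open>The products are compared factor by factor: for i < r <= s/2 one has n - i <= 2K (s -
  i), as n = K s.\<close>

lemma binomial_ratio_ge:
  assumes n: "n = K * s" and s: "2 * r \<le> s" and K: "0 < K"
  shows "real (n choose r) / (2 * K) ^ r \<le> real (s choose r)"
proof -
  have rn: "r \<le> n" "r \<le> s"
  proof -
    show "r \<le> s" using s by simp
    also have "s \<le> K * s" using K by simp
    finally show "r \<le> n" by (simp add: n)
  qed
  have "real (n choose r) / (2 * K) ^ r = (\<Prod>i = 0..<r. real (n - i) / real (r - i) / (2 * K))"
    using rn by (simp add: binomial_altdef_of_nat prod_dividef of_nat_diff)
  also have "\<dots> \<le> (\<Prod>i = 0..<r. real (s - i) / real (r - i))"
  proof (rule prod_mono, safe)
    fix i assume i: "i \<in> {0..<r}"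
    have "real n - i \<le> real K * (2 * (real s - i))"
    proof -
      have "real K * (2 * i) \<le> real K * s" using i s by (intro mult_left_mono) auto
      then show ?thesis by (simp add: n algebra_simps)
    qed
    then have "real (n - i) / (2 * K) \<le> real (s - i)" using i rn K by (simp add: of_nat_diff field_simps)
    then have "real (n - i) / (2 * K) / real (r - i) \<le> real (s - i) / real (r - i)" by (rule divide_right_mono) simp
    then show "real (n - i) / real (r - i) / (2 * K) \<le> real (s - i) / real (r - i)" by (simp add: mult.commute)
    show "0 \<le> real (n - i) / real (r - i) / (2 * K)" by simp
  qed
  also have "\<dots> = real (s choose r)"
    using rn by (simp add: binomial_altdef_of_nat of_nat_diff)
  finally show ?thesis .
qed

lemma binomial_absorb_real:
  assumes "1 \<le> m" "1 \<le> n"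
  shows "real ((n - 1) choose (m - 1)) = real m / real n * real (n choose m)"
proof -
  have "m * (n choose m) = n * ((n - 1) choose (m - 1))"
    using assms times_binomial_minus1_eq[of m n] by simp
  then have "real m * real (n choose m) = real n * real ((n - 1) choose (m - 1))"
    by (metis of_nat_mult)
  then show ?thesis using assms by (simp add: field_simps)
qed

text \<open>The hypotheses for a single n, with C = 1. Those in \<open>n_large\<close> and
  \<open>ln_large\<close> hold for all large n, with thresholds that depend only on r,
  \<open>\<theta> r\<close> and q: the power of 2r serves the lower bound on the class size, and 360
  / (q r \<theta>_r) makes the degree dominate ln n.\<close>

locale sparse_planted_model = planted_model +
  fixes \<theta> :: "nat \<Rightarrow> real" and a b :: real and r :: nat
  assumes alpha: "m \<in> {2..M} \<Longrightarrow> \<alpha> m = \<theta> m * real n powr a * ln (real n) powr b / real (n choose m)"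
    and theta_nonneg: "2 \<le> m \<Longrightarrow> 0 \<le> \<theta> m"
    and r: "2 \<le> r" "0 < \<theta> r" "r \<le> M" and below_r: "2 \<le> m \<Longrightarrow> m < r \<Longrightarrow> \<theta> m = 0"
    and a: "1 \<le> a" and b: "2 \<le> b"
    and sparse: "(\<Sum>m=r..M. real m * \<theta> m) \<le> real n powr (a - 1) * ln (real n) powr (b - 2) / real K ^ (2 * r - 1)"
    and n_large: "(2 * r) ^ (2 * r - 1) \<le> n" and ln_large: "1 \<le> ln (real n)" "1 / \<theta> r \<le> ln (real n)"
      "360 / (q * (r * \<theta> r)) \<le> ln (real n)"
begin

abbreviation L :: real where "L \<equiv> ln (real n)"

text \<open>The common scale of all degrees: \<alpha>_m times the number of m-sets is \<theta>_m n
  F, so sets of size m contribute m \<theta>_m F per node before the probability factors p and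
  q.\<close>

definition F :: real where "F = real n powr (a - 1) * L powr b"

lemma r_le_n: "r \<le> n"
proof -
  have "2 * r \<le> (2 * r) ^ (2 * r - 1)" using r by (intro self_le_power) auto
  with n_large show ?thesis by linarith
qed

lemma powr_a: "real n powr a = n * real n powr (a - 1)"
  using n_pos by (simp add: powr_diff)

lemma alpha_binomial: "m \<in> {2..M} \<Longrightarrow> m \<le> n \<Longrightarrow> \<alpha> m * real (n choose m) = \<theta> m * n * F"
  by (simp add: alpha F_def powr_a)

lemma F_pos: "0 < F"
proof -
  have "0 < real n powr (a - 1)" "0 < L powr b" using n_pos ln_large(1) by (auto simp only: powr_gt_zero)
  then show ?thesis unfolding F_def by (rule mult_pos_pos)
qed

lemma L_powr_b: "L powr b = L powr (b - 2) * L\<^sup>2"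
  using ln_large by (simp add: powr_diff)

lemma F_ge: "L\<^sup>2 \<le> F"
proof -
  have "1 * L powr 2 \<le> real n powr (a - 1) * L powr b"
  proof (rule mult_mono)
    show "1 \<le> real n powr (a - 1)" using a n_pos by (intro ge_one_powr_ge_zero) auto
    show "L powr 2 \<le> L powr b" using b ln_large by (intro powr_mono) auto
  qed auto
  then show ?thesis using ln_large by (simp add: F_def)
qed

lemma d_ge: "q * (r * \<theta> r) * F \<le> d"
proof -
  have rM: "r \<in> {2..M}" using r by simp
  have "\<alpha> r * real ((n - 1) choose (r - 1)) = r / n * (\<alpha> r * real (n choose r))"
    using binomial_absorb_real[of r n] r n_pos by simp
  also have "\<dots> = r * \<theta> r * F" unfolding alpha_binomial[OF rM r_le_n] using n_pos by simp
  finally have "r * \<theta> r * F \<le> weighted_count M \<alpha> n 1"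
    using weighted_count_ge_term[where w = \<alpha> and M = M and m = r and N = n and t = 1, OF alpha_nonneg rM] by simp
  then have "q * (r * \<theta> r * F) \<le> q * weighted_count M \<alpha> n 1" using q by simp
  moreover have "0 \<le> p * weighted_count M \<alpha> s 1"
    using p weighted_count_nonneg[where w = \<alpha> and M = M, OF alpha_nonneg] by simp
  ultimately show ?thesis unfolding d_def by (simp add: mult.assoc)
qed

lemma d_le: "d \<le> F * (\<Sum>m=r..M. real m * \<theta> m)"
proof -
  have "weighted_count M \<alpha> s 1 \<le> weighted_count M \<alpha> n 1"
    unfolding weighted_count_def
  proof (intro sum_mono mult_left_mono alpha_nonneg)
    fix m
    have "s - 1 \<le> n - 1" unfolding s_def by (simp add: diff_le_mono)
    then show "real ((s - 1) choose (m - 1)) \<le> real ((n - 1) choose (m - 1))" by (intro of_nat_mono binomial_right_mono)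
  qed
  then have "d \<le> q * weighted_count M \<alpha> n 1 + p * weighted_count M \<alpha> n 1" unfolding d_def using p by simp
  also have "\<dots> = (p + q) * weighted_count M \<alpha> n 1" by (simp add: algebra_simps)
  also have "\<dots> \<le> weighted_count M \<alpha> n 1"
    using pq p q weighted_count_nonneg[where w = \<alpha> and M = M, OF alpha_nonneg] by (intro mult_left_le_one_le) auto
  also have "\<dots> \<le> (\<Sum>m=2..M. F * (real m * \<theta> m))"
    unfolding weighted_count_def
  proof (rule sum_mono)
    fix m assume m: "m \<in> {2..M}"
    show "\<alpha> m * real ((n - 1) choose (m - 1)) \<le> F * (real m * \<theta> m)"
    proof (cases "m \<le> n")
      case True
      have "\<alpha> m * real ((n - 1) choose (m - 1)) = m / n * (\<alpha> m * real (n choose m))"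
        using binomial_absorb_real[of m n] m n_pos by simp
      also have "\<dots> = F * (real m * \<theta> m)" unfolding alpha_binomial[OF m True] using n_pos by simp
      finally show ?thesis by simp
    next
      \<comment> \<open>Sizes m > n occur when M exceeds n; the count (n-1 choose m-1) is then
        zero.\<close>
      case False
      then show ?thesis using F_pos theta_nonneg[of m] m n_pos by (simp add: binomial_eq_0)
    qed
  qed
  also have "\<dots> = (\<Sum>m=r..M. F * (real m * \<theta> m))"
    by (rule sum.mono_neutral_right) (use r below_r in auto)
  finally show ?thesis by (simp add: sum_distrib_left)
qed

lemma K_power: "real K ^ (2 * r - 1) * (\<Sum>m=r..M. real m * \<theta> m) \<le> real n powr (a - 1) * L powr (b - 2)"
  using sparse K_pos by (simp add: field_simps)

text \<open>Since \<alpha>_r <= 1, one has \<theta>_r n F <= n^r. Combined with the sparsity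
  hypothesis, where the spare factor (ln n)^2 compensates for a small \<theta>_r, this gives
  K^(2r-1) n <= n^r. If s < 2r, then n < 2rK and n^(2r-1) < (2r)^(2r-1) K^(2r-1) <= n K^(2r-1) <=
  n^r, which contradicts r <= 2r-1.\<close>

lemma class_size_large: "2 * r \<le> s"
proof (rule ccontr)
  assume "\<not> ?thesis"
  then have sr: "s < 2 * r" by simp
  have "r * \<theta> r \<le> (\<Sum>m=r..M. real m * \<theta> m)"
    by (rule member_le_sum[of r _ "\<lambda>m. real m * \<theta> m"]) (use r theta_nonneg in auto)
  then have "real K ^ (2 * r - 1) * (r * \<theta> r) \<le> real K ^ (2 * r - 1) * (\<Sum>m=r..M. real m * \<theta> m)"
    by (rule mult_left_mono) simp
  with K_power have 1: "real K ^ (2 * r - 1) * (r * \<theta> r) \<le> real n powr (a - 1) * L powr (b - 2)" by simp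
  have rM: "r \<in> {2..M}" using r by simp
  have "\<theta> r * n * F \<le> real (n choose r)"
    using alpha_binomial[OF rM r_le_n] alpha_le_1[OF rM] by (metis mult_left_le_one_le of_nat_0_le_iff alpha_nonneg[OF rM])
  also have "\<dots> \<le> real n ^ r" using binomial_le_pow[OF r_le_n] by (metis of_nat_le_iff of_nat_power)
  finally have 2: "\<theta> r * n * F \<le> real n ^ r" .
  have "1 \<le> L * \<theta> r" using ln_large r by (simp add: field_simps)
  then have "1 * 1 \<le> (L * \<theta> r) * (L * \<theta> r)" by (intro mult_mono) auto
  then have "1 * 1 \<le> real r * ((L * \<theta> r) * (L * \<theta> r))" using r by (intro mult_mono) auto
  then have 3: "1 \<le> r * \<theta> r * \<theta> r * L\<^sup>2" by (simp add: power2_eq_square mult_ac)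
  have "real K ^ (2 * r - 1) * n \<le> real K ^ (2 * r - 1) * n * (r * \<theta> r * \<theta> r * L\<^sup>2)"
    using mult_left_mono[OF 3, of "real K ^ (2 * r - 1) * n"] by simp
  also have "\<dots> = (real K ^ (2 * r - 1) * (r * \<theta> r)) * (n * \<theta> r * L\<^sup>2)" by (simp add: mult_ac)
  also have "\<dots> \<le> (real n powr (a - 1) * L powr (b - 2)) * (n * \<theta> r * L\<^sup>2)"
    using r by (intro mult_right_mono 1) auto
  also have "\<dots> = \<theta> r * n * F" by (simp add: F_def L_powr_b mult_ac)
  finally have 4: "real K ^ (2 * r - 1) * n \<le> real n ^ r" using 2 by simp
  have "n < 2 * r * K" using n_eq sr K_pos by (metis mult.commute mult_less_mono1)
  then have "real n < real (2 * r * K)" by (simp only: of_nat_less_iff)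
  then have "real n ^ (2 * r - 1) < real (2 * r * K) ^ (2 * r - 1)"
    using r by (intro power_strict_mono) auto
  also have "\<dots> = real ((2 * r) ^ (2 * r - 1)) * real K ^ (2 * r - 1)" by (simp add: power_mult_distrib)
  also have "\<dots> \<le> real n * real K ^ (2 * r - 1)"
    using n_large by (intro mult_right_mono) (auto simp only: of_nat_le_iff zero_le_power of_nat_0_le_iff)
  also have "\<dots> \<le> real n ^ r" using 4 by (simp add: mult.commute)
  also have "\<dots> \<le> real n ^ (2 * r - 1)" using n_pos r by (intro power_increasing) auto
  finally show False by simp
qed

definition c1 :: real where "c1 = p * \<theta> r / 2 ^ r"

lemma c1_pos: "0 < c1"
  using p r by (simp add: c1_def)

text \<open>Only the sets of size r are kept in the gap. Passing from all n nodes to one class costs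
  (2K)^r in the binomial coefficient; one factor K is regained because n / s = K, and 2^r goes into
  \<open>c1\<close>.\<close>

lemma gap_ge: "c1 * F \<le> s * a_gap * K ^ (r - 1)"
proof -
  have rM: "r \<in> {2..M}" using r by simp
  have s2: "2 \<le> s" using class_size_large r by simp
  have cr: "0 < real (n choose r)" using r_le_n by simp
  have A: "real ((s - 2) choose (r - 2)) = (r * (r - 1)) / (s * (s - 1)) * real (s choose r)"
  proof -
    have "real ((s - 1 - 1) choose (r - 1 - 1)) = real (r - 1) / real (s - 1) * real ((s - 1) choose (r - 1))"
      using r s2 by (intro binomial_absorb_real) auto
    moreover have "real ((s - 1) choose (r - 1)) = r / s * real (s choose r)"
      using r s2 by (intro binomial_absorb_real) auto
    ultimately show ?thesis by (simp add: numeral_2_eq_2)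
  qed
  have "\<theta> r * F * K / (2 * K) ^ r = (\<theta> r * n * F / real (n choose r)) * (1 / s) * (real (n choose r) / (2 * K) ^ r)"
  proof -
    have "real n = real K * real s" using n_eq by (metis of_nat_mult)
    then have "real K = real n / real s" using s_pos by simp
    then show ?thesis using cr by simp
  qed
  also have "\<theta> r * n * F / real (n choose r) = \<alpha> r"
    using alpha_binomial[OF rM r_le_n] cr by (simp add: field_simps)
  also have "\<alpha> r * (1 / s) * (real (n choose r) / (2 * K) ^ r) \<le> \<alpha> r * (1 / s) * real (s choose r)"
    using binomial_ratio_ge[OF n_eq class_size_large K_pos] alpha_nonneg[OF rM] by (intro mult_left_mono) auto
  \<comment> \<open>Replacing 1/s by the larger (r-1)/(s-1), possible as r >= 2, produces the
    quotient of binomial coefficients in \<open>A\<close>.\<close>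
  also have "\<dots> \<le> \<alpha> r * ((r - 1) / (s - 1)) * real (s choose r)"
  proof (intro mult_right_mono mult_left_mono alpha_nonneg[OF rM])
    have "1 / real s \<le> 1 / real (s - 1)" using s2 by (intro divide_left_mono) auto
    also have "\<dots> \<le> real (r - 1) / real (s - 1)" using r by (intro divide_right_mono) auto
    finally show "1 / real s \<le> (r - 1) / (s - 1)" .
  qed simp
  also have "\<dots> = s * (\<alpha> r / r * real ((s - 2) choose (r - 2)))"
    unfolding A using r s_pos by simp
  also have "\<dots> \<le> s * weighted_count M (\<lambda>m. \<alpha> m / m) s 2"
    using weighted_count_ge_term[where w = "\<lambda>m. \<alpha> m / m" and M = M and m = r and N = s and t = 2, OF weights_nonneg rM]
    by (intro mult_left_mono) auto
  finally have "p * (\<theta> r * F * K / (2 * K) ^ r) \<le> s * a_gap"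
    using p mult_left_mono[of _ _ p] by (fastforce simp: a_gap_def mult_ac)
  then have "p * (\<theta> r * F * K / (2 * K) ^ r) * K ^ (r - 1) \<le> s * a_gap * K ^ (r - 1)"
    by (rule mult_right_mono) simp
  moreover have "p * (\<theta> r * F * K / (2 * K) ^ r) * K ^ (r - 1) = c1 * F"
  proof -
    have "real K ^ r = K * real K ^ (r - 1)" using r by (simp add: power_eq_if)
    then show ?thesis using K_pos by (simp add: c1_def power_mult_distrib)
  qed
  ultimately show ?thesis by simp
qed

lemma a_gap_pos: "0 < a_gap"
proof -
  have "0 < s * a_gap * K ^ (r - 1)" using gap_ge c1_pos F_pos by (meson less_le_trans mult_pos_pos)
  then show ?thesis using a_gap_nonneg by (cases "a_gap = 0") auto
qed

text \<open>The constant 360 = 4 * 90 is what makes (2T)^2 <= d^2 follow from T^2 <= 90 L d. The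
  bound rests on F >= L^2, hence on a >= 1 and b >= 2.\<close>

lemma d_ge_L: "360 * L \<le> d"
proof -
  have qr: "0 < q * (r * \<theta> r)" using q r by simp
  have "360 \<le> L * (q * (r * \<theta> r))" using ln_large(3) qr by (simp add: pos_divide_le_eq)
  then have "360 * L \<le> L * (q * (r * \<theta> r)) * L" using ln_large by (intro mult_right_mono) auto
  also have "\<dots> = q * (r * \<theta> r) * L\<^sup>2" by (simp add: power2_eq_square mult_ac)
  also have "\<dots> \<le> q * (r * \<theta> r) * F" using qr F_ge by (intro mult_left_mono) auto
  finally show ?thesis using d_ge by simp
qed

text \<open>The order of the moments is ln n rounded up: large enough that exp(-2P) beats the factor
  n in the failure bound, small enough that P d stays of order d ln n.\<close>

definition P :: nat where "P = nat \<lceil>L\<rceil>"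

definition T :: real where "T = exp 1 * sqrt ((real P)\<^sup>2 + 4 * P * d)"

lemma P_bounds: "1 \<le> P" "L \<le> P" "P \<le> 2 * L"
  unfolding P_def using ln_large by linarith+

text \<open>90 is 9 times 10: e^2 <= 9, and P^2 + 4Pd <= 5Pd <= 10 L d, where P <= d absorbs the
  quadratic term.\<close>

lemma T_power2: "T\<^sup>2 \<le> 90 * L * d"
proof -
  have d: "0 < d" using d_ge_L ln_large by linarith
  have "exp (1::real) \<le> 3" by (rule exp_le)
  then have "(exp (1::real))\<^sup>2 \<le> 3\<^sup>2" by (intro power_mono) auto
  moreover have "(real P)\<^sup>2 + 4 * P * d \<le> 10 * L * d"
  proof -
    have "real P \<le> d" using P_bounds d_ge_L ln_large by linarith
    then have "real P * real P \<le> P * d" by (intro mult_left_mono) auto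
    then have "(real P)\<^sup>2 + 4 * P * d \<le> 5 * (real P * d)" by (simp add: power2_eq_square)
    also have "\<dots> \<le> 5 * ((2 * L) * d)" using P_bounds d by (intro mult_left_mono mult_right_mono) auto
    finally show ?thesis by simp
  qed
  ultimately have "(exp 1)\<^sup>2 * ((real P)\<^sup>2 + 4 * P * d) \<le> 9 * (10 * L * d)"
    using d by (intro mult_mono) auto
  moreover have "T\<^sup>2 = (exp 1)\<^sup>2 * ((real P)\<^sup>2 + 4 * P * d)"
    using d by (simp add: T_def power_mult_distrib)
  ultimately show ?thesis by simp
qed

lemma T_small: "2 * T \<le> d"
proof (rule power2_le_imp_le)
  have d: "0 < d" using d_ge_L ln_large by linarith
  have "(2 * T)\<^sup>2 \<le> 360 * L * d" using T_power2 by (simp add: power_mult_distrib)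
  also have "\<dots> \<le> d * d" using d_ge_L d by (intro mult_right_mono) auto
  finally show "(2 * T)\<^sup>2 \<le> d\<^sup>2" by (simp add: power2_eq_square)
  show "0 \<le> d" using d by simp
qed

text \<open>17640 is 14^2 * 90. The factor K and the squared loss K^(2(r-1)) of the gap combine to
  the power of K in the sparsity hypothesis; the logarithms that remain are L * L^(b-2) / L^b =
  1/L.\<close>

lemma signal_to_noise: "K * (14 * T / (s * a_gap))\<^sup>2 \<le> 17640 / (c1\<^sup>2 * L)"
proof -
  let ?S = "\<Sum>m=r..M. real m * \<theta> m" and ?g = "real s * a_gap"
  have g: "0 < ?g" using s_pos a_gap_pos by simp
  have Kr: "0 < real K ^ (r - 1)" using K_pos by simp
  have cF: "0 < c1 * F" using c1_pos F_pos by simp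
  have "(c1 * F)\<^sup>2 \<le> (?g * K ^ (r - 1))\<^sup>2" using gap_ge cF by (intro power_mono) auto
  then have g2: "(c1 * F)\<^sup>2 / (real K ^ (r - 1))\<^sup>2 \<le> ?g\<^sup>2" using Kr by (simp only: power_mult_distrib[of ?g] pos_divide_le_eq zero_less_power of_nat_power)
  have pos: "0 < (c1 * F)\<^sup>2 / (real K ^ (r - 1))\<^sup>2" by (intro divide_pos_pos zero_less_power cF Kr)
  have "K * (14 * T / ?g)\<^sup>2 = K * (196 * T\<^sup>2 / ?g\<^sup>2)"
    by (simp add: power_divide power_mult_distrib)
  also have "\<dots> \<le> K * (196 * (90 * L * d) / ?g\<^sup>2)"
    using T_power2 by (intro mult_left_mono divide_right_mono) auto
  also have "\<dots> \<le> K * (196 * (90 * L * (F * ?S)) / ?g\<^sup>2)"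
    using d_le ln_large by (intro mult_left_mono divide_right_mono) auto
  also have "\<dots> \<le> K * (196 * (90 * L * (F * ?S)) / ((c1 * F)\<^sup>2 / (real K ^ (r - 1))\<^sup>2))"
    using g2 pos ln_large F_pos theta_nonneg r g s_pos a_gap_pos
    by (intro mult_left_mono divide_left_mono mult_nonneg_nonneg sum_nonneg mult_pos_pos) auto
  also have "\<dots> = 17640 * L * (K * (real K ^ (r - 1))\<^sup>2 * ?S) / (c1\<^sup>2 * F)"
    using F_pos c1_pos Kr by (simp add: power2_eq_square field_simps)
  also have "K * (real K ^ (r - 1))\<^sup>2 = real K ^ (2 * r - 1)"
  proof -
    have "Suc (2 * (r - 1)) = 2 * r - 1" using r by simp
    then show ?thesis by (metis mult.commute power_Suc power_mult)
  qed
  also have "17640 * L * (real K ^ (2 * r - 1) * ?S) / (c1\<^sup>2 * F)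
      \<le> 17640 * L * (real n powr (a - 1) * L powr (b - 2)) / (c1\<^sup>2 * F)"
    using K_power ln_large F_pos by (intro divide_right_mono mult_left_mono) auto
  also have "\<dots> = 17640 / (c1\<^sup>2 * L)"
    using n_pos ln_large c1_pos by (simp add: F_def L_powr_b power2_eq_square)
  finally show ?thesis .
qed

lemma failure_le: "2 * n * exp (- 2 * P) \<le> 2 / n"
proof -
  have "exp (- 2 * real P) \<le> exp (- 2 * L)" using P_bounds by simp
  also have "\<dots> = 1 / (real n)\<^sup>2"
    using n_pos by (simp add: exp_minus exp_double[symmetric] exp_double inverse_eq_divide)
  finally have "2 * n * exp (- 2 * P) \<le> 2 * n * (1 / (real n)\<^sup>2)" by (intro mult_left_mono) auto
  also have "\<dots> = 2 / n" using n_pos by (simp add: power2_eq_square)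
  finally show ?thesis .
qed

end

section \<open>Passage to the limit\<close>

lemma smallo_failure:
  fixes c K\<^sub>0 :: real
  assumes "0 < c"
  shows "(\<lambda>n. 288 * real n * (c / ln (real n))) \<in> o(\<lambda>n. real n)"
    and "(\<lambda>n. 2 / real n + K\<^sub>0 * sqrt (12 * sqrt (c / ln (real n)))) \<in> o(\<lambda>_. 1)"
proof -
  show "(\<lambda>n. 288 * real n * (c / ln (real n))) \<in> o(\<lambda>n. real n)" by real_asymp
  have "((\<lambda>n. c / ln (real n)) \<longlongrightarrow> 0) sequentially" by real_asymp
  then have "((\<lambda>n. sqrt (12 * sqrt (c / ln (real n)))) \<longlongrightarrow> sqrt (12 * sqrt 0)) sequentially"
    by (intro tendsto_intros)
  note lim1 = this
  have "((\<lambda>n. 2 / real n) \<longlongrightarrow> 0) sequentially" by real_asymp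
  from tendsto_add[OF this tendsto_mult_left[OF lim1, of K\<^sub>0]]
  show "(\<lambda>n. 2 / real n + K\<^sub>0 * sqrt (12 * sqrt (c / ln (real n)))) \<in> o(\<lambda>_. 1)"
    by (intro smalloI_tendsto) auto
qed

text \<open>k, M and the labellings vary freely with n. The rates e and f depend on p, q, r,
  \<open>\<theta> r\<close> and the constants of the k-means guarantee, but not on k or M; indices
  outside N are discarded by the filter.\<close>

lemma spectral_consistency:
  fixes N :: "nat set" and k M :: "nat \<Rightarrow> nat" and \<psi> :: "nat \<Rightarrow> nat \<Rightarrow> nat" and p q a b :: real
    and \<theta> :: "nat \<Rightarrow> real" and \<alpha> :: "nat \<Rightarrow> nat \<Rightarrow> real" and r :: nat
    and km :: "real mat \<Rightarrow> real mat pmf" and X :: "nat \<Rightarrow> (nat set \<Rightarrow> bool) \<Rightarrow> real mat"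
  assumes N: "\<forall>n\<in>N. 2 \<le> n" and p: "0 < p" and q: "0 < q" and pq: "p + q \<le> 1"
    and bal: "\<forall>n\<in>N. balanced_classes n (k n) (\<psi> n) \<and> 2 \<le> M n"
    and th: "\<forall>m\<ge>2. 0 \<le> \<theta> m" "\<exists>m\<ge>2. 0 < \<theta> m" and r: "r = (LEAST m. 2 \<le> m \<and> 0 < \<theta> m)"
    and a: "1 \<le> a" and b: "2 \<le> b"
    and al: "\<forall>n\<in>N. \<forall>m\<in>{2..M n}. 0 \<le> \<alpha> n m \<and> \<alpha> n m \<le> 1 \<and>
           \<alpha> n m = \<theta> m * real n powr a * ln (real n) powr b / real (n choose m)"
    and sp: "\<forall>n\<in>N. r \<le> M n \<and>
           (\<Sum>m=r..M n. real m * \<theta> m) \<le> real n powr (a - 1) * ln (real n) powr (b - 2) / real (k n) ^ (2 * r - 1)"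
    and km: "kmeans_with_guarantee km"
    and X: "\<forall>n\<in>N. \<forall>h. smallest_eigenvectors n (k n) (laplacian n (M n) h) (X n h)"
  shows "\<exists>(e :: nat \<Rightarrow> real) (f :: nat \<Rightarrow> real).
           e \<in> o[inf sequentially (principal N)](\<lambda>n. real n) \<and>
           f \<in> o[inf sequentially (principal N)](\<lambda>_. 1) \<and>
           (\<forall>n\<in>N.
              measure_pmf.prob
                (bind_pmf (planted_hypergraph n (M n) (\<psi> n) p q (\<alpha> n))
                   (\<lambda>h. spectral_labels km (X n h)))
                {\<psi>'. real (Err n (k n) (\<psi> n) \<psi>') \<le> e n}
              \<ge> 1 - f n)"
proof -
  have r2: "2 \<le> r \<and> 0 < \<theta> r" using th(2) unfolding r by (rule LeastI_ex[of "\<lambda>m. 2 \<le> m \<and> 0 < \<theta> m", simplified])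
  have below: "\<theta> m = 0" if "2 \<le> m" "m < r" for m
    using not_less_Least[of m "\<lambda>m. 2 \<le> m \<and> 0 < \<theta> m"] that th(1) unfolding r by force
  obtain \<epsilon>\<^sub>0 K\<^sub>0 where eK: "0 < \<epsilon>\<^sub>0" "0 < K\<^sub>0"
    and guarantee: "\<forall>\<epsilon>. 0 < \<epsilon> \<and> \<epsilon> \<le> \<epsilon>\<^sub>0 \<longrightarrow>
        (\<forall>n. \<forall>k\<ge>2. \<forall>X\<in>carrier_mat n k. kmeans_eta k X \<le> \<epsilon> * kmeans_eta (k - 1) X \<longrightarrow>
           measure_pmf.prob (km X)
             {S. frobenius_norm (X - S) \<le> sqrt ((1 - \<epsilon>\<^sup>2) / (1 - 37 * \<epsilon>\<^sup>2)) * kmeans_eta k X}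
           \<ge> 1 - K\<^sub>0 * sqrt \<epsilon>)"
    and support: "\<forall>n. \<forall>k\<ge>1. \<forall>X\<in>carrier_mat n k. set_pmf (km X) \<subseteq> few_rows_mats n k k"
    using km unfolding kmeans_with_guarantee_def by (elim conjE exE) (rule that)
  note guar = guarantee[rule_format, OF conjI]
  note supp = support[rule_format]
  \<comment> \<open>This is \<open>17640 / c1\<^sup>2\<close>, free of n, so that \<kappa> bounds
    the relative noise for every good n and decays like 1 / ln n.\<close>
  define c where "c = 17640 / (p * \<theta> r / 2 ^ r)\<^sup>2"
  have c: "0 < c" using p r2 by (simp add: c_def)
  define \<kappa> where "\<kappa> = (\<lambda>n :: nat. c / ln (real n))"
  \<comment> \<open>1/7056 is the bound on \<kappa> that gives 147 * 144 * \<kappa> <= 3, that is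
    147 \<epsilon>^2 <= 3 for \<epsilon> = 12 sqrt \<kappa>.\<close>
  define good where "good = (\<lambda>n :: nat. (2 * r) ^ (2 * r - 1) \<le> n \<and> 1 \<le> ln (real n) \<and> 1 / \<theta> r \<le> ln (real n) \<and>
      360 / (q * (r * \<theta> r)) \<le> ln (real n) \<and> \<kappa> n \<le> 1 / 7056 \<and> 12 * sqrt (\<kappa> n) \<le> \<epsilon>\<^sub>0)"
  define e where "e = (\<lambda>n. 288 * real n * \<kappa> n)"
  \<comment> \<open>For the finitely many n that are not good the value 1 makes the probability
    bound trivial.\<close>
  define f where "f = (\<lambda>n. if good n then 2 / real n + K\<^sub>0 * sqrt (12 * sqrt (\<kappa> n)) else 1)"
  have good: "eventually good sequentially"
  proof -
    have ln: "filterlim (\<lambda>n. ln (real n)) at_top sequentially" by real_asymp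
    have ev: "eventually (\<lambda>n. x \<le> ln (real n)) sequentially" for x
      using ln by (simp add: filterlim_at_top)
    have k0: "(\<kappa> \<longlongrightarrow> 0) sequentially" unfolding \<kappa>_def by real_asymp
    then have k1: "((\<lambda>n. 12 * sqrt (\<kappa> n)) \<longlongrightarrow> 12 * sqrt 0) sequentially" by (intro tendsto_intros)
    have "eventually (\<lambda>n. \<kappa> n < 1 / 7056) sequentially" by (rule order_tendstoD(2)[OF k0]) simp
    moreover have "eventually (\<lambda>n. 12 * sqrt (\<kappa> n) < \<epsilon>\<^sub>0) sequentially" by (rule order_tendstoD(2)[OF k1]) (use eK in simp)
    moreover note ev[of 1] ev[of "1 / \<theta> r"] ev[of "360 / (q * (r * \<theta> r))"] eventually_ge_at_top[of "(2 * r) ^ (2 * r - 1)"]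
    ultimately show ?thesis unfolding good_def by eventually_elim auto
  qed
  have le: "inf sequentially (principal N) \<le> sequentially" by simp
  have eo: "e \<in> o[inf sequentially (principal N)](\<lambda>n. real n)"
    unfolding e_def \<kappa>_def by (rule landau_o.small.filter_mono[OF le smallo_failure(1)[OF c]])
  have fo: "f \<in> o[inf sequentially (principal N)](\<lambda>_. 1)"
  proof (rule landau_o.small.filter_mono[OF le])
    have ev: "eventually (\<lambda>n. f n = 2 / real n + K\<^sub>0 * sqrt (12 * sqrt (c / ln (real n)))) sequentially"
      using good by eventually_elim (simp add: f_def \<kappa>_def)
    show "f \<in> o(\<lambda>_. 1)" unfolding landau_o.small.in_cong[OF ev] by (rule smallo_failure(2)[OF c])
  qed
  have "1 - f n \<le> measure_pmf.prob
                (bind_pmf (planted_hypergraph n (M n) (\<psi> n) p q (\<alpha> n)) (\<lambda>h. spectral_labels km (X n h)))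
                {\<psi>'. real (Err n (k n) (\<psi> n) \<psi>') \<le> e n}" if n: "n \<in> N" for n
  proof (cases "good n")
    case True
    interpret sparse_planted_model n "k n" "M n" "\<psi> n" p q "\<alpha> n" \<theta> a b r
    proof unfold_locales
      show "0 < n" using N n by force
      show "2 \<le> m \<Longrightarrow> m < r \<Longrightarrow> \<theta> m = 0" for m by (rule below)
      show "balanced_classes n (k n) (\<psi> n)" using bal n by blast
      show "0 \<le> \<alpha> n m" "\<alpha> n m \<le> 1" "\<alpha> n m = \<theta> m * real n powr a * ln (real n) powr b / real (n choose m)"
        if "m \<in> {2..M n}" for m using al n that by blast+
      show "r \<le> M n" "(\<Sum>m=r..M n. real m * \<theta> m) \<le> real n powr (a - 1) * ln (real n) powr (b - 2) / real (k n) ^ (2 * r - 1)"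
        using sp n by blast+
      show "0 \<le> \<theta> m" if "2 \<le> m" for m using th(1) that by blast
      show "(2 * r) ^ (2 * r - 1) \<le> n" "1 \<le> ln (real n)" "1 / \<theta> r \<le> ln (real n)" "360 / (q * (r * \<theta> r)) \<le> ln (real n)"
        using True unfolding good_def by blast+
    qed (use p q pq r2 a b in simp_all)
    have kap: "0 < \<kappa> n" "\<kappa> n \<le> 1 / 7056" "12 * sqrt (\<kappa> n) \<le> \<epsilon>\<^sub>0"
      using True c ln_large(1) by (auto simp: \<kappa>_def good_def)
    have kap_eq: "17640 / (c1\<^sup>2 * ln (real n)) = \<kappa> n" by (simp add: \<kappa>_def c_def c1_def)
    have "1 - (2 * n * exp (- 2 * P) + K\<^sub>0 * sqrt (12 * sqrt (\<kappa> n)))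
      \<le> measure_pmf.prob (bind_pmf H (\<lambda>h. spectral_labels km (X n h))) {\<psi>'. real (Err n (k n) (\<psi> n) \<psi>') \<le> 288 * n * \<kappa> n}"
    proof (rule recovery_probability[OF P_bounds(1) T_def T_small _ a_gap_pos _ kap(1) _ refl _ eK(2)])
      show "0 < d" using d_ge_L ln_large(1) by linarith
      show "real (k n) * (14 * T / (real s * a_gap))\<^sup>2 \<le> \<kappa> n" using signal_to_noise unfolding kap_eq .
      show "\<kappa> n \<le> 1 / 400" "147 * (12 * sqrt (\<kappa> n))\<^sup>2 \<le> 3" using kap by (auto simp: power_mult_distrib)
      show "set_pmf (km Xb) \<subseteq> few_rows_mats n (k n) (k n)" if "Xb \<in> carrier_mat n (k n)" for Xb
        by (rule supp[OF _ that]) (use K_pos in simp)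
      show "1 - K\<^sub>0 * sqrt (12 * sqrt (\<kappa> n)) \<le> measure_pmf.prob (km Xb)
             {S. frobenius_norm (Xb - S) \<le> sqrt ((1 - (12 * sqrt (\<kappa> n))\<^sup>2) / (1 - 37 * (12 * sqrt (\<kappa> n))\<^sup>2)) * kmeans_eta (k n) Xb}"
        if "2 \<le> k n" "Xb \<in> carrier_mat n (k n)" "kmeans_eta (k n) Xb \<le> 12 * sqrt (\<kappa> n) * kmeans_eta (k n - 1) Xb" for Xb
        by (rule guar[OF _ kap(3) that]) (use kap in simp)
      show "smallest_eigenvectors n (k n) (laplacian n (M n) h) (X n h)" for h using X n by blast
    qed
    then show ?thesis using failure_le True by (simp add: f_def e_def)
  next
    case False
    then show ?thesis by (simp add: f_def)
  qed
  with eo fo show ?thesis by blast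
qed

theorem corollary5p2:
  shows
    "(\<forall>n k M \<psi> p q \<alpha>.
        balanced_classes n k \<psi> \<and> 2 * k \<le> n \<and> 2 \<le> M \<and>
        0 < p \<and> p < 1 \<and> 0 < q \<and> q < 1 \<and> p + q \<le> 1 \<and>
        (\<forall>m\<in>{2..M}. 0 < \<alpha> m \<and> \<alpha> m \<le> 1)
        \<longrightarrow> planted_delta n k M \<psi> p q \<alpha> > 0)
     \<and>
     (\<exists>C>0. \<forall>(N :: nat set) (k :: nat \<Rightarrow> nat) (M :: nat \<Rightarrow> nat) (\<psi> :: nat \<Rightarrow> nat \<Rightarrow> nat)
         (p :: real) (q :: real) (\<theta> :: nat \<Rightarrow> real) (a :: real) (b :: real)
         (\<alpha> :: nat \<Rightarrow> nat \<Rightarrow> real) (r :: nat)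
         (km :: real mat \<Rightarrow> real mat pmf) (X :: nat \<Rightarrow> (nat set \<Rightarrow> bool) \<Rightarrow> real mat).
        infinite N \<and> (\<forall>n\<in>N. 2 \<le> n) \<and>
        0 < p \<and> p < 1 \<and> 0 < q \<and> q < 1 \<and> p + q \<le> 1 \<and>
        (\<forall>n\<in>N. balanced_classes n (k n) (\<psi> n) \<and> 2 \<le> M n) \<and>
        (\<forall>m\<ge>2. 0 \<le> \<theta> m) \<and> (\<exists>m\<ge>2. 0 < \<theta> m) \<and> r = (LEAST m. 2 \<le> m \<and> 0 < \<theta> m) \<and>
        1 \<le> a \<and> 2 \<le> b \<and>
        (\<forall>n\<in>N. \<forall>m\<in>{2..M n}. 0 \<le> \<alpha> n m \<and> \<alpha> n m \<le> 1 \<and>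
           \<alpha> n m = \<theta> m * real n powr a * ln (real n) powr b / real (n choose m)) \<and>
        (\<forall>n\<in>N. r \<le> M n \<and>
           (\<Sum>m=r..M n. real m * \<theta> m)
             \<le> C * (real n powr (a - 1) * ln (real n) powr (b - 2) / real (k n) ^ (2 * r - 1))) \<and>
        kmeans_with_guarantee km \<and>
        (\<forall>n\<in>N. \<forall>h. smallest_eigenvectors n (k n) (laplacian n (M n) h) (X n h))
        \<longrightarrow>
        (\<exists>(e :: nat \<Rightarrow> real) (f :: nat \<Rightarrow> real).
           e \<in> o[inf sequentially (principal N)](\<lambda>n. real n) \<and>
           f \<in> o[inf sequentially (principal N)](\<lambda>_. 1) \<and>
           (\<forall>n\<in>N.
              measure_pmf.prob
                (bind_pmf (planted_hypergraph n (M n) (\<psi> n) p q (\<alpha> n))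
                   (\<lambda>h. spectral_labels km (X n h)))
                {\<psi>'. real (Err n (k n) (\<psi> n) \<psi>') \<le> e n}
              \<ge> 1 - f n)))"
proof (intro conjI allI impI)
  fix n k M \<psi> and p q :: real and \<alpha> :: "nat \<Rightarrow> real"
  assume A: "balanced_classes n k \<psi> \<and> 2 * k \<le> n \<and> 2 \<le> M \<and>
        0 < p \<and> p < 1 \<and> 0 < q \<and> q < 1 \<and> p + q \<le> 1 \<and>
        (\<forall>m\<in>{2..M}. 0 < \<alpha> m \<and> \<alpha> m \<le> 1)"
  then have k: "0 < k" by (simp add: balanced_classes_def)
  interpret planted_model n k M \<psi> p q \<alpha>
  proof unfold_locales
    show "0 < n" using A k by linarith
  qed (use A in \<open>auto simp: less_imp_le\<close>)
  have "2 \<le> s" using A k unfolding s_def by (simp add: less_eq_div_iff_mult_less_eq)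
  then show "0 < planted_delta n k M \<psi> p q \<alpha>"
    using A by (intro planted_delta_pos) auto
next
  show "\<exists>C>0. \<forall>(N :: nat set) (k :: nat \<Rightarrow> nat) (M :: nat \<Rightarrow> nat) (\<psi> :: nat \<Rightarrow> nat \<Rightarrow> nat)
         (p :: real) (q :: real) (\<theta> :: nat \<Rightarrow> real) (a :: real) (b :: real)
         (\<alpha> :: nat \<Rightarrow> nat \<Rightarrow> real) (r :: nat)
         (km :: real mat \<Rightarrow> real mat pmf) (X :: nat \<Rightarrow> (nat set \<Rightarrow> bool) \<Rightarrow> real mat).
        infinite N \<and> (\<forall>n\<in>N. 2 \<le> n) \<and>
        0 < p \<and> p < 1 \<and> 0 < q \<and> q < 1 \<and> p + q \<le> 1 \<and>
        (\<forall>n\<in>N. balanced_classes n (k n) (\<psi> n) \<and> 2 \<le> M n) \<and>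
        (\<forall>m\<ge>2. 0 \<le> \<theta> m) \<and> (\<exists>m\<ge>2. 0 < \<theta> m) \<and> r = (LEAST m. 2 \<le> m \<and> 0 < \<theta> m) \<and>
        1 \<le> a \<and> 2 \<le> b \<and>
        (\<forall>n\<in>N. \<forall>m\<in>{2..M n}. 0 \<le> \<alpha> n m \<and> \<alpha> n m \<le> 1 \<and>
           \<alpha> n m = \<theta> m * real n powr a * ln (real n) powr b / real (n choose m)) \<and>
        (\<forall>n\<in>N. r \<le> M n \<and>
           (\<Sum>m=r..M n. real m * \<theta> m)
             \<le> C * (real n powr (a - 1) * ln (real n) powr (b - 2) / real (k n) ^ (2 * r - 1))) \<and>
        kmeans_with_guarantee km \<and>
        (\<forall>n\<in>N. \<forall>h. smallest_eigenvectors n (k n) (laplacian n (M n) h) (X n h))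
        \<longrightarrow>
        (\<exists>(e :: nat \<Rightarrow> real) (f :: nat \<Rightarrow> real).
           e \<in> o[inf sequentially (principal N)](\<lambda>n. real n) \<and>
           f \<in> o[inf sequentially (principal N)](\<lambda>_. 1) \<and>
           (\<forall>n\<in>N.
              measure_pmf.prob
                (bind_pmf (planted_hypergraph n (M n) (\<psi> n) p q (\<alpha> n))
                   (\<lambda>h. spectral_labels km (X n h)))
                {\<psi>'. real (Err n (k n) (\<psi> n) \<psi>') \<le> e n}
              \<ge> 1 - f n))"
    by (rule exI[of _ 1], intro conjI allI impI, simp, elim conjE, rule spectral_consistency) (assumption | simp only: mult_1)+
qed

end
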